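(* Let $1<p<2$, let $0<\kappa<\frac{1}{3p}$ and let $d>0$. There exist positive constants $C_1,C_2,C_3$ such that for any $n\ge1$, if $n^{-\kappa}\le\delta\le1$, then the event $$\max_{x\in\mathbb{R}^n:\ \mathrm{dist}(x,\mathcal{O})\ge\delta,\ \|x\|_p=1}\langle G_nx,x\rangle\le 2^{\frac12-\frac2p}\bigl(1-C_1\delta^6\bigr)\xi_{p^*}n^{1/p^*}+C_2n^{p/(2p^* )}\sqrt{\log n}$$ occurs with probability at least $1-C_3n^{-d}$.
   Context: $G_n=(g_{ij})_{i,j\in[n]}$ is an $n\times n$ matrix with i.i.d. standard Gaussian entries, $[n]=\{1,\dots,n\}$, and $\bar G_n=(G_n+G_n^T)/\sqrt2$ has entries $\bar g_{ij}$. $p^*$ is the Hölder conjugate of $p$, $1/p+1/p^*=1$; $\|x\|_p=(\sum_i|x_i|^p)^{1/p}$; $e_1,\dots,e_n$ is the standard basis of $\mathbb{R}^n$; $\xi_q=(\mathbb{E}|z|^q)^{1/q}$ for a standard Gaussian variable $z$. Set $\mathrm{sgn}(a)=1$ if $a\ge0$ and $-1$ if $a<0$. For $i\in[n]$ define $v_i\in\mathbb{R}^n$ by $$v_i(j)=\mathrm{sgn}(\bar g_{ij})\Bigl(\frac{|\bar g_{ij}|^{p^*}}{\|\bar G_ne_i\|_{p^*}^{p^*}}\Bigr)^{1/p},\quad j\in[n],$$ so $\|v_i\|_p=1$, and $$\mathcal{O}=\Bigl\{\pm\frac{e_i+v_i}{\|e_i+v_i\|_p}:1\le i\le n\Bigr\},\qquad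 \mathrm{dist}(x,\mathcal{O})=\min_{y\in\mathcal{O}}\|x-y\|_p.$$ The constants do not depend on $n$ or $\delta$ (they may depend on $p,\kappa,d$). *)

theory Defs
  imports "HOL-Probability.Probability"
begin

text \<open>
  The constants of the theorem are uniform in the dimension, so \<open>n\<close> is a term and not a type.
  A vector of \<open>\<real>\<^sup>n\<close> is a function \<open>x :: nat \<Rightarrow> real\<close> and an \<open>n \<times> n\<close> matrix a function
  \<open>A :: nat \<Rightarrow> nat \<Rightarrow> real\<close>; only the values at indices in \<open>{1..n}\<close> matter, and every norm, product
  and inner product below ignores all other values.
\<close>

definition pnorm :: "nat \<Rightarrow> real \<Rightarrow> (nat \<Rightarrow> real) \<Rightarrow> real" where
  "pnorm n p x = (\<Sum>i\<in>{1..n}. \<bar>x i\<bar> powr p) powr (1 / p)"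

definition inner_prod :: "nat \<Rightarrow> (nat \<Rightarrow> real) \<Rightarrow> (nat \<Rightarrow> real) \<Rightarrow> real" where
  "inner_prod n x y = (\<Sum>i\<in>{1..n}. x i * y i)"

definition mat_vec :: "nat \<Rightarrow> (nat \<Rightarrow> nat \<Rightarrow> real) \<Rightarrow> (nat \<Rightarrow> real) \<Rightarrow> nat \<Rightarrow> real" where
  "mat_vec n A x = (\<lambda>i. \<Sum>j\<in>{1..n}. A i j * x j)"

definition basis_vec :: "nat \<Rightarrow> nat \<Rightarrow> real" where
  "basis_vec i = (\<lambda>j. if j = i then 1 else 0)"

definition gaussian_matrix ::
    "'a measure \<Rightarrow> nat \<Rightarrow> (nat \<Rightarrow> nat \<Rightarrow> 'a \<Rightarrow> real) \<Rightarrow> bool" where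
  "gaussian_matrix M n g \<longleftrightarrow>
     prob_space M \<and>
     prob_space.indep_vars M (\<lambda>_. borel) (\<lambda>(i, j). g i j) ({1..n} \<times> {1..n}) \<and>
     (\<forall>i\<in>{1..n}. \<forall>j\<in>{1..n}. distributed M lborel (g i j) std_normal_density)"

definition gauss_xi :: "real \<Rightarrow> real" where
  "gauss_xi q = (\<integral>z. \<bar>z\<bar> powr q \<partial>density lborel std_normal_density) powr (1 / q)"

definition sym_mat :: "(nat \<Rightarrow> nat \<Rightarrow> real) \<Rightarrow> nat \<Rightarrow> nat \<Rightarrow> real" where
  "sym_mat G = (\<lambda>i j. (G i j + G j i) / sqrt 2)"

text \<open>Unlike the library's \<^const>\<open>sgn\<close>, this sign function takes the value 1 at 0.\<close>

definition sgn1 :: "real \<Rightarrow> real" where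
  "sgn1 a = (if a \<ge> 0 then 1 else -1)"

text \<open>In the following definitions \<open>q\<close> is the Hoelder conjugate of \<open>p\<close>.\<close>

definition opt_vec :: "nat \<Rightarrow> real \<Rightarrow> real \<Rightarrow> (nat \<Rightarrow> nat \<Rightarrow> real) \<Rightarrow> nat \<Rightarrow> nat \<Rightarrow> real" where
  "opt_vec n p q G i = (\<lambda>j. sgn1 (sym_mat G i j) *
     (\<bar>sym_mat G i j\<bar> powr q / pnorm n q (mat_vec n (sym_mat G) (basis_vec i)) powr q) powr (1 / p))"

text \<open>
  If \<open>e\<^sub>i + v\<^sub>i = 0\<close>, the convention \<open>x / 0 = 0\<close> makes the corresponding point the zero vector.
  This has probability 0 unless \<open>n = 1\<close>.
\<close>

definition opt_point :: "nat \<Rightarrow> real \<Rightarrow> real \<Rightarrow> (nat \<Rightarrow> nat \<Rightarrow> real) \<Rightarrow> nat \<Rightarrow> nat \<Rightarrow> real" where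
  "opt_point n p q G i =
     (let w = (\<lambda>j. basis_vec i j + opt_vec n p q G i j) in (\<lambda>j. w j / pnorm n p w))"

definition opt_set :: "nat \<Rightarrow> real \<Rightarrow> real \<Rightarrow> (nat \<Rightarrow> nat \<Rightarrow> real) \<Rightarrow> (nat \<Rightarrow> real) set" where
  "opt_set n p q G =
     (\<Union>i\<in>{1..n}. {opt_point n p q G i, (\<lambda>j. - opt_point n p q G i j)})"

definition pdist_set :: "nat \<Rightarrow> real \<Rightarrow> (nat \<Rightarrow> real) \<Rightarrow> (nat \<Rightarrow> real) set \<Rightarrow> real" where
  "pdist_set n p x S = (MIN y\<in>S. pnorm n p (\<lambda>j. x j - y j))"

text \<open>
  The supremum is a maximum whenever the constraint set is nonempty, by compactness. It is taken
  in \<^typ>\<open>ereal\<close> because the constraint set can be empty; the value is then \<open>-\<infinity>\<close>.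
\<close>

definition max_far_form :: "nat \<Rightarrow> real \<Rightarrow> real \<Rightarrow> real \<Rightarrow> (nat \<Rightarrow> nat \<Rightarrow> real) \<Rightarrow> ereal" where
  "max_far_form n p q \<delta> G =
     (SUP x\<in>{x. pdist_set n p x (opt_set n p q G) \<ge> \<delta> \<and> pnorm n p x = 1}.
        ereal (inner_prod n (mat_vec n G x) x))"

end

theory Submission
  imports Defs "HOL-Real_Asymp.Real_Asymp"
begin

text \<open>
  Split a unit vector as \<open>x = y + u + z\<close> with entries of \<open>y\<close> above \<open>n powr (- 1 / q)\<close>, those of \<open>z\<close> below
  \<open>1 / sqrt n\<close> and those of \<open>u\<close> in between. A union bound over sign vectors and a dyadic decomposition
  show that all contributions to the form other than the cross term of \<open>y\<close> and \<open>z\<close> are of the order of the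
  error term. In the cross term \<open>y\<close> has at most \<open>n powr (p - 1)\<close> nonzero entries, so a net of such \<open>y\<close>
  costs only the error term again; for fixed \<open>y\<close> Young's inequality, with the multiplier that is optimal at
  \<open>\<parallel>z\<parallel>\<^sup>p = 1 / 2\<close> and truncated because the entries of \<open>z\<close> are small, reduces the supremum over \<open>z\<close> to a sum
  of independent sub-Gaussian variables. This bounds the cross term by
  the second norm of \<open>y\<close> times \<open>\<xi>\<^sub>q n powr (1 / q)\<close> times an explicit function of \<open>\<parallel>z\<parallel>\<^sup>p\<close>.

  If the bound is nearly attained, then \<open>u\<close> is small, \<open>y\<close> is dominated by one coordinate \<open>i\<close>, both \<open>y\<close> and \<open>z\<close>
  carry about half of the mass, and strict convexity of \<open>\<bar>\<cdot>\<bar>\<^sup>p\<close> forces \<open>z\<close> to be near a multiple of \<open>v\<^sub>i\<close>; hence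
  \<open>x\<close> is near one of the candidate points.
\<close>

section \<open>Bilinear forms bounded on sign vectors\<close>

text \<open>All randomness is confined to the events \<open>sign_bound\<close> and
  \<open>young_bound\<close>; on them the argument is deterministic. A net for z is unaffordable, as
  z may have n nonzero entries, so Young's inequality eliminates z and leaves one number per
  coordinate. Untruncated, that number is a multiple of |w|^q for a Gaussian w, which has no
  exponential moments because q > 2; the bound n powr (-1 / 2) on the entries of z caps it by a
  linear function of |w| and makes Chernoff's bound available. The two thresholds are the values at
  which both crude estimates, for large and for small entries, have exactly the order of the error
  term.

  On the exponent 6: the minor coordinates of y are estimated only through their norm, so a relative
  loss of s^2 allows terms linear in s, and strict convexity turns these into a distance of order
  sqrt s. The choice s = c \<delta>^3 keeps this below \<delta>. The lower bound on \<delta> is due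
  to the overlap of e_i and v_i in coordinate i, which disturbs the normalization of a candidate by
  n powr (-1 / p) up to logarithms.\<close>

definition bilin :: "nat \<Rightarrow> (nat \<Rightarrow> nat \<Rightarrow> real) \<Rightarrow> (nat \<Rightarrow> real) \<Rightarrow> (nat \<Rightarrow> real) \<Rightarrow> real" where
  "bilin n G a b = (\<Sum>i\<in>{1..n}. \<Sum>j\<in>{1..n}. a i * G i j * b j)"

definition supp :: "nat \<Rightarrow> (nat \<Rightarrow> real) \<Rightarrow> nat set" where
  "supp n a = {i \<in> {1..n}. a i \<noteq> 0}"

abbreviation nnz :: "nat \<Rightarrow> (nat \<Rightarrow> real) \<Rightarrow> real" where
  "nnz n a \<equiv> real (card (supp n a))"

abbreviation psum :: "nat \<Rightarrow> real \<Rightarrow> (nat \<Rightarrow> real) \<Rightarrow> real" where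
  "psum n p v \<equiv> (\<Sum>i\<in>{1..n}. \<bar>v i\<bar> powr p)"

text \<open>Entries outside the index range are fixed at 0: vectors are total functions, and this
  makes the sets finite for finite V, as the union bounds require.\<close>

definition vecs :: "nat \<Rightarrow> real set \<Rightarrow> (nat \<Rightarrow> real) set" where
  "vecs n V = {a. (\<forall>i\<in>{1..n}. a i \<in> V) \<and> (\<forall>i. i \<notin> {1..n} \<longrightarrow> a i = 0)}"

text \<open>For supports of sizes k and l the form is Gaussian with variance k l, and the number of
  such pairs is n to a power of order k + l; the right-hand side is the deviation that survives this
  union bound.\<close>

definition sign_bound :: "nat \<Rightarrow> real \<Rightarrow> (nat \<Rightarrow> nat \<Rightarrow> real) \<Rightarrow> bool" where
  "sign_bound n A G \<longleftrightarrow> (\<forall>a\<in>vecs n {-1, 0, 1}. \<forall>b\<in>vecs n {-1, 0, 1}.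
     bilin n G a b \<le> A * sqrt (nnz n a * nnz n b *
       (nnz n a + nnz n b) * ln (real n)))"

lemma finite_supp [simp]: "finite (supp n a)" by (simp add: supp_def)

lemma sgn1_mult_self: "sgn1 x * x = \<bar>x\<bar>" by (simp add: sgn1_def)

lemma mult_le_sgn1:
  assumes "\<bar>x\<bar> \<le> (\<alpha>::real)"
  shows "x * u \<le> \<alpha> * ((if x \<noteq> 0 then sgn1 u else 0) * u)"
proof (cases "x = 0")
  case False
  have "x * u \<le> \<bar>x\<bar> * \<bar>u\<bar>" by (metis abs_ge_self abs_mult)
  also have "\<dots> \<le> \<alpha> * \<bar>u\<bar>" using assms by (intro mult_right_mono) auto
  finally show ?thesis using False by (simp add: sgn1_mult_self)
qed simp

lemma bilin_swap: "bilin n G a b = (\<Sum>j\<in>{1..n}. b j * (\<Sum>i\<in>{1..n}. a i * G i j))"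
  unfolding bilin_def by (subst sum.swap) (simp add: sum_distrib_left mult_ac)

lemma bilin_left: "bilin n G a b = (\<Sum>i\<in>{1..n}. a i * (\<Sum>j\<in>{1..n}. G i j * b j))"
  unfolding bilin_def by (simp add: sum_distrib_left mult_ac)

text \<open>The form is linear in each argument, so over a box it is largest at a vertex. Each
  argument is replaced in turn by a multiple of a sign vector with the same support, which leaves
  the support sizes in the bound unchanged.\<close>

lemma bilin_box_bound:
  assumes sb: "sign_bound n A G" and "0 \<le> \<alpha>" "0 \<le> \<beta>"
    and x: "\<And>i. i \<in> {1..n} \<Longrightarrow> \<bar>x i\<bar> \<le> \<alpha>" and y: "\<And>i. i \<in> {1..n} \<Longrightarrow> \<bar>y i\<bar> \<le> \<beta>"
  shows "bilin n G x y \<le> \<alpha> * \<beta> * (A * sqrt (nnz n x * nnz n y *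
       (nnz n x + nnz n y) * ln (real n)))"
proof -
  define u where "u i = (\<Sum>j\<in>{1..n}. G i j * y j)" for i
  define a where "a i = (if i \<in> {1..n} then if x i \<noteq> 0 then sgn1 (u i) else 0 else 0)" for i
  define c where "c j = (\<Sum>i\<in>{1..n}. a i * G i j)" for j
  define b where "b j = (if j \<in> {1..n} then if y j \<noteq> 0 then sgn1 (c j) else 0 else 0)" for j
  have av: "a \<in> vecs n {-1, 0, 1}" "b \<in> vecs n {-1, 0, 1}" by (auto simp: a_def b_def vecs_def sgn1_def)
  have sa: "supp n a = supp n x" "supp n b = supp n y"
    by (auto simp: a_def b_def supp_def sgn1_def split: if_splits)
  have "bilin n G x y = (\<Sum>i\<in>{1..n}. x i * u i)" by (simp add: bilin_left u_def)
  also have "\<dots> \<le> (\<Sum>i\<in>{1..n}. \<alpha> * (a i * u i))"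
  proof (intro sum_mono)
    fix i assume "i \<in> {1..n}"
    then show "x i * u i \<le> \<alpha> * (a i * u i)" using mult_le_sgn1[OF x, of i "u i"] by (simp add: a_def)
  qed
  also have "\<dots> = \<alpha> * bilin n G a y" by (simp add: bilin_left u_def sum_distrib_left)
  also have "bilin n G a y = (\<Sum>j\<in>{1..n}. y j * c j)" by (simp add: bilin_swap c_def)
  also have "\<alpha> * \<dots> \<le> \<alpha> * (\<Sum>j\<in>{1..n}. \<beta> * (b j * c j))"
  proof (intro mult_left_mono sum_mono)
    fix i assume "i \<in> {1..n}"
    then show "y i * c i \<le> \<beta> * (b i * c i)" using mult_le_sgn1[OF y, of i "c i"] by (simp add: b_def)
  qed (use assms in auto)
  also have "\<dots> = \<alpha> * \<beta> * bilin n G a b" by (simp add: bilin_swap c_def sum_distrib_left mult_ac)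
  also have "\<dots> \<le> \<alpha> * \<beta> * (A * sqrt (nnz n a * nnz n b *
       (nnz n a + nnz n b) * ln (real n)))"
    using sb av assms(2,3) unfolding sign_bound_def by (intro mult_left_mono) auto
  finally show ?thesis by (simp add: sa)
qed

text \<open>Two one-point supports: their sizes give 1 * 1 * (1 + 1) under the root. The factor
  \<open>s\<close> covers both signs of the entry.\<close>

lemma entry_bound:
  assumes sb: "sign_bound n A G" and "i \<in> {1..n}" "j \<in> {1..n}"
  shows "\<bar>G i j\<bar> \<le> A * sqrt (2 * ln (real n))"
proof -
  define e :: "nat \<Rightarrow> real" where "e k = (if k = j then 1 else 0)" for k
  have "s * G i j \<le> A * sqrt (2 * ln (real n))" if "\<bar>s\<bar> = 1" for s :: real
  proof -
    define f :: "nat \<Rightarrow> real" where "f k = (if k = i then s else 0)" for k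
    have s: "supp n e = {j}" "supp n f = {i}" using assms that by (auto simp: supp_def e_def f_def)
    have "bilin n G f e = (\<Sum>k\<in>{1..n}. f k * G k j)"
      unfolding bilin_left e_def using assms(3) by (simp add: if_distrib[of "\<lambda>x. _ * x"] cong: if_cong)
    also have "\<dots> = (\<Sum>k\<in>{1..n}. if k = i then s * G i j else 0)" unfolding f_def by (intro sum.cong) auto
    also have "\<dots> = s * G i j" using assms by simp
    finally have "bilin n G f e = s * G i j" .
    moreover have "bilin n G f e \<le> 1 * 1 * (A * sqrt (nnz n f * nnz n e *
       (nnz n f + nnz n e) * ln (real n)))"
      using that by (intro bilin_box_bound[OF sb]) (auto simp: e_def f_def)
    ultimately show ?thesis by (simp add: s)
  qed
  from this[of 1] this[of "-1"] show ?thesis by (auto simp: abs_if)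
qed

section \<open>Bilinearity and the dyadic estimate of the form\<close>

lemma bilin_sum_left: "bilin n G (\<lambda>i. \<Sum>l\<in>I. f l i) b = (\<Sum>l\<in>I. bilin n G (f l) b)"
  unfolding bilin_left by (simp add: sum_distrib_right sum.swap[of _ _ I])

lemma bilin_sum_right: "bilin n G a (\<lambda>i. \<Sum>l\<in>I. f l i) = (\<Sum>l\<in>I. bilin n G a (f l))"
  unfolding bilin_swap by (simp add: sum_distrib_right sum.swap[of _ _ I])

lemma bilin_uminus_left: "bilin n G (\<lambda>i. - a i) b = - bilin n G a b" by (simp add: bilin_def sum_negf)

lemma bilin_add_left: "bilin n G (\<lambda>i. a i + a' i) b = bilin n G a b + bilin n G a' b"
  by (simp add: bilin_def sum.distrib ring_distribs)

lemma bilin_add_right: "bilin n G a (\<lambda>i. b i + b' i) = bilin n G a b + bilin n G a b'"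
  by (simp add: bilin_def sum.distrib ring_distribs)

text \<open>Markov's inequality for the counting measure.\<close>

lemma card_supp_le:
  fixes v :: "nat \<Rightarrow> real"
  assumes "0 < (s::real)" "0 < p" and "psum n p v \<le> 1"
    and "S \<subseteq> {1..n}" and "\<And>i. i \<in> S \<Longrightarrow> s \<le> \<bar>v i\<bar>"
  shows "real (card S) \<le> s powr (- p)"
proof -
  have fin: "finite S" by (rule finite_subset[OF assms(4)]) simp
  have "real (card S) * s powr p = (\<Sum>i\<in>S. s powr p)" by simp
  also have "\<dots> \<le> (\<Sum>i\<in>S. \<bar>v i\<bar> powr p)" using assms by (intro sum_mono powr_mono2) auto
  also have "\<dots> \<le> psum n p v" using assms by (intro sum_mono2) auto
  also have "\<dots> \<le> 1" by fact
  finally show ?thesis using assms(1) by (simp add: powr_minus field_simps)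
qed

lemma dyadic_between:
  assumes "1 \<le> (x::real)"
  shows "\<exists>M::nat. 2 ^ M \<le> x \<and> x \<le> 2 ^ Suc M"
proof -
  define M where "M = nat \<lfloor>log 2 x\<rfloor>"
  have l: "0 \<le> log 2 x" using assms by simp
  have "real M \<le> log 2 x" "log 2 x \<le> real (Suc M)" using l unfolding M_def by linarith+
  then have "2 powr real M \<le> x" "x \<le> 2 powr real (Suc M)"
    using assms by (simp_all add: le_log_iff log_le_iff del: of_nat_Suc)
  then show ?thesis by (subst (asm) (1 2) powr_realpow) auto
qed

text \<open>The leading 2 counts the two mirror-image double series, 2 powr (3 * p / 2) comes from
  the level sizes, and the other factors bound the geometric series with ratios 2 powr (p / 2 - 1) <
  1 and 2 powr (p - 1) > 1.\<close>

definition crude_const :: "real \<Rightarrow> real" where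
  "crude_const p = 2 * 2 powr (3 * p / 2) * 2 powr (p - 1) / ((1 - 2 powr (p / 2 - 1)) * (2 powr (p - 1) - 1))"

text \<open>Level l has at most K P^(2 l) entries with P = 2 powr (p / 2). Replacing the root of a
  sum by a sum of roots leaves products of a function of l and a function of l', so that the double
  sum over levels factorizes.\<close>

lemma sqrt_level_le:
  assumes "0 \<le> a" "0 \<le> b" "a \<le> K * P ^ (2 * l)" "b \<le> K * P ^ (2 * l')" "0 \<le> K" "0 \<le> (P::real)"
  shows "sqrt (a * b * (a + b)) \<le> K powr (3/2) * (P ^ l * P ^ l' * (P ^ l + P ^ l'))"
proof -
  have "a * b * (a + b) \<le> (K * P ^ (2 * l)) * (K * P ^ (2 * l')) * (K * P ^ (2 * l) + K * P ^ (2 * l'))"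
    using assms by (intro mult_mono add_mono) auto
  also have "\<dots> \<le> K ^ 3 * (P ^ l * P ^ l' * (P ^ l + P ^ l'))\<^sup>2"
  proof -
    have "(K * P ^ (2 * l)) * (K * P ^ (2 * l')) * (K * P ^ (2 * l) + K * P ^ (2 * l'))
      = K ^ 3 * ((P^l)\<^sup>2 * (P^l')\<^sup>2 * ((P^l)\<^sup>2 + (P^l')\<^sup>2))"
      unfolding power_even_eq power3_eq_cube by algebra
    moreover have "(P^l)\<^sup>2 + (P^l')\<^sup>2 \<le> (P^l + P^l')\<^sup>2" using assms by (simp add: power2_sum)
    ultimately show ?thesis using assms by (auto simp: power_mult_distrib intro!: mult_left_mono)
  qed
  also have "K ^ 3 = (K powr (3/2))\<^sup>2"
    using assms by (cases "K = 0") (simp_all add: powr_powr flip: powr_realpow powr_numeral)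
  finally have "a * b * (a + b) \<le> (K powr (3/2) * (P ^ l * P ^ l' * (P ^ l + P ^ l')))\<^sup>2"
    by (simp add: power_mult_distrib)
  then show ?thesis using assms by (intro real_le_lsqrt) auto
qed

text \<open>Dyadic decomposition of \<open>v\<close>: pairs of levels contribute a double geometric sum, dominated by
  the largest entries on one side and the smallest ones on the other.\<close>

lemma bilin_crude:
  assumes sb: "sign_bound n A G" and p: "1 < p" "p < 2" and n: "n \<ge> 1" and A: "0 \<le> A"
    and v1: "psum n p v \<le> 1"
    and hi: "\<And>i. i \<in> {1..n} \<Longrightarrow> \<bar>v i\<bar> \<le> hi" and lo: "0 < lo" "lo \<le> hi"
    and cv: "nnz n v \<le> lo powr (- p)"
  shows "\<bar>bilin n G v v\<bar> \<le> crude_const p * A * sqrt (ln (real n)) * hi powr (1 - p / 2) * lo powr (1 - p)"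
proof -
  have hi0: "0 < hi" using lo by simp
  obtain M :: nat where M: "2 ^ M \<le> hi / lo" "hi / lo \<le> 2 ^ Suc M"
    using dyadic_between[of "hi / lo"] lo by auto
  \<comment> \<open>Level l < M holds the entries of size in (hi / 2^(l + 1), hi / 2^l]; level M
    also takes everything smaller, zeros included, so finitely many levels suffice.\<close>
  define lev where "lev i = (LEAST l. l = M \<or> hi / 2 ^ Suc l < \<bar>v i\<bar>)" for i
  define f where "f l i = (if lev i = l then v i else 0)" for l i
  have lev: "lev i = M \<or> hi / 2 ^ Suc (lev i) < \<bar>v i\<bar>" for i
    unfolding lev_def by (rule LeastI[of _ M]) simp
  have levM: "lev i \<le> M" for i unfolding lev_def by (rule Least_le) simp
  have lev2: "\<bar>v i\<bar> \<le> hi / 2 ^ lev i" if "i \<in> {1..n}" for i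
  proof (cases "lev i")
    case 0 then show ?thesis using hi that by simp
  next
    case (Suc k)
    then have "\<not> (k = M \<or> hi / 2 ^ Suc k < \<bar>v i\<bar>)" unfolding lev_def by (intro not_less_Least) simp
    then show ?thesis using Suc by simp
  qed
  have v: "v = (\<lambda>i. \<Sum>l\<in>{..M}. f l i)" using levM by (auto simp: f_def fun_eq_iff)
  define K where "K = (hi / 2) powr (- p)"
  define P :: real where "P = 2 powr (p / 2)"
  have P2: "P\<^sup>2 = 2 powr p" by (simp add: P_def powr_powr flip: powr_numeral)
  have K0: "0 \<le> K" by (simp add: K_def)
  have Kl: "(hi / 2 ^ Suc l) powr (- p) = K * P ^ (2 * l)" for l
  proof -
    have "(hi / 2 ^ Suc l) powr (- p) = (hi / 2 * 2 powr (- real l)) powr (- p)"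
      by (simp add: powr_minus powr_realpow divide_simps)
    also have "\<dots> = K * 2 powr (real l * p)"
      using hi0 by (subst powr_mult) (simp_all add: K_def powr_powr)
    also have "2 powr (real l * p) = P ^ (2 * l)"
      by (simp only: power_mult P2) (simp add: powr_powr mult.commute flip: powr_realpow)
    finally show ?thesis .
  qed
  have cf: "nnz n (f l) \<le> K * P ^ (2 * l)" if "l \<le> M" for l
  \<comment> \<open>The last level has no lower bound on its entries; its size is controlled by the
    hypothesis on the whole support.\<close>
  proof (cases "l = M")
    case True
    have "supp n (f l) \<subseteq> supp n v" by (auto simp: supp_def f_def)
    then have "nnz n (f l) \<le> nnz n v" by (simp add: card_mono)
    also have "\<dots> \<le> lo powr (- p)" by fact
    also have "\<dots> \<le> (hi / 2 ^ Suc M) powr (- p)"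
      using M lo hi0 p by (intro powr_mono2') (auto simp: field_simps)
    finally show ?thesis using Kl[of M] True by simp
  next
    case False
    have "nnz n (f l) \<le> (hi / 2 ^ Suc l) powr (- p)"
    proof (rule card_supp_le)
      show "psum n p v \<le> 1" by fact
      fix i assume "i \<in> supp n (f l)"
      then have "lev i = l" by (auto simp: supp_def f_def split: if_splits)
      then show "hi / 2 ^ Suc l \<le> \<bar>v i\<bar>" using lev[of i] False by simp
    qed (use hi0 p in \<open>auto simp: supp_def\<close>)
    then show ?thesis using Kl by simp
  qed
  \<comment> \<open>Entry size 2^(-l) times the counting factor P^l or P^(2 l) gives \<alpha>^l or
    \<beta>^l. Since 1 < p < 2, the first series decreases and the second increases.\<close>
  define \<alpha> where "\<alpha> = P / 2"
  define \<beta> where "\<beta> = P\<^sup>2 / 2"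
  have \<alpha>: "\<alpha> = 2 powr (p / 2 - 1)" by (simp add: \<alpha>_def P_def powr_diff)
  have \<beta>: "\<beta> = 2 powr (p - 1)" by (simp add: \<beta>_def P2 powr_diff)
  have \<alpha>0: "0 < \<alpha>" and \<beta>0: "0 < \<beta>" by (simp_all add: \<alpha> \<beta>)
  have "2 powr (p / 2 - 1) < 2 powr (0::real)" using p by (intro powr_less_mono) auto
  then have \<alpha>1: "\<alpha> < 1" by (simp add: \<alpha>)
  have "2 powr (0::real) < 2 powr (p - 1)" using p by (intro powr_less_mono) auto
  then have \<beta>1: "1 < \<beta>" by (simp add: \<beta>)
  define T where "T = hi\<^sup>2 * K powr (3/2) * (A * sqrt (ln (real n)))"
  have L0: "0 \<le> ln (real n)" using n by simp
  have T0: "0 \<le> T" using A L0 by (simp add: T_def)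
  have pair: "\<bar>bilin n G (f l) (f l')\<bar> \<le> T * (\<beta> ^ l * \<alpha> ^ l' + \<alpha> ^ l * \<beta> ^ l')"
    if "l \<le> M" "l' \<le> M" for l l'
  proof -
    define k k' where "k = nnz n (f l)" and "k' = nnz n (f l')"
    have fb: "\<bar>f l i\<bar> \<le> hi / 2 ^ l" if "i \<in> {1..n}" for i l using lev2[OF that] hi0 by (auto simp: f_def)
    have "bilin n G (f l) (f l') \<le> hi / 2 ^ l * (hi / 2 ^ l') * (A * sqrt (k * k' * (k + k') * ln (real n)))"
      unfolding k_def k'_def by (rule bilin_box_bound[OF sb]) (use fb hi0 in auto)
    moreover have "bilin n G (\<lambda>i. - f l i) (f l') \<le> hi / 2 ^ l * (hi / 2 ^ l') * (A * sqrt (k * k' * (k + k') * ln (real n)))"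
      using bilin_box_bound[OF sb, of "hi / 2 ^ l" "hi / 2 ^ l'" "\<lambda>i. - f l i" "f l'"] fb hi0
      unfolding k_def k'_def supp_def by auto
    ultimately have "\<bar>bilin n G (f l) (f l')\<bar> \<le> hi / 2 ^ l * (hi / 2 ^ l') * (A * sqrt (k * k' * (k + k') * ln (real n)))"
      by (simp add: bilin_uminus_left abs_le_iff)
    also have "\<dots> = hi\<^sup>2 * (A * sqrt (ln (real n))) / (2 ^ l * 2 ^ l') * sqrt (k * k' * (k + k'))"
      by (simp add: real_sqrt_mult power2_eq_square)
    also have "\<dots> \<le> hi\<^sup>2 * (A * sqrt (ln (real n))) / (2 ^ l * 2 ^ l') *
        (K powr (3/2) * (P ^ l * P ^ l' * (P ^ l + P ^ l')))" using cf[OF that(1)] cf[OF that(2)] K0 A L0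
      by (intro mult_left_mono sqrt_level_le) (auto simp: k_def k'_def P_def)
    also have "\<dots> = T * (\<beta> ^ l * \<alpha> ^ l' + \<alpha> ^ l * \<beta> ^ l')"
      by (simp add: T_def \<alpha>_def \<beta>_def power_divide power2_eq_square power_mult_distrib field_simps)
    finally show ?thesis .
  qed
  have geo: "(\<Sum>l\<in>{..M}. \<alpha> ^ l) \<le> 1 / (1 - \<alpha>)" using \<alpha>0 \<alpha>1 by (simp add: sum_gp0 divide_right_mono)
  \<comment> \<open>An increasing geometric series is comparable to its last term, and \<beta>^M is
    the power p - 1 of 2^M \<le> hi / lo.\<close>
  have geo2: "(\<Sum>l\<in>{..M}. \<beta> ^ l) \<le> \<beta> * (hi / lo) powr (p - 1) / (\<beta> - 1)"
  proof -
    have "(\<Sum>l\<in>{..M}. \<beta> ^ l) = (\<beta> ^ Suc M - 1) / (\<beta> - 1)" using \<beta>1 by (simp add: sum_gp0 field_simps)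
    also have "\<dots> \<le> \<beta> * \<beta> ^ M / (\<beta> - 1)" using \<beta>1 by (intro divide_right_mono) auto
    also have "\<beta> ^ M = (2 ^ M) powr (p - 1)" by (simp add: \<beta> powr_powr mult.commute flip: powr_realpow)
    also have "\<beta> * (2 ^ M) powr (p - 1) / (\<beta> - 1) \<le> \<beta> * (hi / lo) powr (p - 1) / (\<beta> - 1)"
      using M \<beta>1 p by (intro divide_right_mono mult_left_mono powr_mono2) auto
    finally show ?thesis .
  qed
  have "bilin n G v v = (\<Sum>l\<in>{..M}. \<Sum>l'\<in>{..M}. bilin n G (f l) (f l'))"
    by (subst (1 2) v) (simp only: bilin_sum_left bilin_sum_right)
  also have "\<bar>\<dots>\<bar> \<le> (\<Sum>l\<in>{..M}. \<Sum>l'\<in>{..M}. \<bar>bilin n G (f l) (f l')\<bar>)"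
    by (intro order.trans[OF sum_abs] sum_mono sum_abs)
  also have "\<dots> \<le> (\<Sum>l\<in>{..M}. \<Sum>l'\<in>{..M}. T * (\<beta> ^ l * \<alpha> ^ l' + \<alpha> ^ l * \<beta> ^ l'))"
    by (intro sum_mono pair) auto
  also have "\<dots> = T * ((\<Sum>l\<in>{..M}. \<beta> ^ l) * (\<Sum>l\<in>{..M}. \<alpha> ^ l) + (\<Sum>l\<in>{..M}. \<alpha> ^ l) * (\<Sum>l\<in>{..M}. \<beta> ^ l))"
    by (simp only: sum_product sum.distrib flip: sum_distrib_left)
  also have "\<dots> = T * (2 * ((\<Sum>l\<in>{..M}. \<alpha> ^ l) * (\<Sum>l\<in>{..M}. \<beta> ^ l)))" by (simp add: mult.commute)
  also have "\<dots> \<le> T * (2 * (1 / (1 - \<alpha>) * (\<beta> * (hi / lo) powr (p - 1) / (\<beta> - 1))))"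
    using geo geo2 T0 \<alpha>0 \<alpha>1 \<beta>0 by (intro mult_left_mono mult_mono sum_nonneg) auto
  also have "\<dots> = 2 * \<beta> / ((1 - \<alpha>) * (\<beta> - 1)) * (A * sqrt (ln (real n))) * (hi\<^sup>2 * K powr (3/2) * (hi / lo) powr (p - 1))"
    by (simp add: T_def)
  also have "hi\<^sup>2 * K powr (3/2) * (hi / lo) powr (p - 1) = 2 powr (3 * p / 2) * hi powr (1 - p / 2) * lo powr (1 - p)"
  proof -
    have "hi\<^sup>2 * K powr (3/2) * (hi / lo) powr (p - 1)
      = hi powr 2 * (hi powr (- (3 * p / 2)) * 2 powr (3 * p / 2)) * (hi powr (p - 1) * lo powr (1 - p))"
      using hi0 lo by (simp add: K_def powr_powr powr_divide powr_minus powr_diff field_simps)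
    also have "\<dots> = (hi powr 2 * hi powr (- (3 * p / 2)) * hi powr (p - 1)) * 2 powr (3 * p / 2) * lo powr (1 - p)"
      by simp
    also have "hi powr 2 * hi powr (- (3 * p / 2)) * hi powr (p - 1) = hi powr (1 - p / 2)"
      by (simp add: field_simps flip: powr_add)
    finally show ?thesis by (simp add: mult_ac)
  qed
  finally show ?thesis by (simp add: crude_const_def \<alpha> \<beta> mult_ac)
qed

section \<open>Young and Hoelder inequalities with stability\<close>

text \<open>Young's inequality for the pair x, 1 with exponent k and its conjugate, solved for x
  powr k.\<close>

lemma bernoulli_powr:
  assumes "0 \<le> (x::real)" "1 \<le> k"
  shows "1 + k * (x - 1) \<le> x powr k"
proof (cases "k = 1")
  case True then show ?thesis using assms by simp
next
  case False
  then have k: "1 < k" using assms by simp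
  have "x * 1 \<le> x powr k / k + 1 powr (k / (k - 1)) / (k / (k - 1))"
    using k assms by (intro Youngs_inequality) (auto simp: field_simps)
  then have "k * x \<le> k * (x powr k / k + (k - 1) / k)" using k by (intro mult_left_mono) auto
  also have "\<dots> = x powr k + (k - 1)" using k by (simp add: distrib_left)
  finally show ?thesis by (simp add: algebra_simps)
qed

lemma powr_add_le_4:
  assumes "0 \<le> (s::real)" "0 \<le> v" "0 < p" "p \<le> 2"
  shows "(s + v) powr p \<le> 4 * (s powr p + v powr p)"
proof -
  have "(s + v) powr p \<le> (2 * max s v) powr p" using assms by (intro powr_mono2) auto
  also have "\<dots> = 2 powr p * max s v powr p" by (rule powr_mult)
  also have "\<dots> \<le> 4 * (s powr p + v powr p)"
  proof (intro mult_mono)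
    have "2 powr p \<le> 2 powr (2::real)" using assms by (intro powr_mono) auto
    then show "2 powr p \<le> (4::real)" by simp
  qed (auto simp: max_def)
  finally show ?thesis .
qed

text \<open>Between \<open>u\<close> and \<open>v\<close> the second derivative of \<open>\<bar>\<cdot>\<bar>\<^sup>p / p\<close> is at least
  \<open>(p - 1) (\<bar>u\<bar> + \<bar>v\<bar>) powr (p - 2)\<close>, because \<open>p < 2\<close>.\<close>

lemma abs_powr_strict_convex:
  fixes u v :: real
  assumes p: "1 < p" "p < 2"
  shows "\<bar>v\<bar> powr p / p + sgn1 v * \<bar>v\<bar> powr (p - 1) * (u - v) +
      (p - 1) / 8 * ((u - v)\<^sup>2 * (\<bar>u\<bar> + \<bar>v\<bar>) powr (p - 2)) \<le> \<bar>u\<bar> powr p / p"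
proof -
  have main: "v powr p / p + v powr (p - 1) * (u - v) +
      (p - 1) / 8 * ((u - v)\<^sup>2 * (\<bar>u\<bar> + v) powr (p - 2)) \<le> \<bar>u\<bar> powr p / p"
    if v: "0 \<le> v" for u v :: real
  proof (cases "v = 0")
    case True
    have "(p - 1) / 8 * (u\<^sup>2 * \<bar>u\<bar> powr (p - 2)) = (p - 1) / 8 * \<bar>u\<bar> powr p"
      by (cases "u = 0") (simp_all add: powr_diff)
    also have "\<dots> \<le> 1 / p * \<bar>u\<bar> powr p"
    proof (intro mult_right_mono)
      have "(p - 1) * p \<le> 1 * 2" using p by (intro mult_mono) auto
      then show "(p - 1) / 8 \<le> 1 / p" using p by (simp add: field_simps)
    qed auto
    finally show ?thesis using True by simp
  next
    case False
    then have v: "0 < v" using v by simp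
    show ?thesis
    proof (cases "0 < u")
      case True
      show ?thesis
      proof (cases "u = v")
        case False
        define d :: "nat \<Rightarrow> real \<Rightarrow> real" where
          "d m = (if m = 0 then (\<lambda>t. t powr p / p) else if m = 1 then (\<lambda>t. t powr (p - 1))
             else (\<lambda>t. (p - 1) * t powr (p - 2)))" for m
        define a b where "a = min u v" and "b = max u v"
        \<comment> \<open>The expansion is centred at v, and the intermediate point t lies between u
          and v. From t \<le> u + v and p < 2 it follows that t powr (p - 2) is at least (u + v)
          powr (p - 2).\<close>
        have "\<exists>t. (if u < v then u < t \<and> t < v else v < t \<and> t < u) \<and>
          u powr p / p = (\<Sum>m<2. (d m v / fact m) * (u - v)^m) + (d 2 t / fact 2) * (u - v)^2"
        proof (rule Taylor[of 2 d _ a b])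
          show "\<forall>m t. m < 2 \<and> a \<le> t \<and> t \<le> b \<longrightarrow> DERIV (d m) t :> d (Suc m) t"
          proof (intro allI impI)
            fix m t assume mt: "m < (2::nat) \<and> a \<le> t \<and> t \<le> b"
            then have t: "0 < t" using True v by (auto simp: a_def)
            have "m = 0 \<or> m = 1" using mt by auto
            then show "DERIV (d m) t :> d (Suc m) t"
              using t p by (auto simp: d_def intro!: derivative_eq_intros simp: field_simps)
          qed
        qed (use False in \<open>auto simp: d_def a_def b_def\<close>)
        then obtain t where t0: "if u < v then u < t \<and> t < v else v < t \<and> t < u"
          and eq0: "u powr p / p = (\<Sum>m<2. (d m v / fact m) * (u - v)^m) + (d 2 t / fact 2) * (u - v)^2"
          by blast
        have t: "min u v \<le> t" "t \<le> max u v" using t0 by (auto split: if_splits)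
        have eq: "u powr p / p = v powr p / p + v powr (p - 1) * (u - v) + (p - 1) * t powr (p - 2) / 2 * (u - v)\<^sup>2"
          using eq0 by (simp add: d_def numeral_2_eq_2)
        have "(u + v) powr (p - 2) \<le> t powr (p - 2)" using t True v p by (intro powr_mono2') auto
        then have "(p - 1) / 8 * ((u - v)\<^sup>2 * (u + v) powr (p - 2)) \<le> (p - 1) / 2 * ((u - v)\<^sup>2 * t powr (p - 2))"
          using p by (intro mult_mono mult_nonneg_nonneg) auto
        then show ?thesis using True by (simp add: eq field_simps)
      qed (use v in simp)
    next
      \<comment> \<open>For u \<le> 0 < v the segment meets the singularity of the second derivative
        at 0. Here the linear term is at most -(v powr p), which pays for the quadratic one; the
        weight 1 / 8 leaves room for the factor 4 of \<open>powr_add_le_4\<close>.\<close>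
      case False
      define s where "s = - u"
      have s: "0 \<le> s" using False by (simp add: s_def)
      have "(u - v)\<^sup>2 * (\<bar>u\<bar> + v) powr (p - 2) = (s + v) powr 2 * (s + v) powr (p - 2)"
        using s v by (simp add: s_def power2_eq_square algebra_simps)
      also have "\<dots> = (s + v) powr p" by (simp flip: powr_add)
      also have "\<dots> \<le> 4 * (s powr p + v powr p)" using s v p by (intro powr_add_le_4) auto
      finally have 1: "(p - 1) / 8 * ((u - v)\<^sup>2 * (\<bar>u\<bar> + v) powr (p - 2)) \<le> (p - 1) / 8 * (4 * (s powr p + v powr p))"
        using p by (intro mult_left_mono) auto
      have pp: "(p - 1) * p \<le> 1 * 2" using p by (intro mult_mono) auto
      have 2: "(p - 1) / 2 * s powr p \<le> 1 / p * s powr p"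
        using pp p by (intro mult_right_mono) (auto simp: field_simps)
      have 3: "(p - 1) / 2 * v powr p \<le> (1 - 1 / p) * v powr p"
      proof (intro mult_right_mono)
        have "(p - 1) * p \<le> (p - 1) * 2" using p by (intro mult_left_mono) auto
        then show "(p - 1) / 2 \<le> 1 - 1 / p" using p by (simp add: field_simps)
      qed auto
      have 4: "v powr (p - 1) * (u - v) \<le> - (v powr p)"
      proof -
        have "v powr (p - 1) * (u - v) \<le> v powr (p - 1) * (- v)"
          using False by (intro mult_left_mono) auto
        also have "\<dots> = - (v powr p)" using v by (simp add: powr_diff)
        finally show ?thesis .
      qed
      have "\<bar>u\<bar> = s" using False by (simp add: s_def)
      then have "v powr p / p + v powr (p - 1) * (u - v) + (p - 1) / 8 * ((u - v)\<^sup>2 * (\<bar>u\<bar> + v) powr (p - 2))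
        \<le> v powr p / p - v powr p + ((p - 1) / 2 * s powr p + (p - 1) / 2 * v powr p)"
        using 1 4 by (simp add: distrib_left)
      also have "\<dots> \<le> v powr p / p - v powr p + (1 / p * s powr p + (1 - 1 / p) * v powr p)"
        using 2 3 by (intro add_left_mono add_mono) auto
      also have "\<dots> = \<bar>u\<bar> powr p / p" using \<open>\<bar>u\<bar> = s\<close> by (simp add: left_diff_distrib)
      finally show ?thesis .
    qed
  qed
  show ?thesis
  proof (cases "0 \<le> v")
    case True then show ?thesis using main[OF True, of u] by (simp add: sgn1_def)
  next
    case False
    then show ?thesis using main[of "- v" "- u"] by (simp add: sgn1_def algebra_simps power2_commute[of u v] power2_eq_square)
  qed
qed

locale conjugate_exponents =
  fixes p q :: real
  assumes p1: "1 < p" and p2: "p < 2" and conj: "1 / p + 1 / q = 1"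
begin

lemma q_eq: "q = p / (p - 1)"
proof -
  have "q \<noteq> 0" using conj p1 by auto
  then show ?thesis using conj p1 by (simp add: field_simps)
qed

lemma q_gt: "2 < q" using p1 p2 by (simp add: q_eq field_simps)

lemma inv_q: "1 / q = 1 - 1 / p" using conj by simp

lemma exp_simps: "q / p = q - 1" "p / q = p - 1" "(p - 1) * (q - 1) = 1" "q * (p - 1) = p" "(p - 1) / p = 1 / q"
  using p1 by (simp_all add: q_eq field_simps)

text \<open>Common p-norm of the two parts of an extremal vector, each of mass 1 / 2. The leading
  constant of the theorem is \<open>sqrt 2 * c0\<^sup>2\<close>.\<close>

definition c0 :: real where "c0 = 2 powr (- 1 / p)"

lemma c0: "0 < c0" "1 / 2 \<le> c0" "c0 < 1" "c0 powr p = 1 / 2" "2 powr (1 / q) = 2 * c0"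
  "(2 * c0) powr (1 - q) = c0" "c0\<^sup>2 \<ge> 1 / 4" "2 powr (1 / 2 - 2 / p) = sqrt 2 * c0\<^sup>2" "c0 powr (p - 1) * (2 * c0) = 1"
proof -
  show c: "0 < c0" by (simp add: c0_def)
  have "2 powr (-1) \<le> (2::real) powr (- 1 / p)" using p1 by (intro powr_mono) (auto simp: field_simps)
  then show h: "1 / 2 \<le> c0" by (simp add: c0_def powr_minus)
  have "2 powr (- 1 / p) < (2::real) powr 0" using p1 by (intro powr_less_mono) auto
  then show "c0 < 1" by (simp add: c0_def)
  show "c0 powr p = 1 / 2" using p1 by (simp only: c0_def powr_powr) (simp add: powr_minus)
  show e: "2 powr (1 / q) = 2 * c0" by (simp add: inv_q c0_def powr_diff powr_minus field_simps)
  have "1 / q * (1 - q) = - 1 / p" using q_gt inv_q by (simp add: field_simps)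
  then show "(2 * c0) powr (1 - q) = c0" unfolding e[symmetric] powr_powr by (simp add: c0_def)
  have "(1/2)\<^sup>2 \<le> c0\<^sup>2" using h by (intro power_mono) auto
  then show "c0\<^sup>2 \<ge> 1 / 4" by (simp add: power2_eq_square)
  have "c0\<^sup>2 = 2 powr (- 2 / p)" by (simp add: c0_def powr_powr flip: powr_numeral)
  then show "2 powr (1 / 2 - 2 / p) = sqrt 2 * c0\<^sup>2"
    using powr_add[of 2 "1/2" "- 2 / p"] by (simp add: powr_half_sqrt)
  have "c0 powr (p - 1) * (2 * c0) = 2 * (c0 powr (p - 1) * c0 powr 1)" using c by simp
  also have "\<dots> = 2 * c0 powr p" by (subst powr_add[symmetric]) simp
  finally show "c0 powr (p - 1) * (2 * c0) = 1" using \<open>c0 powr p = 1 / 2\<close> by simp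
qed

text \<open>Upper bound for the supremum of w z - l |z|^p / p over |z| \<le> t. The second argument
  of the minimum is the Legendre transform of l |.|^p / p at w; the first uses only |z| \<le> t and
  grows linearly, which keeps exponential moments finite.\<close>

definition trunc_young :: "real \<Rightarrow> real \<Rightarrow> real \<Rightarrow> real" where
  "trunc_young t l w = min (t * \<bar>w\<bar>) (\<bar>w\<bar> powr q * l powr (1 - q) / q)"

lemma mult_le_trunc_young:
  assumes "\<bar>z\<bar> \<le> t" "0 < l"
  shows "w * z \<le> l * \<bar>z\<bar> powr p / p + trunc_young t l w"
proof -
  have 1: "w * z \<le> \<bar>w\<bar> * \<bar>z\<bar>" by (metis abs_ge_self abs_mult)
  have 2: "\<bar>w\<bar> * \<bar>z\<bar> \<le> t * \<bar>w\<bar>" using mult_right_mono[OF assms(1), of "\<bar>w\<bar>"] by (simp add: mult.commute)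
  have "\<bar>w\<bar> * \<bar>z\<bar> = (l powr (1 / p) * \<bar>z\<bar>) * (\<bar>w\<bar> * l powr (- 1 / p))"
    using assms by (simp add: powr_minus field_simps)
  also have "\<dots> \<le> (l powr (1 / p) * \<bar>z\<bar>) powr p / p + (\<bar>w\<bar> * l powr (- 1 / p)) powr q / q"
    using p1 q_gt conj by (intro Youngs_inequality) auto
  also have "(l powr (1 / p) * \<bar>z\<bar>) powr p = l * \<bar>z\<bar> powr p"
    using p1 assms by (simp add: powr_mult powr_powr)
  also have "(\<bar>w\<bar> * l powr (- 1 / p)) powr q = \<bar>w\<bar> powr q * l powr (1 - q)"
    using p1 exp_simps(1) by (simp add: powr_mult powr_powr)
  finally have 3: "\<bar>w\<bar> * \<bar>z\<bar> \<le> l * \<bar>z\<bar> powr p / p + \<bar>w\<bar> powr q * l powr (1 - q) / q" .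
  have 4: "0 \<le> l * \<bar>z\<bar> powr p / p" using assms p1 by simp
  show ?thesis using 1 2 3 4 by (simp add: trunc_young_def min_def)
qed

text \<open>Tangent line at B = 1 / 2 of the concave function B powr (1 / p). It is a tangent
  because the multiplier in Young's inequality is fixed before the mass B of z is known; 2 c0
  \<open>gauss_norm n\<close> is the multiplier optimal at B = 1 / 2.\<close>

definition main_coef :: "real \<Rightarrow> real" where
  "main_coef B = c0 * (2 * B / p + 1 / q)"

lemma main_coef_bounds: "0 \<le> B \<Longrightarrow> 0 \<le> main_coef B" "B \<le> 1 \<Longrightarrow> main_coef B \<le> 2" "main_coef (1 / 2) = c0"
  "B \<le> B' \<Longrightarrow> main_coef B \<le> main_coef B'"
proof -
  show "0 \<le> main_coef B" if "0 \<le> B" using that c0 p1 q_gt by (simp add: main_coef_def)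
  show mono: "main_coef B \<le> main_coef B'" if "B \<le> B'" for B B' unfolding main_coef_def using that c0 p1
    by (intro mult_left_mono add_right_mono divide_right_mono) auto
  show "main_coef B \<le> 2" if "B \<le> 1"
  proof -
    have "main_coef B \<le> main_coef 1" by (rule mono) fact
    also have "\<dots> \<le> 1 * (2 * 1 / p + 1 / q)"
      unfolding main_coef_def using c0 p1 q_gt by (intro mult_right_mono) auto
    also have "\<dots> \<le> 2" using p1 by (simp add: inv_q field_simps)
    finally show ?thesis .
  qed
  show "main_coef (1 / 2) = c0" using conj by (simp add: main_coef_def)
qed

text \<open>With s = a / c0 the constraint reads B = 1 - s powr p / 2 - U, and Bernoulli's
  inequality for s powr p leaves s (2 - s) = 1 - (s - 1)^2 minus a term in U. The deficit thus
  measures both the deviation of a from c0 and the mass U of the middle range.\<close>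

lemma main_coef_opt:
  assumes "0 \<le> a" "a powr p + U + B = 1" "0 \<le> U" "0 \<le> B" "0 \<le> \<theta>" "\<theta> \<le> 1"
  shows "\<theta> * a * main_coef B \<le> c0\<^sup>2 * (\<theta> * (1 - (a / c0 - 1)\<^sup>2 - 2 * (a / c0) * U / p))"
proof -
  define s where "s = a / c0"
  have s: "0 \<le> s" "a = c0 * s" using assms c0 by (simp_all add: s_def)
  have "a powr p = s powr p / 2" using c0 s by (simp add: powr_mult)
  then have "2 * B = 2 - s powr p - 2 * U" using assms by simp
  then have "2 * B / p + 1 / q = 1 + (1 - s powr p - 2 * U) / p"
    unfolding inv_q by (simp add: diff_divide_distrib)
  also have "\<dots> \<le> 1 + (p * (1 - s) - 2 * U) / p"
    using bernoulli_powr[OF s(1), of p] p1 by (intro add_left_mono divide_right_mono) (auto simp: algebra_simps)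
  also have "\<dots> = 2 - s - 2 * U / p" using p1 by (simp add: field_simps)
  finally have "(\<theta> * s) * (2 * B / p + 1 / q) \<le> (\<theta> * s) * (2 - s - 2 * U / p)"
    using assms s by (intro mult_left_mono) auto
  also have "\<dots> = \<theta> * (1 - (s - 1)\<^sup>2 - 2 * s * U / p)" by (simp add: power2_eq_square algebra_simps)
  finally have "c0\<^sup>2 * ((\<theta> * s) * (2 * B / p + 1 / q)) \<le> c0\<^sup>2 * (\<theta> * (1 - (s - 1)\<^sup>2 - 2 * s * U / p))"
    by (intro mult_left_mono) auto
  then show ?thesis by (simp add: main_coef_def s(2) power2_eq_square mult_ac s_def[symmetric])
qed

text \<open>The hypothesis on w says that it is W times the gradient of |.|^p / p at v. Because
  \<open>c0 powr (p - 1) * (2 * c0) = 1\<close>, it is also 2 c0 W times the gradient at c0 v, so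
  \<open>abs_powr_strict_convex\<close> is applied there: the terms without the quadratic gain add
  up to \<open>main_coef\<close>.\<close>

lemma holder_stability:
  fixes v z w :: "'i \<Rightarrow> real"
  assumes v: "(\<Sum>j\<in>I. \<bar>v j\<bar> powr p) = 1" and w: "\<And>j. j \<in> I \<Longrightarrow> w j = W * (sgn1 (v j) * \<bar>v j\<bar> powr (p - 1))"
    and W: "0 \<le> W"
  shows "(\<Sum>j\<in>I. w j * z j) \<le> W * (main_coef (\<Sum>j\<in>I. \<bar>z j\<bar> powr p) -
    2 * c0 * ((p - 1) / 8) * (\<Sum>j\<in>I. (z j - c0 * v j)\<^sup>2 * (\<bar>z j\<bar> + \<bar>c0 * v j\<bar>) powr (p - 2)))"
proof -
  have *: "w j * z j \<le> W * (2 * c0) * (\<bar>z j\<bar> powr p / p + (1 - 1 / p) * (\<bar>v j\<bar> powr p / 2) -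
     (p - 1) / 8 * ((z j - c0 * v j)\<^sup>2 * (\<bar>z j\<bar> + \<bar>c0 * v j\<bar>) powr (p - 2)))" if "j \<in> I" for j
  proof -
    define b where "b = c0 * v j"
    have sb: "sgn1 b = sgn1 (v j)" using c0 by (simp add: b_def sgn1_def zero_le_mult_iff)
    have bp: "\<bar>b\<bar> powr p = \<bar>v j\<bar> powr p / 2" using c0 by (simp add: b_def abs_mult powr_mult)
    have "sgn1 b * \<bar>b\<bar> powr (p - 1) * (2 * c0) = sgn1 (v j) * \<bar>v j\<bar> powr (p - 1) * (c0 powr (p - 1) * (2 * c0))"
      using c0(1) by (simp add: sb) (simp add: b_def abs_mult powr_mult)
    then have "sgn1 b * \<bar>b\<bar> powr (p - 1) * (2 * c0) = sgn1 (v j) * \<bar>v j\<bar> powr (p - 1)"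
      unfolding c0(9) by simp
    then have "w j = W * (sgn1 b * \<bar>b\<bar> powr (p - 1) * (2 * c0))" using w[OF that] by simp
    then have "w j = W * (2 * c0) * (sgn1 b * \<bar>b\<bar> powr (p - 1))" by (simp only: mult_ac)
    moreover have "sgn1 b * \<bar>b\<bar> powr (p - 1) * b = \<bar>b\<bar> powr p"
      by (cases "b = 0") (simp_all add: powr_diff sgn1_def)
    then have "sgn1 b * \<bar>b\<bar> powr (p - 1) * z j \<le> \<bar>z j\<bar> powr p / p + (1 - 1 / p) * \<bar>b\<bar> powr p -
        (p - 1) / 8 * ((z j - b)\<^sup>2 * (\<bar>z j\<bar> + \<bar>b\<bar>) powr (p - 2))"
      using abs_powr_strict_convex[OF p1 p2, of b "z j"] by (simp add: algebra_simps)
    then have "W * (2 * c0) * (sgn1 b * \<bar>b\<bar> powr (p - 1) * z j) \<le> W * (2 * c0) * (\<bar>z j\<bar> powr p / p + (1 - 1 / p) * \<bar>b\<bar> powr p -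
        (p - 1) / 8 * ((z j - b)\<^sup>2 * (\<bar>z j\<bar> + \<bar>b\<bar>) powr (p - 2)))"
      using W c0 by (intro mult_left_mono) auto
    ultimately show ?thesis by (simp add: bp mult_ac flip: b_def)
  qed
  have "(\<Sum>j\<in>I. w j * z j) \<le> (\<Sum>j\<in>I. W * (2 * c0) * (\<bar>z j\<bar> powr p / p + (1 - 1 / p) * (\<bar>v j\<bar> powr p / 2) -
     (p - 1) / 8 * ((z j - c0 * v j)\<^sup>2 * (\<bar>z j\<bar> + \<bar>c0 * v j\<bar>) powr (p - 2))))" by (intro sum_mono *)
  also have "\<dots> = W * (2 * c0) * ((\<Sum>j\<in>I. \<bar>z j\<bar> powr p) / p + (1 - 1 / p) * ((\<Sum>j\<in>I. \<bar>v j\<bar> powr p) / 2) -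
     (p - 1) / 8 * (\<Sum>j\<in>I. (z j - c0 * v j)\<^sup>2 * (\<bar>z j\<bar> + \<bar>c0 * v j\<bar>) powr (p - 2)))"
    by (simp only: sum_distrib_left[symmetric] sum.distrib sum_subtractf sum_divide_distrib[symmetric])
  also have "\<dots> = W * (main_coef (\<Sum>j\<in>I. \<bar>z j\<bar> powr p) -
    2 * c0 * ((p - 1) / 8) * (\<Sum>j\<in>I. (z j - c0 * v j)\<^sup>2 * (\<bar>z j\<bar> + \<bar>c0 * v j\<bar>) powr (p - 2)))"
    unfolding v main_coef_def inv_q by (simp add: algebra_simps diff_divide_distrib)
  finally show ?thesis .
qed

text \<open>Splitting according to whether \<open>\<bar>d\<bar>\<close> exceeds \<open>\<gamma> R\<close> replaces Hoelder's inequality here.\<close>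

lemma sum_powr_le_of_weighted:
  fixes d R :: "'i \<Rightarrow> real"
  assumes "\<And>j. j \<in> I \<Longrightarrow> \<bar>d j\<bar> \<le> R j" and "(\<Sum>j\<in>I. (d j)\<^sup>2 * R j powr (p - 2)) \<le> \<gamma>\<^sup>2" and \<gamma>: "0 < \<gamma>"
  shows "(\<Sum>j\<in>I. \<bar>d j\<bar> powr p) \<le> \<gamma> powr p * (1 + (\<Sum>j\<in>I. R j powr p))"
proof -
  have *: "\<bar>d j\<bar> powr p \<le> \<gamma> powr (p - 2) * ((d j)\<^sup>2 * R j powr (p - 2)) + \<gamma> powr p * R j powr p" if "j \<in> I" for j
  proof (cases "\<bar>d j\<bar> \<le> \<gamma> * R j")
    case True
    have R0: "0 \<le> R j" using assms(1)[OF that] by linarith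
    have "\<bar>d j\<bar> powr p \<le> (\<gamma> * R j) powr p" using True p1 by (intro powr_mono2) auto
    also have "\<dots> = \<gamma> powr p * R j powr p" using \<gamma> R0 by (simp add: powr_mult)
    finally show ?thesis by (simp add: add_increasing)
  next
    case False
    have R0: "0 \<le> R j" using assms(1)[OF that] by linarith
    then have d0: "0 < \<bar>d j\<bar>" using False \<gamma> mult_nonneg_nonneg[of \<gamma> "R j"] by linarith
    then have R0: "0 < R j" using assms(1)[OF that] by linarith
    have "\<bar>d j\<bar> powr p = \<bar>d j\<bar> powr 2 * \<bar>d j\<bar> powr (p - 2)" by (subst powr_add[symmetric]) simp
    also have "\<dots> \<le> \<bar>d j\<bar> powr 2 * (\<gamma> * R j) powr (p - 2)"
      using False \<gamma> R0 p2 by (intro mult_left_mono powr_mono2') auto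
    also have "\<dots> = \<gamma> powr (p - 2) * ((d j)\<^sup>2 * R j powr (p - 2))" using \<gamma> R0 by (simp add: powr_mult)
    finally show ?thesis by (simp add: add_increasing2)
  qed
  have "(\<Sum>j\<in>I. \<bar>d j\<bar> powr p) \<le> (\<Sum>j\<in>I. \<gamma> powr (p - 2) * ((d j)\<^sup>2 * R j powr (p - 2)) + \<gamma> powr p * R j powr p)"
    by (intro sum_mono *)
  also have "\<dots> = \<gamma> powr (p - 2) * (\<Sum>j\<in>I. (d j)\<^sup>2 * R j powr (p - 2)) + \<gamma> powr p * (\<Sum>j\<in>I. R j powr p)"
    by (simp add: sum.distrib sum_distrib_left)
  also have "\<dots> \<le> \<gamma> powr (p - 2) * \<gamma>\<^sup>2 + \<gamma> powr p * (\<Sum>j\<in>I. R j powr p)"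
    using assms by (intro add_right_mono mult_left_mono) auto
  also have "\<gamma> powr (p - 2) * \<gamma>\<^sup>2 = \<gamma> powr p" using \<gamma> by (simp add: powr_diff)
  finally show ?thesis by (simp add: ring_distribs)
qed

end

section \<open>Uniform control of the sharp part of the form\<close>

lemma abs_le_sum_powr:
  fixes y :: "nat \<Rightarrow> real"
  assumes "i \<in> {1..n}" "0 < p"
  shows "\<bar>y i\<bar> \<le> psum n p y powr (1 / p)" (is "_ \<le> ?S powr _")
proof -
  have "\<bar>y i\<bar> = (\<bar>y i\<bar> powr p) powr (1 / p)" using assms by (simp add: powr_powr)
  also have "\<dots> \<le> ?S powr (1 / p)" using assms by (intro powr_mono2) (auto intro!: member_le_sum)
  finally show ?thesis .
qed

section \<open>The net for the large entries and the cross term\<close>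

definition l2norm :: "nat \<Rightarrow> (nat \<Rightarrow> real) \<Rightarrow> real" where
  "l2norm n y = sqrt (\<Sum>i\<in>{1..n}. (y i)\<^sup>2)"

text \<open>Mesh n^(-2): rounding one argument changes n^2 terms of the form, each by n^(-2) times
  an entry bound, while the number of grid values stays polynomial in n.\<close>

definition grid :: "nat \<Rightarrow> real set" where
  "grid n = (\<lambda>k. real_of_int k / (real n)\<^sup>2) ` {- int (n\<^sup>2)..int (n\<^sup>2)}"

lemma l2norm_mono:
  assumes "\<And>i. i \<in> {1..n} \<Longrightarrow> \<bar>y i\<bar> \<le> \<bar>y' i\<bar>"
  shows "l2norm n y \<le> l2norm n y'"
  unfolding l2norm_def using assms by (intro real_sqrt_le_mono sum_mono) (simp add: abs_le_square_iff)

lemma l2norm_nonneg [simp]: "0 \<le> l2norm n y" by (simp add: l2norm_def sum_nonneg)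

lemma l2norm_pos: "supp n y \<noteq> {} \<Longrightarrow> 0 < l2norm n y"
proof -
  assume "supp n y \<noteq> {}"
  then obtain i where "i \<in> {1..n}" "y i \<noteq> 0" by (auto simp: supp_def)
  then have "0 < (\<Sum>i\<in>{1..n}. (y i)\<^sup>2)" by (intro sum_pos2[of _ i]) auto
  then show ?thesis by (simp add: l2norm_def)
qed

text \<open>Rounding goes towards 0, so that no entry grows and no new support appears; sparsity,
  the bound on the second norm and disjointness from z are inherited.\<close>

definition round_to_grid :: "nat \<Rightarrow> (nat \<Rightarrow> real) \<Rightarrow> nat \<Rightarrow> real" where
  "round_to_grid n y i = (if i \<in> {1..n} then sgn1 (y i) * (real_of_int \<lfloor>\<bar>y i\<bar> * (real n)\<^sup>2\<rfloor> / (real n)\<^sup>2) else 0)"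

lemma round_to_grid:
  assumes y: "\<And>i. i \<in> {1..n} \<Longrightarrow> \<bar>y i\<bar> \<le> 1"
  shows "round_to_grid n y \<in> vecs n (grid n)"
    and "i \<in> {1..n} \<Longrightarrow> \<bar>round_to_grid n y i\<bar> \<le> \<bar>y i\<bar>"
    and "i \<in> {1..n} \<Longrightarrow> \<bar>y i - round_to_grid n y i\<bar> \<le> 1 / (real n)\<^sup>2"
proof -
  define f where "f i = \<lfloor>\<bar>y i\<bar> * (real n)\<^sup>2\<rfloor>" for i
  have f: "0 \<le> f i" "real_of_int (f i) \<le> \<bar>y i\<bar> * (real n)\<^sup>2" "\<bar>y i\<bar> * (real n)\<^sup>2 \<le> real_of_int (f i) + 1" for i
    unfolding f_def by (simp_all)
  have r: "round_to_grid n y i = sgn1 (y i) * (real_of_int (f i) / (real n)\<^sup>2)" if "i \<in> {1..n}" for i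
    using that by (simp add: round_to_grid_def f_def)
  have n0: "0 < (real n)\<^sup>2" if "i \<in> {1..n}" for i using that by simp
  have "round_to_grid n y i \<in> grid n" if i: "i \<in> {1..n}" for i
  proof -
    have "f i \<le> int (n\<^sup>2)"
    proof -
      have "real_of_int (f i) \<le> 1 * (real n)\<^sup>2" 
        using order.trans[OF f(2) mult_right_mono[OF y[OF i], of "(real n)\<^sup>2"]] by simp
      then show ?thesis by (metis mult_1 of_int_le_iff of_int_of_nat_eq of_nat_power)
    qed
    then show ?thesis unfolding r[OF i] grid_def
      using f(1)[of i] by (intro image_eqI[of _ _ "if 0 \<le> y i then f i else - f i"]) (auto simp: sgn1_def)
  qed
  then show "round_to_grid n y \<in> vecs n (grid n)" by (auto simp: vecs_def round_to_grid_def)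
  show "\<bar>round_to_grid n y i\<bar> \<le> \<bar>y i\<bar>" if "i \<in> {1..n}"
  proof -
    have "\<bar>round_to_grid n y i\<bar> = real_of_int (f i) / (real n)\<^sup>2"
      using f(1)[of i] by (simp add: r[OF that] abs_mult sgn1_def)
    then show ?thesis using f(2)[of i] n0[OF that] by (simp add: divide_le_eq)
  qed
  show "\<bar>y i - round_to_grid n y i\<bar> \<le> 1 / (real n)\<^sup>2" if "i \<in> {1..n}"
  proof -
    have "\<bar>y i - round_to_grid n y i\<bar> = \<bar>\<bar>y i\<bar> - real_of_int (f i) / (real n)\<^sup>2\<bar>"
      by (auto simp: r[OF that] sgn1_def abs_if)
    also have "\<dots> = \<bar>\<bar>y i\<bar> * (real n)\<^sup>2 - real_of_int (f i)\<bar> / (real n)\<^sup>2"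
      using n0[OF that] by (simp add: divide_simps abs_if)
    also have "\<dots> \<le> 1 / (real n)\<^sup>2" using f[of i] by (intro divide_right_mono) auto
    finally show ?thesis .
  qed
qed

lemma mat_vec_sym: "bilin n (sym_mat G) y z = (\<Sum>j\<in>{1..n}. mat_vec n (sym_mat G) y j * z j)"
  unfolding bilin_swap mat_vec_def by (intro sum.cong refl) (simp add: sym_mat_def mult_ac add.commute)

lemma mat_vec_basis_vec: "i \<in> {1..n} \<Longrightarrow> mat_vec n (sym_mat G) (basis_vec i) j = sym_mat G i j"
  by (simp add: mat_vec_def basis_vec_def sym_mat_def add.commute if_distrib[of "\<lambda>x. _ * x"] cong: if_cong)

lemma bilin_add_transpose: "bilin n G y z + bilin n G z y = sqrt 2 * bilin n (sym_mat G) y z"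
proof -
  have "bilin n G z y = (\<Sum>i\<in>{1..n}. \<Sum>j\<in>{1..n}. y i * G j i * z j)"
    unfolding bilin_def by (subst sum.swap) (simp add: mult_ac)
  then have "bilin n G y z + bilin n G z y = (\<Sum>i\<in>{1..n}. \<Sum>j\<in>{1..n}. y i * (G i j + G j i) * z j)"
    by (simp add: bilin_def sum.distrib ring_distribs)
  also have "\<dots> = sqrt 2 * bilin n (sym_mat G) y z"
    unfolding bilin_def sum_distrib_left by (intro sum.cong refl) (simp add: sym_mat_def)
  finally show ?thesis .
qed

lemma sym_entry_bound:
  assumes sb: "sign_bound n A G" and "i \<in> {1..n}" "j \<in> {1..n}"
  shows "\<bar>sym_mat G i j\<bar> \<le> 2 * A * sqrt (ln (real n))"
proof -
  have "\<bar>sym_mat G i j\<bar> \<le> (\<bar>G i j\<bar> + \<bar>G j i\<bar>) / sqrt 2" by (simp add: sym_mat_def divide_right_mono)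
  also have "\<dots> \<le> (A * sqrt (2 * ln (real n)) + A * sqrt (2 * ln (real n))) / sqrt 2"
    using entry_bound[OF sb assms(2,3)] entry_bound[OF sb assms(3,2)] by (intro divide_right_mono add_mono) auto
  also have "\<dots> = 2 * A * sqrt (ln (real n))" by (simp add: real_sqrt_mult)
  finally show ?thesis .
qed

context conjugate_exponents begin

text \<open>Typical q-norm of n independent standard Gaussian variables.\<close>

definition gauss_norm :: "nat \<Rightarrow> real" where
  "gauss_norm n = gauss_xi q * real n powr (1 / q)"

text \<open>The exponent equals p / (2 q), so this is the error term of the theorem without its
  constant. Four times its square bounds the logarithm of the number of net points for y.\<close>

definition err :: "nat \<Rightarrow> real" where
  "err n = real n powr ((p - 1) / 2) * sqrt (ln (real n))"

lemma sqrt_ln_le_err: "3 \<le> n \<Longrightarrow> sqrt (ln (real n)) \<le> err n"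
  using p1 ge_one_powr_ge_zero[of "real n" "(p - 1) / 2"] by (simp add: err_def mult_le_cancel_right1)

lemma err_nonneg: "3 \<le> n \<Longrightarrow> 0 \<le> err n" by (simp add: err_def)

lemma err_squared: "3 \<le> n \<Longrightarrow> (err n)\<^sup>2 = real n powr (p - 1) * ln (real n)"
  by (simp add: err_def power_mult_distrib) (simp add: power2_eq_square flip: powr_add)

text \<open>Off the support of y the normalized coordinates of the product are independent standard
  Gaussians. The term \<open>gauss_norm n * c0 / q\<close> is n times the mean of the untruncated
  summand, and \<open>A * err n\<close> is the deviation allowed by the union bound over the
  net.\<close>

definition young_bound :: "nat \<Rightarrow> real \<Rightarrow> (nat \<Rightarrow> nat \<Rightarrow> real) \<Rightarrow> bool" where
  "young_bound n A G \<longleftrightarrow> (\<forall>y\<in>vecs n (grid n). supp n y \<noteq> {} \<longrightarrow> nnz n y \<le> real n powr (p - 1) \<longrightarrow>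
     (\<Sum>i\<in>{1..n} - supp n y. trunc_young (1 / sqrt (real n)) (2 * c0 * gauss_norm n)
        (mat_vec n (sym_mat G) y i / l2norm n y)) \<le> gauss_norm n * c0 / q + A * err n)"

lemma l2norm_le:
  fixes y :: "nat \<Rightarrow> real"
  assumes "\<And>i. i \<in> {1..n} \<Longrightarrow> \<bar>y i\<bar> \<le> \<mu>"
  shows "(l2norm n y)\<^sup>2 \<le> \<mu> powr (2 - p) * (psum n p y)"
proof -
  have "(y i)\<^sup>2 \<le> \<mu> powr (2 - p) * \<bar>y i\<bar> powr p" if "i \<in> {1..n}" for i
  proof -
    have "(y i)\<^sup>2 = \<bar>y i\<bar> powr (2 - p) * \<bar>y i\<bar> powr p" by (subst powr_add[symmetric]) simp
    also have "\<dots> \<le> \<mu> powr (2 - p) * \<bar>y i\<bar> powr p"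
      using assms[OF that] p2 by (intro mult_right_mono powr_mono2) auto
    finally show ?thesis .
  qed
  then show ?thesis
    unfolding l2norm_def by (simp add: sum_nonneg sum_distrib_left del: sum.cl_ivl_Suc) (intro sum_mono, simp)
qed

lemma l2norm_le_pnorm: "l2norm n y \<le> psum n p y powr (1 / p)" (is "_ \<le> ?S powr _")
proof -
  have S0: "0 \<le> ?S" by (simp add: sum_nonneg)
  have "(l2norm n y)\<^sup>2 \<le> (?S powr (1 / p)) powr (2 - p) * ?S"
    using p1 by (intro l2norm_le abs_le_sum_powr) auto
  also have "\<dots> = ?S powr ((2 - p) / p) * ?S powr 1" using S0 by (simp add: powr_powr)
  also have "\<dots> = ?S powr (2 / p)" using p1 by (subst powr_add[symmetric]) (simp add: field_simps)
  also have "\<dots> = (?S powr (1 / p))\<^sup>2" by (simp add: powr_powr flip: powr_numeral)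
  finally show ?thesis by (rule power2_le_imp_le) simp
qed

text \<open>The factor \<open>l2norm n y\<close> is kept because the bound has three uses: for all
  large entries together, for the minor ones among them, where the small norm matters, and for a
  single basis vector. Disjoint supports allow the sum in \<open>young_bound\<close> to skip the
  support of the rounded y.\<close>

lemma cross_term_bound:
  assumes sb: "sign_bound n A1 G" and yb: "young_bound n A2 G" and n: "3 \<le> n" and \<xi>: "0 < gauss_xi q"
    and A: "0 \<le> A1" "0 \<le> A2"
    and y: "\<And>i. i \<in> {1..n} \<Longrightarrow> \<bar>y i\<bar> \<le> 1" "nnz n y \<le> real n powr (p - 1)" "l2norm n y \<le> 1"
    and z: "\<And>i. i \<in> {1..n} \<Longrightarrow> \<bar>z i\<bar> \<le> 1 / sqrt (real n)" "\<And>i. i \<in> {1..n} \<Longrightarrow> y i \<noteq> 0 \<Longrightarrow> z i = 0"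
  shows "bilin n (sym_mat G) y z \<le> l2norm n y * gauss_norm n * main_coef (psum n p z) + (2 * A1 + A2) * err n"
proof -
  define y' where "y' = round_to_grid n y"
  have r: "y' \<in> vecs n (grid n)" "\<And>i. i \<in> {1..n} \<Longrightarrow> \<bar>y' i\<bar> \<le> \<bar>y i\<bar>"
    "\<And>i. i \<in> {1..n} \<Longrightarrow> \<bar>y i - y' i\<bar> \<le> 1 / (real n)\<^sup>2"
    unfolding y'_def using y(1) by (blast intro: round_to_grid)+
  define B where "B = psum n p z"
  define N where "N = gauss_norm n"
  have B0: "0 \<le> B" by (simp add: B_def sum_nonneg)
  have N0: "0 < N" using \<xi> n by (simp add: N_def gauss_norm_def)
  have ss: "supp n y' \<subseteq> supp n y" using r(2) by (force simp: supp_def)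
  have cs: "nnz n y' \<le> real n powr (p - 1)" using card_mono[OF _ ss] y(2) by simp
  have s'1: "l2norm n y' \<le> l2norm n y" using r(2) by (rule l2norm_mono)
  have L0: "0 \<le> ln (real n)" using n by simp
  note E = sqrt_ln_le_err[OF n] and E0 = err_nonneg[OF n]
  have "bilin n (sym_mat G) y z = bilin n (sym_mat G) (\<lambda>i. y' i + (y i - y' i)) z" by simp
  also have "\<dots> = bilin n (sym_mat G) y' z + bilin n (sym_mat G) (\<lambda>i. y i - y' i) z" by (rule bilin_add_left)
  finally have split: "bilin n (sym_mat G) y z = bilin n (sym_mat G) y' z + bilin n (sym_mat G) (\<lambda>i. y i - y' i) z" .
  have "bilin n (sym_mat G) (\<lambda>i. y i - y' i) z \<le> (\<Sum>i\<in>{1..n}. \<Sum>j\<in>{1..n}. 1 / (real n)\<^sup>2 * (2 * A1 * sqrt (ln (real n))) * 1)"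
    unfolding bilin_def
  proof (intro sum_mono)
    fix i j assume ij: "i \<in> {1..n}" "j \<in> {1..n}"
    have "1 / sqrt (real n) \<le> 1" using n by simp
    then have zj: "\<bar>z j\<bar> \<le> 1" using z(1)[OF ij(2)] by linarith
    have "(y i - y' i) * sym_mat G i j * z j \<le> \<bar>y i - y' i\<bar> * \<bar>sym_mat G i j\<bar> * \<bar>z j\<bar>"
      by (metis abs_ge_self abs_mult)
    also have "\<dots> \<le> 1 / (real n)\<^sup>2 * (2 * A1 * sqrt (ln (real n))) * 1"
      using r(3)[OF ij(1)] sym_entry_bound[OF sb ij] zj A L0 by (intro mult_mono) auto
    finally show "(y i - y' i) * sym_mat G i j * z j \<le> 1 / (real n)\<^sup>2 * (2 * A1 * sqrt (ln (real n))) * 1" .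
  qed
  also have "\<dots> = 2 * A1 * sqrt (ln (real n))" using n by (simp add: power2_eq_square)
  also have "\<dots> \<le> 2 * A1 * err n" using E A by (intro mult_left_mono) auto
  finally have second: "bilin n (sym_mat G) (\<lambda>i. y i - y' i) z \<le> 2 * A1 * err n" .
  have first: "bilin n (sym_mat G) y' z \<le> l2norm n y * N * main_coef B + A2 * err n"
  proof (cases "supp n y' = {}")
    case True
    then have "bilin n (sym_mat G) y' z = 0" by (auto simp: bilin_left supp_def intro!: sum.neutral)
    then show ?thesis using main_coef_bounds(1)[OF B0] N0 A E0 by simp
  next
    case False
    define \<sigma> where "\<sigma> = l2norm n y'"
    have \<sigma>: "0 < \<sigma>" "\<sigma> \<le> l2norm n y" "\<sigma> \<le> 1" using l2norm_pos[OF False] s'1 y(3) by (auto simp: \<sigma>_def)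
    define w where "w j = mat_vec n (sym_mat G) y' j" for j
    define l where "l = 2 * c0 * N"
    have l0: "0 < l" using c0 N0 by (simp add: l_def)
    have "bilin n (sym_mat G) y' z = (\<Sum>j\<in>{1..n}. w j * z j)" by (simp add: mat_vec_sym w_def)
    also have "\<dots> = (\<Sum>j\<in>{1..n} - supp n y'. w j * z j)"
      using z(2) ss by (intro sum.mono_neutral_right) (auto simp: supp_def)
    also have "\<dots> \<le> (\<Sum>j\<in>{1..n} - supp n y'. \<sigma> * (l * \<bar>z j\<bar> powr p / p + trunc_young (1 / sqrt (real n)) l (w j / \<sigma>)))"
    proof (intro sum_mono)
      fix j assume "j \<in> {1..n} - supp n y'"
      then have "w j / \<sigma> * z j \<le> l * \<bar>z j\<bar> powr p / p + trunc_young (1 / sqrt (real n)) l (w j / \<sigma>)"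
        using z(1) l0 by (intro mult_le_trunc_young) auto
      then have "\<sigma> * (w j / \<sigma> * z j) \<le> \<sigma> * (l * \<bar>z j\<bar> powr p / p + trunc_young (1 / sqrt (real n)) l (w j / \<sigma>))"
        using \<sigma> by (intro mult_left_mono) auto
      then show "w j * z j \<le> \<sigma> * (l * \<bar>z j\<bar> powr p / p + trunc_young (1 / sqrt (real n)) l (w j / \<sigma>))"
        using \<sigma> by simp
    qed
    also have "\<dots> = \<sigma> * (l * (\<Sum>j\<in>{1..n} - supp n y'. \<bar>z j\<bar> powr p) / p +
        (\<Sum>j\<in>{1..n} - supp n y'. trunc_young (1 / sqrt (real n)) l (w j / \<sigma>)))"
      by (simp add: sum.distrib flip: sum_distrib_left sum_divide_distrib)
    also have "\<dots> \<le> \<sigma> * (l * B / p + (N * c0 / q + A2 * err n))"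
    proof (intro mult_left_mono add_mono divide_right_mono)
      show "(\<Sum>j\<in>{1..n} - supp n y'. \<bar>z j\<bar> powr p) \<le> B" unfolding B_def by (intro sum_mono2) auto
      show "(\<Sum>j\<in>{1..n} - supp n y'. trunc_young (1 / sqrt (real n)) l (w j / \<sigma>)) \<le> N * c0 / q + A2 * err n"
        using yb r(1) False cs unfolding young_bound_def by (simp add: l_def N_def w_def \<sigma>_def)
    qed (use \<sigma> l0 p1 in auto)
    also have "\<dots> = \<sigma> * (N * main_coef B) + \<sigma> * (A2 * err n)"
      by (simp add: main_coef_def l_def field_simps)
    also have "\<dots> \<le> l2norm n y * (N * main_coef B) + 1 * (A2 * err n)"
      using \<sigma> N0 A E0 main_coef_bounds(1)[OF B0] by (intro add_mono mult_right_mono) auto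
    finally show ?thesis by simp
  qed
  show ?thesis using split first second by (simp add: B_def N_def ring_distribs)
qed

end

section \<open>Stability of the scalar problem, reduction to the cross term, norming vectors\<close>

context conjugate_exponents begin

text \<open>Writing \<sigma> = \<theta> a with \<theta> \<le> 1, \<open>main_coef_opt\<close> gives
  1 - \<rho> \<le> \<theta> (1 - D - F), where D = (a / c0 - 1)^2 and F is the loss from U. A
  product of two factors that are at most 1 is near 1 only if both are, which yields the last three
  conclusions.\<close>

lemma near_extremal_scalars:
  assumes "0 \<le> a" "a powr p + U + B = 1" "0 \<le> U" "0 \<le> B" "0 \<le> \<sigma>" "\<sigma> \<le> a" "0 \<le> \<rho>" "\<rho> \<le> 1 / 4"
    and big: "c0\<^sup>2 * (1 - \<rho>) \<le> \<sigma> * main_coef B"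
  shows "0 < a" "(1 - \<rho>) * a \<le> \<sigma>" "\<bar>a - c0\<bar> \<le> sqrt \<rho>" "U \<le> 2 * \<rho>"
proof -
  have pos: "0 < c0\<^sup>2 * (1 - \<rho>)" using c0 assms by simp
  show a0: "0 < a"
  proof (rule ccontr)
    assume "\<not> 0 < a"
    then have "\<sigma> = 0" using assms by linarith
    then show False using big pos by simp
  qed
  define \<theta> where "\<theta> = \<sigma> / a"
  define s where "s = a / c0"
  define D F where "D = (s - 1)\<^sup>2" and "F = 2 * s * U / p"
  have \<theta>: "0 \<le> \<theta>" "\<theta> \<le> 1" "\<sigma> = \<theta> * a" using assms a0 by (auto simp: \<theta>_def divide_le_eq)
  have s0: "0 \<le> s" using a0 c0 by (simp add: s_def)
  have D0: "0 \<le> D" "0 \<le> F" using s0 assms p1 by (auto simp: D_def F_def)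
  have "\<theta> * a * main_coef B \<le> c0\<^sup>2 * (\<theta> * (1 - D - F))"
    using main_coef_opt[of a U B \<theta>] assms \<theta> by (simp add: D_def F_def s_def)
  then have "c0\<^sup>2 * (1 - \<rho>) \<le> c0\<^sup>2 * (\<theta> * (1 - D - F))" using big \<theta> by simp
  then have *: "1 - \<rho> \<le> \<theta> * (1 - D - F)" using c0 by simp
  then have "0 < \<theta> * (1 - D - F)" using assms by linarith
  then have pos': "0 < 1 - D - F" using \<theta> by (simp add: zero_less_mult_iff)
  have "\<theta> * (1 - D - F) \<le> 1 * (1 - D - F)" using pos' \<theta> by (intro mult_right_mono) auto
  then have DF: "D + F \<le> \<rho>" using * by simp
  have "\<theta> * (1 - D - F) \<le> \<theta> * 1" using D0 \<theta> by (intro mult_left_mono) auto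
  then have "1 - \<rho> \<le> \<theta>" using * by simp
  then show "(1 - \<rho>) * a \<le> \<sigma>" using \<theta> a0 by (simp add: mult_right_mono)
  have "(s - 1)\<^sup>2 \<le> \<rho>" using DF D0 by (simp add: D_def)
  then have s1: "\<bar>s - 1\<bar> \<le> sqrt \<rho>" by (metis real_sqrt_abs real_sqrt_le_iff)
  have "\<bar>a - c0\<bar> = c0 * \<bar>s - 1\<bar>" using c0 by (simp add: s_def abs_mult_pos' algebra_simps)
  also have "\<dots> \<le> 1 * sqrt \<rho>" using c0 s1 by (intro mult_mono) auto
  finally show "\<bar>a - c0\<bar> \<le> sqrt \<rho>" by simp
  have "sqrt \<rho> \<le> sqrt ((1/2)\<^sup>2)" using assms by (intro real_sqrt_le_mono) (simp add: power2_eq_square)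
  then have "sqrt \<rho> \<le> 1 / 2" by simp
  then have "1 / 2 \<le> s" using s1 by linarith
  then have "2 * (1/2) * U / 2 \<le> F" unfolding F_def using assms p1 p2 by (intro frac_le mult_mono) auto
  then show "U \<le> 2 * \<rho>" using DF D0 by simp
qed

text \<open>In the application a, \<mu> and \<sigma> are the p-norm, the largest entry and the
  second norm of one vector. The interpolation hypothesis shows that the second norm nearly reaches
  the p-norm only if one entry carries almost everything; 2 / (2 - p) comes from solving it for
  \<mu> / a.\<close>

lemma dominant_coordinate_scalar:
  assumes "0 < a" "0 \<le> \<mu>" "\<mu> \<le> a" "\<sigma>\<^sup>2 \<le> \<mu> powr (2 - p) * a powr p" "(1 - \<rho>) * a \<le> \<sigma>" "0 \<le> \<rho>" "\<rho> \<le> 1"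
  shows "(1 - 2 / (2 - p) * \<rho>) * a \<le> \<mu>" "a powr p - \<mu> powr p \<le> 2 * p / (2 - p) * \<rho> * a powr p"
proof -
  define t where "t = \<mu> / a"
  have t: "0 \<le> t" "\<mu> = t * a" using assms by (auto simp: t_def)
  define k where "k = 2 / (2 - p)"
  have k: "1 \<le> k" using p1 p2 by (simp add: k_def)
  have "((1 - \<rho>) * a)\<^sup>2 \<le> \<sigma>\<^sup>2" using assms by (intro power_mono) auto
  also have "\<dots> \<le> \<mu> powr (2 - p) * a powr p" by fact
  also have "\<dots> = t powr (2 - p) * (a powr (2 - p) * a powr p)"
    unfolding t(2) using t(1) assms(1) by (simp add: powr_mult)
  also have "a powr (2 - p) * a powr p = a\<^sup>2" using assms(1) by (subst powr_add[symmetric]) simp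
  finally have "(1 - \<rho>)\<^sup>2 * a\<^sup>2 \<le> t powr (2 - p) * a\<^sup>2" by (simp add: power_mult_distrib)
  then have "(1 - \<rho>)\<^sup>2 \<le> t powr (2 - p)" using assms(1) by simp
  then have "((1 - \<rho>)\<^sup>2) powr (1 / (2 - p)) \<le> (t powr (2 - p)) powr (1 / (2 - p))"
    using p2 by (intro powr_mono2) auto
  also have "\<dots> = t" using t p2 by (simp add: powr_powr)
  also have "((1 - \<rho>)\<^sup>2) powr (1 / (2 - p)) = (1 - \<rho>) powr k"
    using assms(7) by (simp add: k_def powr_powr flip: powr_numeral)
  finally have tk: "(1 - \<rho>) powr k \<le> t" .
  have "1 + k * ((1 - \<rho>) - 1) \<le> (1 - \<rho>) powr k" using k assms by (intro bernoulli_powr) auto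
  then have "1 - k * \<rho> \<le> t" using tk by simp
  then have "(1 - k * \<rho>) * a \<le> t * a" using assms(1) by (intro mult_right_mono) auto
  then show "(1 - 2 / (2 - p) * \<rho>) * a \<le> \<mu>" by (simp add: t(2) k_def)
  have "1 * 1 \<le> p * k" using p1 k by (intro mult_mono) auto
  then have pk: "1 \<le> p * k" by simp
  have "1 + (p * k) * ((1 - \<rho>) - 1) \<le> (1 - \<rho>) powr (p * k)" using pk assms by (intro bernoulli_powr) auto
  also have "\<dots> = ((1 - \<rho>) powr k) powr p" by (simp add: powr_powr mult.commute)
  also have "\<dots> \<le> t powr p" using tk p1 by (intro powr_mono2) auto
  finally have "(1 - t powr p) * a powr p \<le> p * k * \<rho> * a powr p" by (intro mult_right_mono) auto
  moreover have "\<mu> powr p = t powr p * a powr p" using t assms(1) by (simp add: powr_mult)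
  ultimately show "a powr p - \<mu> powr p \<le> 2 * p / (2 - p) * \<rho> * a powr p"
    by (simp add: k_def algebra_simps)
qed

text \<open>Of the nine products of the parts y, u, z only those of y with z lie outside the two
  blocks y + u and u + z; the product of u with itself is counted twice and subtracted once. The
  nonzero entries of the upper block exceed n powr (-1 / 2), those of the lower block are at most n
  powr (-1 / q), and either way \<open>bilin_crude\<close> gives n powr ((p - 1) / 2).\<close>

lemma crude_split:
  fixes x :: "nat \<Rightarrow> real" and n :: nat
  defines "y \<equiv> \<lambda>i. if real n powr (- 1 / q) < \<bar>x i\<bar> then x i else 0"
    and "z \<equiv> \<lambda>i. if \<bar>x i\<bar> \<le> 1 / sqrt (real n) then x i else 0"
  assumes sb: "sign_bound n A G" and n: "1 \<le> n" and A: "0 \<le> A"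
    and x: "psum n p x \<le> 1"
  shows "bilin n G x x \<le> 3 * crude_const p * A * err n + sqrt 2 * bilin n (sym_mat G) y z"
proof -
  define t where "t = 1 / sqrt (real n)"
  define \<tau> where "\<tau> = real n powr (- 1 / q)"
  define u where "u i = (if t < \<bar>x i\<bar> \<and> \<bar>x i\<bar> \<le> \<tau> then x i else 0)" for i
  have te: "t = real n powr (- 1 / 2)" using n by (simp add: t_def powr_minus powr_half_sqrt divide_simps)
  have n0: "1 \<le> real n" using n by simp
  have t\<tau>: "t \<le> \<tau>" unfolding te \<tau>_def using n0 q_gt by (intro powr_mono) (auto simp: field_simps)
  have xi1: "\<bar>x i\<bar> \<le> 1" if "i \<in> {1..n}" for i
  proof -
    have "\<bar>x i\<bar> \<le> psum n p x powr (1 / p)" using that p1 by (intro abs_le_sum_powr) auto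
    also have "\<dots> \<le> 1 powr (1 / p)" using x p1 by (intro powr_mono2) (auto simp: sum_nonneg)
    finally show ?thesis by simp
  qed
  have t0: "0 < t" "t \<le> 1" using n0 by (auto simp: t_def)
  have C: "\<bar>bilin n G v v\<bar> \<le> crude_const p * A * err n"
    if v: "\<And>i. v i = x i \<or> v i = 0"
    and cond: "(\<forall>i. v i \<noteq> 0 \<longrightarrow> t < \<bar>v i\<bar>) \<or> (\<forall>i. \<bar>v i\<bar> \<le> \<tau>)" for v
  proof -
    have "\<bar>v i\<bar> powr p \<le> \<bar>x i\<bar> powr p" for i using v[of i] by auto
    then have v1: "psum n p v \<le> 1" using x by (meson sum_mono order.trans)
    have vi1: "\<bar>v i\<bar> \<le> 1" if "i \<in> {1..n}" for i using v[of i] xi1[OF that] by auto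
    show ?thesis using cond
    proof
      assume c: "\<forall>i. v i \<noteq> 0 \<longrightarrow> t < \<bar>v i\<bar>"
      have "nnz n v \<le> t powr (- p)"
        using t0 p1 v1 c by (intro card_supp_le[where s = t and v = v]) (auto simp: supp_def intro: less_imp_le)
      then have "\<bar>bilin n G v v\<bar> \<le> crude_const p * A * sqrt (ln (real n)) * 1 powr (1 - p / 2) * t powr (1 - p)"
        using bilin_crude[OF sb p1 p2 n A v1, of 1 t] vi1 t0 by auto
      also have "t powr (1 - p) = real n powr ((p - 1) / 2)"
        unfolding te powr_powr by (rule arg_cong2[where f = "(powr)"]) (auto simp: field_simps)
      finally show ?thesis by (simp add: err_def mult_ac)
    next
      assume c: "\<forall>i. \<bar>v i\<bar> \<le> \<tau>"
      \<comment> \<open>Entries of the lower block may be arbitrarily small. This lo satisfies lo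
        powr (- p) = n, which turns the trivial support bound n into the hypothesis of
        \<open>bilin_crude\<close>.\<close>
      define lo where "lo = real n powr (- 1 / p)"
      have "1 / q \<le> 1 / p" using q_gt p2 p1 by (intro divide_left_mono) auto
      then have lo: "0 < lo" "lo \<le> \<tau>" unfolding lo_def \<tau>_def using n0 by (auto intro!: powr_mono)
      have "card (supp n v) \<le> card {1..n}" by (intro card_mono) (auto simp: supp_def)
      then have "nnz n v \<le> real n" by simp
      also have "\<dots> = lo powr (- p)" using p1 n0 by (simp add: lo_def powr_powr)
      finally have "\<bar>bilin n G v v\<bar> \<le> crude_const p * A * sqrt (ln (real n)) * \<tau> powr (1 - p / 2) * lo powr (1 - p)"
        using bilin_crude[OF sb p1 p2 n A v1, of \<tau> lo] c lo by auto
      also have "\<dots> = crude_const p * A * sqrt (ln (real n)) * (\<tau> powr (1 - p / 2) * lo powr (1 - p))"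
        by (simp only: mult.assoc)
      also have "\<tau> powr (1 - p / 2) * lo powr (1 - p) = real n powr (- 1 / q * (1 - p / 2) + - 1 / p * (1 - p))"
        by (simp only: lo_def \<tau>_def powr_powr powr_add)
      also have "- 1 / q * (1 - p / 2) + - 1 / p * (1 - p) = (p - 1) / 2"
      proof -
        have "- 1 / q * (1 - p / 2) + - 1 / p * (1 - p) = - (1 / q) + (p / q) / 2 + (p - 1) / p"
          by (simp add: right_diff_distrib diff_divide_distrib)
        then show ?thesis by (simp only: exp_simps)
      qed
      finally show ?thesis by (simp add: err_def mult_ac)
    qed
  qed
  have yd: "y i = (if \<tau> < \<bar>x i\<bar> then x i else 0)" for i by (simp only: y_def \<tau>_def)
  have zd: "z i = (if \<bar>x i\<bar> \<le> t then x i else 0)" for i by (simp only: z_def t_def)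
  have xs: "x = (\<lambda>i. y i + u i + z i)" using t\<tau> by (auto simp: fun_eq_iff yd u_def zd)
  have yu: "y i + u i = (if t < \<bar>x i\<bar> then x i else 0)" for i using t\<tau> by (auto simp: yd u_def)
  have uz: "u i + z i = (if \<bar>x i\<bar> \<le> \<tau> then x i else 0)" for i using t\<tau> by (auto simp: zd u_def)
  have "bilin n G x x = bilin n G (\<lambda>i. y i + u i) (\<lambda>i. y i + u i) + bilin n G (\<lambda>i. u i + z i) (\<lambda>i. u i + z i)
     - bilin n G u u + (bilin n G y z + bilin n G z y)"
    by (subst (1 2) xs) (simp add: bilin_add_left bilin_add_right)
  moreover have "\<bar>bilin n G (\<lambda>i. y i + u i) (\<lambda>i. y i + u i)\<bar> \<le> crude_const p * A * err n"
    unfolding yu by (rule C, force, rule disjI1, auto)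
  moreover have "\<bar>bilin n G (\<lambda>i. u i + z i) (\<lambda>i. u i + z i)\<bar> \<le> crude_const p * A * err n"
    unfolding uz using t\<tau> t0 by (intro C[OF _ disjI2]) auto
  moreover have "\<bar>bilin n G u u\<bar> \<le> crude_const p * A * err n"
    by (rule C, force simp: u_def, rule disjI1, auto simp: u_def)
  ultimately show ?thesis unfolding bilin_add_transpose by linarith
qed

text \<open>v_i is the norming vector of row i: paired with the row it gives the row's q-norm W, the
  equality case of Hoelder's inequality. The second conclusion writes the row as W times the
  gradient of |.|^p / p at v_i, the form required by \<open>holder_stability\<close>.\<close>

lemma opt_vec_props:
  defines "W \<equiv> \<lambda>n G i. pnorm n q (mat_vec n (sym_mat G) (basis_vec i))"
  assumes i: "i \<in> {1..n}" and W: "0 < W n G i"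
  shows "(\<Sum>j\<in>{1..n}. \<bar>opt_vec n p q G i j\<bar> powr p) = 1"
    and "\<And>j. sym_mat G i j = W n G i * (sgn1 (opt_vec n p q G i j) * \<bar>opt_vec n p q G i j\<bar> powr (p - 1))"
    and "\<And>j. \<bar>opt_vec n p q G i j\<bar> = (\<bar>sym_mat G i j\<bar> / W n G i) powr (q / p)"
    and "(\<Sum>j\<in>{1..n}. sym_mat G i j * opt_vec n p q G i j) = W n G i"
proof -
  define w where "w = W n G i"
  define g where "g j = sym_mat G i j" for j
  have w0: "0 < w" using W by (simp add: w_def)
  have "mat_vec n (sym_mat G) (basis_vec i) j = g j" for j
    using mat_vec_basis_vec[OF i] by (simp add: g_def)
  then have w: "w = (\<Sum>j\<in>{1..n}. \<bar>g j\<bar> powr q) powr (1 / q)" by (simp add: w_def W_def pnorm_def)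
  have wq: "w powr q = (\<Sum>j\<in>{1..n}. \<bar>g j\<bar> powr q)"
    using q_gt unfolding w by (simp add: powr_powr sum_nonneg)
  define v where "v j = opt_vec n p q G i j" for j
  have v: "v j = sgn1 (g j) * (\<bar>g j\<bar> powr q / w powr q) powr (1 / p)" for j
    by (simp add: v_def opt_vec_def g_def w_def W_def)
  have av: "\<bar>v j\<bar> = (\<bar>g j\<bar> powr q / w powr q) powr (1 / p)" for j by (simp add: v abs_mult sgn1_def)
  have avp: "\<bar>v j\<bar> powr p = \<bar>g j\<bar> powr q / w powr q" for j using p1 w0 by (simp add: av powr_powr)
  have avq: "\<bar>v j\<bar> = (\<bar>g j\<bar> / w) powr (q / p)" for j
    using w0 by (simp add: av powr_powr flip: powr_divide)
  have s1: "psum n p v = 1"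
  proof -
    have "psum n p v = (\<Sum>j\<in>{1..n}. \<bar>g j\<bar> powr q) / w powr q" by (simp only: avp sum_divide_distrib)
    also have "\<dots> = 1" unfolding wq[symmetric] using w0 by simp
    finally show ?thesis .
  qed
  have av1: "\<bar>v j\<bar> powr (p - 1) = \<bar>g j\<bar> / w" for j
  proof -
    have "q / p * (p - 1) = 1" using exp_simps(1,3) by (simp add: mult.commute)
    then show ?thesis using w0 by (simp add: avq powr_powr)
  qed
  have gv: "g j = w * (sgn1 (v j) * \<bar>v j\<bar> powr (p - 1))" for j
  proof (cases "g j = 0")
    case True then show ?thesis by (simp add: av1)
  next
    case False
    have "sgn1 (v j) = sgn1 (g j)" using False w0 by (simp add: v sgn1_def zero_le_mult_iff)
    then show ?thesis using w0 by (simp add: av1 sgn1_def)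
  qed
  have "g j * v j = w * \<bar>v j\<bar> powr p" for j
  proof -
    have "g j * v j = w * (\<bar>v j\<bar> powr (p - 1) * (sgn1 (v j) * v j))" by (subst gv) simp
    also have "sgn1 (v j) * v j = \<bar>v j\<bar>" by (rule sgn1_mult_self)
    also have "\<bar>v j\<bar> powr (p - 1) * \<bar>v j\<bar> = \<bar>v j\<bar> powr p" by (cases "v j = 0") (simp_all add: powr_diff)
    finally show ?thesis .
  qed
  then have "(\<Sum>j\<in>{1..n}. g j * v j) = w * (psum n p v)" by (simp add: sum_distrib_left)
  then have 4: "(\<Sum>j\<in>{1..n}. g j * v j) = w" by (simp only: s1)
  show "(\<Sum>j\<in>{1..n}. \<bar>opt_vec n p q G i j\<bar> powr p) = 1" using s1 by (simp add: v_def)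
  show "\<And>j. sym_mat G i j = W n G i * (sgn1 (opt_vec n p q G i j) * \<bar>opt_vec n p q G i j\<bar> powr (p - 1))"
    using gv by (simp add: v_def g_def w_def)
  show "\<And>j. \<bar>opt_vec n p q G i j\<bar> = (\<bar>sym_mat G i j\<bar> / W n G i) powr (q / p)"
    using avq by (simp add: v_def g_def w_def)
  show "(\<Sum>j\<in>{1..n}. sym_mat G i j * opt_vec n p q G i j) = W n G i"
    using 4 by (simp add: v_def g_def w_def)
qed

end

section \<open>Near maximizers are close to the candidate points\<close>

text \<open>Serves as triangle inequality for p-th powers of norms; 25 bounds 5 powr p.\<close>

lemma abs_sum5_powr:
  fixes a b c d e :: real
  assumes "1 < p" "p < 2"
  shows "\<bar>a + b + c + d + e\<bar> powr p \<le> 25 * (\<bar>a\<bar> powr p + \<bar>b\<bar> powr p + \<bar>c\<bar> powr p + \<bar>d\<bar> powr p + \<bar>e\<bar> powr p)"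
proof -
  define m where "m = Max {\<bar>a\<bar>, \<bar>b\<bar>, \<bar>c\<bar>, \<bar>d\<bar>, \<bar>e\<bar>}"
  have m: "\<bar>a\<bar> \<le> m" "\<bar>b\<bar> \<le> m" "\<bar>c\<bar> \<le> m" "\<bar>d\<bar> \<le> m" "\<bar>e\<bar> \<le> m" by (simp_all add: m_def le_max_iff_disj)
  have "m \<in> {\<bar>a\<bar>, \<bar>b\<bar>, \<bar>c\<bar>, \<bar>d\<bar>, \<bar>e\<bar>}" unfolding m_def by (intro Max_in) auto
  then have mp: "m powr p \<le> \<bar>a\<bar> powr p + \<bar>b\<bar> powr p + \<bar>c\<bar> powr p + \<bar>d\<bar> powr p + \<bar>e\<bar> powr p"
    by (elim insertE) (auto simp: add_increasing add_increasing2)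
  have "\<bar>a + b + c + d + e\<bar> powr p \<le> (5 * m) powr p" using m assms by (intro powr_mono2) auto
  also have "\<dots> = 5 powr p * m powr p" by (rule powr_mult)
  also have "\<dots> \<le> 25 * m powr p"
  proof (intro mult_right_mono)
    have "5 powr p \<le> 5 powr (2::real)" using assms by (intro powr_mono) auto
    then show "5 powr p \<le> (25::real)" by simp
  qed simp
  also have "\<dots> \<le> 25 * (\<bar>a\<bar> powr p + \<bar>b\<bar> powr p + \<bar>c\<bar> powr p + \<bar>d\<bar> powr p + \<bar>e\<bar> powr p)" using mp by simp
  finally show ?thesis .
qed

lemma abs_powr_sub_one_le:
  assumes "0 \<le> (s::real)" "0 < r" "r \<le> 1"
  shows "\<bar>s powr r - 1\<bar> \<le> \<bar>s - 1\<bar>"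
proof (cases "s \<le> 1")
  case True
  have "s powr 1 \<le> s powr r" if "s \<noteq> 0" using True assms that by (intro powr_mono') auto
  moreover have "s powr r \<le> 1" using True assms powr_mono2[of r s 1] by simp
  ultimately show ?thesis using assms True by (cases "s = 0") auto
next
  case False
  then have "s powr r \<le> s powr 1" using assms by (intro powr_mono) auto
  moreover have "1 \<le> s powr r" using False assms by (intro ge_one_powr_ge_zero) auto
  ultimately show ?thesis using False by auto
qed

context conjugate_exponents begin

text \<open>e_i and v_i have p-norm 1 and overlap in coordinate i only, so the p-th power of the
  norm of their sum differs from 2 by at most 3 V. Hence multiplication by c0 nearly normalizes the
  sum.\<close>

lemma normalizer_bound:
  fixes v :: "nat \<Rightarrow> real"
  defines "w \<equiv> \<lambda>i j. basis_vec i j + v j"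
  assumes i: "i \<in> {1..n}" and v: "psum n p v = 1" and V: "\<bar>v i\<bar> \<le> V" "V \<le> 1 / 8"
  shows "(\<Sum>j\<in>{1..n}. \<bar>c0 * w i j - w i j / pnorm n p (w i)\<bar> powr p) \<le> (2 * V) powr p"
proof -
  define X where "X = (\<Sum>j\<in>{1..n}. \<bar>w i j\<bar> powr p)"
  have V0: "0 \<le> V" using V by linarith
  have "X = \<bar>1 + v i\<bar> powr p + (\<Sum>j\<in>{1..n} - {i}. \<bar>v j\<bar> powr p)"
    unfolding X_def by (subst sum.remove[of _ i]) (use i in \<open>auto simp: w_def basis_vec_def intro!: sum.cong\<close>)
  moreover have "1 = \<bar>v i\<bar> powr p + (\<Sum>j\<in>{1..n} - {i}. \<bar>v j\<bar> powr p)"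
    unfolding v[symmetric] by (subst sum.remove[of _ i]) (use i in auto)
  ultimately have X: "X = \<bar>1 + v i\<bar> powr p + 1 - \<bar>v i\<bar> powr p" by simp
  have "\<bar>v i\<bar> powr p \<le> V"
  proof (cases "v i = 0")
    case False
    have "\<bar>v i\<bar> powr p \<le> \<bar>v i\<bar> powr 1" using False V p1 by (intro powr_mono') auto
    then show ?thesis using V by simp
  qed (use V0 in simp)
  moreover have "\<bar>1 + v i\<bar> powr p \<le> 1 + 3 * V"
  proof -
    have "\<bar>1 + v i\<bar> powr p \<le> (1 + V) powr p" using V p1 by (intro powr_mono2) auto
    also have "\<dots> \<le> (1 + V) powr 2" using V0 p2 by (intro powr_mono) auto
    also have "\<dots> = 1 + 2 * V + V * V" using V0 by (simp add: power2_eq_square algebra_simps)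
    also have "\<dots> \<le> 1 + 2 * V + V * 1" using V0 V by (intro add_left_mono mult_left_mono) auto
    finally show ?thesis by simp
  qed
  moreover have "1 - 2 * V \<le> \<bar>1 + v i\<bar> powr p"
  proof -
    have "1 - 2 * V \<le> 1 + p * ((1 - V) - 1)" using p2 V0 by (simp add: mult_right_mono)
    also have "\<dots> \<le> (1 - V) powr p" using V p1 by (intro bernoulli_powr) auto
    also have "\<dots> \<le> \<bar>1 + v i\<bar> powr p" using V p1 by (intro powr_mono2) auto
    finally show ?thesis .
  qed
  moreover have "0 \<le> \<bar>v i\<bar> powr p" by simp
  ultimately have Xb: "\<bar>X - 2\<bar> \<le> 3 * V" using X by linarith
  then have X0: "0 < X" using V by linarith
  define \<nu> where "\<nu> = X powr (1 / p)"
  have \<nu>: "pnorm n p (w i) = \<nu>" "0 < \<nu>" "\<nu> powr p = X"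
    using X0 p1 by (simp_all add: pnorm_def X_def \<nu>_def powr_powr)
  have "c0 * \<nu> = (X / 2) powr (1 / p)"
    using X0 by (simp add: \<nu>_def c0_def powr_divide powr_minus field_simps)
  then have "\<bar>c0 * \<nu> - 1\<bar> \<le> \<bar>X / 2 - 1\<bar>" using abs_powr_sub_one_le[of "X / 2" "1 / p"] X0 p1 by simp
  also have "\<dots> = \<bar>X - 2\<bar> / 2" by (simp add: abs_if)
  also have "\<dots> \<le> 2 * V" using Xb V0 by simp
  finally have cn: "\<bar>c0 * \<nu> - 1\<bar> \<le> 2 * V" .
  have "(\<Sum>j\<in>{1..n}. \<bar>c0 * w i j - w i j / \<nu>\<bar> powr p) = (\<Sum>j\<in>{1..n}. \<bar>c0 - 1 / \<nu>\<bar> powr p * \<bar>w i j\<bar> powr p)"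
  proof (intro sum.cong refl)
    fix j
    have "c0 * w i j - w i j / \<nu> = (c0 - 1 / \<nu>) * w i j" by (simp add: algebra_simps)
    then show "\<bar>c0 * w i j - w i j / \<nu>\<bar> powr p = \<bar>c0 - 1 / \<nu>\<bar> powr p * \<bar>w i j\<bar> powr p"
      by (simp add: abs_mult powr_mult)
  qed
  also have "\<dots> = \<bar>c0 - 1 / \<nu>\<bar> powr p * \<nu> powr p" unfolding \<nu>(3) X_def by (simp add: sum_distrib_left)
  also have "\<dots> = (\<bar>c0 - 1 / \<nu>\<bar> * \<nu>) powr p" using \<nu> by (simp add: powr_mult)
  also have "\<bar>c0 - 1 / \<nu>\<bar> * \<nu> = \<bar>(c0 - 1 / \<nu>) * \<nu>\<bar>" using \<nu> by (simp add: abs_mult)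
  also have "(c0 - 1 / \<nu>) * \<nu> = c0 * \<nu> - 1" using \<nu>(2) by (simp add: field_simps)
  also have "\<bar>c0 * \<nu> - 1\<bar> powr p \<le> (2 * V) powr p" using cn p1 by (intro powr_mono2) auto
  finally show ?thesis by (simp add: \<nu>(1))
qed

definition coord_const :: real where "coord_const = 2 * p / (2 - p)"
text \<open>384 = 3 * 128: the total deficit is at most 3 \<eta> N with \<eta> =
  \<open>coord_const\<close> s, and the convexity gain has weight at least (p - 1) / (8 * 16), the
  16 coming from \<mu> W \<ge> N / 16.\<close>

definition stab_const :: real where "stab_const = 384 * coord_const / (p - 1)"
text \<open>The first summand absorbs the error of one application of
  \<open>cross_term_bound\<close>; the second is twice the error in the upper bound for the row
  norm.\<close>

definition err_main :: "real \<Rightarrow> real \<Rightarrow> real" where "err_main A1 A2 = (2 * A1 + A2) + 4 * (2 * A1 + (2 * A1 + A2))"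
definition err_total :: "real \<Rightarrow> real \<Rightarrow> real" where "err_total A1 A2 = 3 * crude_const p * A1 + sqrt 2 * err_main A1 A2"
text \<open>Bound for the entries of v_i: an entry of row i is at most 2 A sqrt (ln n), the row norm
  is at least \<open>gauss_norm n / 16\<close>, and the quotient enters with exponent q / p.\<close>

definition vec_max :: "nat \<Rightarrow> real \<Rightarrow> real" where
  "vec_max n A = (32 * A * sqrt (ln (real n)) / gauss_norm n) powr (q / p)"

text \<open>The summands belong to the dominant entry, the minor entries of y, the middle range, and
  the distance of z from c0 v_i, up to a sign. The normalization error is kept apart, in terms of
  \<open>vec_max\<close>.\<close>

abbreviation dist_coef :: "real \<Rightarrow> real" where
  "dist_coef c \<equiv> 25 * (((1 + coord_const) * c) powr p + coord_const * c\<^sup>2 + 2 * c\<^sup>2 + 7 * (sqrt (stab_const * c)) powr p)"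

lemma coord_const: "2 \<le> coord_const" "2 / (2 - p) \<le> coord_const"
proof -
  have "2 * (2 - p) / (2 - p) \<le> 2 * p / (2 - p)" using p1 p2 by (intro divide_right_mono) auto
  then show "2 \<le> coord_const" using p2 by (simp add: coord_const_def del: right_diff_distrib_numeral)
  show "2 / (2 - p) \<le> coord_const" using p1 p2 unfolding coord_const_def by (intro divide_right_mono) auto
qed

text \<open>The upper bound for the row norm W follows from \<open>cross_term_bound\<close> itself:
  e_i is an admissible y, and c0 v_i with coordinate i deleted is an admissible z of mass at most 1
  / 2, where \<open>main_coef\<close> is at most c0. The cross term of this pair is c0 W up to a
  diagonal entry.\<close>

lemma opt_vec_norm_le:
  assumes sb: "sign_bound n A1 G" and yb: "young_bound n A2 G" and n: "3 \<le> n" and \<xi>: "0 < gauss_xi q"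
    and A: "0 \<le> A1" "0 \<le> A2" and V: "vec_max n A1 \<le> 1 / sqrt (real n)" "vec_max n A1 \<le> 1 / 8"
    and i: "i \<in> {1..n}" and W: "W = pnorm n q (mat_vec n (sym_mat G) (basis_vec i))" "gauss_norm n / 16 \<le> W"
  shows "\<bar>opt_vec n p q G i j\<bar> \<le> vec_max n A1 \<or> j \<notin> {1..n}"
    and "W \<le> gauss_norm n + 2 * (2 * A1 + (2 * A1 + A2)) * err n"
proof -
  define N where "N = gauss_norm n"
  define v where "v = opt_vec n p q G i"
  define V where "V = vec_max n A1"
  have N0: "0 < N" using \<xi> n by (simp add: N_def gauss_norm_def)
  have W0: "0 < W" using W N0 by (simp add: N_def)
  have L0: "0 \<le> ln (real n)" using n by simp
  note ov = opt_vec_props[OF i W0[unfolded W(1)], folded W(1) v_def]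
  have vV: "\<bar>v j\<bar> \<le> V" if "j \<in> {1..n}" for j
  proof -
    have "\<bar>sym_mat G i j\<bar> / W \<le> (2 * A1 * sqrt (ln (real n))) / (N / 16)"
      using sym_entry_bound[OF sb i that] W(2) N0 by (intro frac_le) (auto simp: N_def)
    also have "\<dots> = 32 * A1 * sqrt (ln (real n)) / N" by simp
    finally show ?thesis unfolding ov(3) V_def vec_max_def N_def
      using W0 q_gt p1 by (intro powr_mono2) auto
  qed
  then show "\<bar>opt_vec n p q G i j\<bar> \<le> vec_max n A1 \<or> j \<notin> {1..n}" by (auto simp: v_def V_def)
  define z where "z j = (if j = i then 0 else c0 * v j)" for j
  note E = sqrt_ln_le_err[OF n] and E0 = err_nonneg[OF n]
  have sB: "supp n (basis_vec i) = {i}" using i by (auto simp: supp_def basis_vec_def)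
  have "l2norm n (basis_vec i) \<le> sqrt (\<Sum>j\<in>{1..n}. if j = i then 1 else 0)"
    unfolding l2norm_def basis_vec_def by (intro real_sqrt_le_mono sum_mono) auto
  then have l2: "l2norm n (basis_vec i) \<le> 1" using i by simp
  have "bilin n (sym_mat G) (basis_vec i) z \<le>
    l2norm n (basis_vec i) * gauss_norm n * main_coef (psum n p z) + (2 * A1 + A2) * err n"
  proof (rule cross_term_bound[OF sb yb n \<xi> A])
    show "nnz n (basis_vec i) \<le> real n powr (p - 1)" using n p1 by (simp add: sB ge_one_powr_ge_zero)
    show "\<bar>z j\<bar> \<le> 1 / sqrt (real n)" if "j \<in> {1..n}" for j
    proof -
      have "\<bar>z j\<bar> \<le> 1 * \<bar>v j\<bar>" using c0 mult_right_mono[of c0 1 "\<bar>v j\<bar>"] by (simp add: z_def abs_mult)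
      then show ?thesis using vV[OF that] assms(7) by (simp add: V_def)
    qed
  qed (use l2 in \<open>auto simp: basis_vec_def z_def split: if_splits\<close>)
  also have "\<dots> \<le> 1 * N * c0 + (2 * A1 + A2) * err n"
  proof (intro add_right_mono mult_mono)
    have "psum n p z \<le> (\<Sum>j\<in>{1..n}. c0 powr p * \<bar>v j\<bar> powr p)"
      using c0 by (intro sum_mono) (auto simp: z_def abs_mult powr_mult)
    also have "\<dots> = 1 / 2" using ov(1) by (simp only: sum_distrib_left[symmetric] c0(4))
    finally show "main_coef (psum n p z) \<le> c0" using main_coef_bounds(3,4) by metis
    show "0 \<le> main_coef (psum n p z)" by (intro main_coef_bounds(1) sum_nonneg) simp
  qed (use l2 N0 in \<open>auto simp: N_def\<close>)
  finally have 1: "bilin n (sym_mat G) (basis_vec i) z \<le> N * c0 + (2 * A1 + A2) * err n" by simp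
  have "bilin n (sym_mat G) (basis_vec i) z = (\<Sum>k\<in>{1..n}. if k = i then (\<Sum>j\<in>{1..n}. sym_mat G i j * z j) else 0)"
    unfolding bilin_left by (intro sum.cong refl) (simp add: basis_vec_def)
  then have 2: "bilin n (sym_mat G) (basis_vec i) z = (\<Sum>j\<in>{1..n}. sym_mat G i j * z j)" using i by simp
  have "c0 * W = (\<Sum>j\<in>{1..n}. c0 * (sym_mat G i j * v j))" unfolding ov(4)[symmetric] by (simp add: sum_distrib_left)
  also have "\<dots> = (\<Sum>j\<in>{1..n}. sym_mat G i j * z j + (if j = i then c0 * (sym_mat G i i * v i) else 0))"
    by (intro sum.cong) (auto simp: z_def)
  also have "\<dots> = (\<Sum>j\<in>{1..n}. sym_mat G i j * z j) + c0 * (sym_mat G i i * v i)"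
    using i by (simp add: sum.distrib)
  also have "c0 * (sym_mat G i i * v i) \<le> c0 * (\<bar>sym_mat G i i\<bar> * \<bar>v i\<bar>)"
    using c0 by (intro mult_left_mono) (auto simp flip: abs_mult)
  also have "\<dots> \<le> 1 * (2 * A1 * sqrt (ln (real n)) * 1)"
    using c0 sym_entry_bound[OF sb i i] vV[OF i] assms(8) A L0 by (intro mult_mono mult_nonneg_nonneg) (auto simp: V_def)
  also have "\<dots> \<le> 2 * A1 * err n" using mult_left_mono[OF E, of "2 * A1"] A by simp
  finally have "c0 * W \<le> c0 * N + (2 * A1 + (2 * A1 + A2)) * err n"
    using 1 2 by (simp add: ring_distribs mult_ac)
  then have "W \<le> N + (2 * A1 + (2 * A1 + A2)) * err n / c0" using c0 by (simp add: field_simps)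
  also have "\<dots> \<le> N + (2 * A1 + (2 * A1 + A2)) * err n / (1 / 2)"
    using c0 A E0 by (intro add_left_mono divide_left_mono) auto
  finally show "W \<le> gauss_norm n + 2 * (2 * A1 + (2 * A1 + A2)) * err n" by (simp add: N_def ring_distribs)
qed

text \<open>The defect s^2 gives bounds of second order for the middle range and for the mass of the
  minor entries. These entries, however, enter the form through their second norm and cost a term
  linear in s, which limits the control of the convexity gain X to order s.\<close>

theorem near_maximizer_close_to_opt:
  assumes sb: "sign_bound n A1 G" and yb: "young_bound n A2 G" and n: "3 \<le> n" and \<xi>: "0 < gauss_xi q"
    and A: "0 \<le> A1" "0 \<le> A2" and x: "psum n p x = 1"
    and s0: "0 < s" "s \<le> 1 / 2" "coord_const * s \<le> 1 / 32"
    and V: "vec_max n A1 \<le> 1 / sqrt (real n)" "vec_max n A1 \<le> 1 / 8"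
    and big: "sqrt 2 * c0\<^sup>2 * (1 - s\<^sup>2) * gauss_norm n + err_total A1 A2 * err n < bilin n G x x"
  shows "\<exists>i\<in>{1..n}. \<exists>\<epsilon>\<in>{1, -1}. (\<Sum>j\<in>{1..n}. \<bar>x j - \<epsilon> * opt_point n p q G i j\<bar> powr p) \<le>
    dist_coef s + 25 * (2 * vec_max n A1) powr p"
proof -
  define \<rho> where "\<rho> = s\<^sup>2"
  have s: "0 < s" "s \<le> 1" "\<rho> = s * s" "sqrt \<rho> = s" using s0 by (auto simp: \<rho>_def power2_eq_square)
  have "s\<^sup>2 \<le> (1 / 2)\<^sup>2" using s0 by (intro power_mono) auto
  then have \<rho>: "0 < \<rho>" "\<rho> \<le> 1 / 4" using s by (simp_all add: \<rho>_def power2_eq_square)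
  define N where "N = gauss_norm n"
  define E where "E = err n"
  define V where "V = vec_max n A1"
  define Km where "Km = 2 * A1 + A2"
  \<comment> \<open>\<open>K' * E\<close> will bound the excess of the row norm W over N; the
    hypothesis \<open>big\<close> keeps twice this amount in reserve.\<close>
  define K' where "K' = 2 * (2 * A1 + Km)"
  have N0: "0 < N" using \<xi> n by (simp add: N_def gauss_norm_def)
  have L0: "0 \<le> ln (real n)" using n by simp
  have E0: "0 \<le> E" using L0 by (simp add: E_def err_def)
  have K0: "0 \<le> Km" "0 \<le> K'" using A by (simp_all add: Km_def K'_def)
  have EM: "err_main A1 A2 = Km + 2 * K'" by (simp add: err_main_def Km_def K'_def)
  define \<tau> where "\<tau> = real n powr (- 1 / q)"
  define t where "t = 1 / sqrt (real n)"
  define y where "y i = (if \<tau> < \<bar>x i\<bar> then x i else 0)" for i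
  define z where "z i = (if \<bar>x i\<bar> \<le> t then x i else 0)" for i
  define u where "u i = (if t < \<bar>x i\<bar> \<and> \<bar>x i\<bar> \<le> \<tau> then x i else 0)" for i
  have te: "t = real n powr (- 1 / 2)" using n by (simp add: t_def powr_minus powr_half_sqrt divide_simps)
  have t\<tau>: "t \<le> \<tau>" unfolding te \<tau>_def using n q_gt by (intro powr_mono) (auto simp: field_simps)
  have \<tau>0: "0 < \<tau>" using n by (simp add: \<tau>_def)
  have xs: "x i = y i + u i + z i" for i using t\<tau> by (auto simp: y_def u_def z_def)
  define Y U B where "Y = psum n p y" and "U = psum n p u"
    and "B = psum n p z"
  have "\<bar>x i\<bar> powr p = \<bar>y i\<bar> powr p + \<bar>u i\<bar> powr p + \<bar>z i\<bar> powr p" for i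
    using t\<tau> by (auto simp: y_def u_def z_def)
  then have YUB: "Y + U + B = 1" using x by (simp add: Y_def U_def B_def sum.distrib)
  have nn: "0 \<le> Y" "0 \<le> U" "0 \<le> B" by (simp_all add: Y_def U_def B_def sum_nonneg)
  have "bilin n G x x \<le> 3 * crude_const p * A1 * E + sqrt 2 * bilin n (sym_mat G) y z"
    using crude_split[OF sb _ A(1), of x] x n unfolding y_def z_def \<tau>_def t_def E_def by simp
  then have "sqrt 2 * (c0\<^sup>2 * (1 - \<rho>) * N + err_main A1 A2 * E) < sqrt 2 * bilin n (sym_mat G) y z"
    using big by (simp add: err_total_def N_def E_def \<rho>_def algebra_simps)
  then have big2: "c0\<^sup>2 * (1 - \<rho>) * N + (Km + 2 * K') * E < bilin n (sym_mat G) y z" by (simp add: EM)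
  define a where "a = Y powr (1 / p)"
  have ap: "a powr p = Y" using nn p1 by (simp add: a_def powr_powr)
  have a01: "0 \<le> a" "a \<le> 1"
  proof -
    have "Y powr (1 / p) \<le> 1 powr (1 / p)" using nn YUB p1 by (intro powr_mono2) auto
    then show "0 \<le> a" "a \<le> 1" by (simp_all add: a_def)
  qed
  define \<sigma> where "\<sigma> = l2norm n y"
  have \<sigma>: "0 \<le> \<sigma>" "\<sigma> \<le> a" unfolding \<sigma>_def a_def Y_def by (rule l2norm_nonneg l2norm_le_pnorm)+
  have ya: "\<bar>y i\<bar> \<le> a" if "i \<in> {1..n}" for i unfolding a_def Y_def using that p1 by (intro abs_le_sum_powr) auto
  have cy: "nnz n y \<le> real n powr (p - 1)"
  proof -
    have "psum n p y \<le> 1" using nn YUB by (simp add: Y_def)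
    then have "nnz n y \<le> \<tau> powr (- p)"
      by (rule card_supp_le[rotated 2, where v = y]) (use \<tau>0 p1 in \<open>auto simp: supp_def y_def split: if_splits\<close>)
    also have "\<dots> = real n powr (p / q)" by (simp add: \<tau>_def powr_powr)
    finally show ?thesis using exp_simps by simp
  qed
  have zt: "\<bar>z i\<bar> \<le> 1 / sqrt (real n)" for i using n by (simp add: z_def t_def)
  have yz: "z i = 0" if "y i \<noteq> 0" for i using that t\<tau> by (auto simp: y_def z_def split: if_splits)
  have "bilin n (sym_mat G) y z \<le> \<sigma> * N * main_coef B + Km * E" unfolding \<sigma>_def N_def B_def Km_def E_def
    by (rule cross_term_bound[OF sb yb n \<xi> A]) (use ya a01 cy \<sigma> zt yz in \<open>fastforce simp: \<sigma>_def\<close>)+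
  then have "c0\<^sup>2 * (1 - \<rho>) * N \<le> \<sigma> * main_coef B * N"
    using big2 mult_nonneg_nonneg[OF K0(2) E0] by (simp add: algebra_simps)
  then have sm: "c0\<^sup>2 * (1 - \<rho>) \<le> \<sigma> * main_coef B" using N0 by simp
  note ne = near_extremal_scalars[OF a01(1) _ nn(2,3) \<sigma> _ \<rho>(2) sm]
  have YUB': "a powr p + U + B = 1" "0 \<le> \<rho>" using ap YUB \<rho> by auto
  note ne = ne[OF YUB']
  obtain i where i: "i \<in> {1..n}" and imax: "\<And>j. j \<in> {1..n} \<Longrightarrow> \<bar>y j\<bar> \<le> \<bar>y i\<bar>"
  proof -
    have "Max ((\<lambda>j. \<bar>y j\<bar>) ` {1..n}) \<in> (\<lambda>j. \<bar>y j\<bar>) ` {1..n}" using n by (intro Max_in) auto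
    then obtain i where "i \<in> {1..n}" "Max ((\<lambda>j. \<bar>y j\<bar>) ` {1..n}) = \<bar>y i\<bar>" by auto
    then show ?thesis using Max_ge[of "(\<lambda>j. \<bar>y j\<bar>) ` {1..n}"] by (intro that[of i]) auto
  qed
  define \<mu> where "\<mu> = \<bar>y i\<bar>"
  define \<epsilon> where "\<epsilon> = sgn1 (y i)"
  have \<epsilon>: "\<epsilon> \<in> {1, -1}" "\<bar>\<epsilon>\<bar> = 1" "\<epsilon> * \<epsilon> = 1" "y i = \<epsilon> * \<mu>" by (auto simp: \<epsilon>_def \<mu>_def sgn1_def)
  have \<mu>: "0 \<le> \<mu>" "\<mu> \<le> a" using ya[OF i] by (auto simp: \<mu>_def)
  have "\<sigma>\<^sup>2 \<le> \<mu> powr (2 - p) * a powr p"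
    using l2norm_le[of n y \<mu>] imax by (simp add: \<sigma>_def \<mu>_def ap Y_def)
  note dc = dominant_coordinate_scalar[OF ne(1) \<mu> this ne(2) YUB'(2)]
  have \<rho>1: "\<rho> \<le> 1" using \<rho> by simp
  note dc = dc[OF \<rho>1]
  define r where "r j = (if j = i then 0 else y j)" for j
  define R where "R = psum n p r"
  have R: "R = Y - \<mu> powr p"
  proof -
    have "Y = (\<Sum>j\<in>{1..n}. \<bar>r j\<bar> powr p + (if j = i then \<mu> powr p else 0))"
      unfolding Y_def by (intro sum.cong) (auto simp: r_def \<mu>_def)
    then show ?thesis using i by (simp add: sum.distrib R_def)
  qed
  have Y1: "Y \<le> 1" using YUB nn by simp
  have "R \<le> coord_const * \<rho> * Y" using dc(2) by (simp add: R ap coord_const_def)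
  also have "\<dots> \<le> coord_const * \<rho> * 1" using Y1 coord_const \<rho> by (intro mult_left_mono) auto
  finally have R\<rho>: "R \<le> coord_const * \<rho>" by simp
  have R0: "0 \<le> R" by (simp add: R_def sum_nonneg)
  define \<eta> where "\<eta> = coord_const * s"
  have \<eta>: "0 < \<eta>" "\<eta> \<le> 1 / 32" "s \<le> \<eta>" 
  proof -
    show "0 < \<eta>" using s coord_const(1) by (simp add: \<eta>_def)
    show "\<eta> \<le> 1 / 32" using s0(3) by (simp add: \<eta>_def)
    have "1 * s \<le> coord_const * s" using s coord_const(1) by (intro mult_right_mono) auto
    then show "s \<le> \<eta>" by (simp add: \<eta>_def)
  qed
  \<comment> \<open>R is of second order in s, and 2 / p > 1 with \<eta> < 1 gives \<eta> powr (2 /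
    p) \<le> \<eta>.\<close>
  have \<sigma>r: "l2norm n r \<le> \<eta>"
  proof -
    have "l2norm n r \<le> R powr (1 / p)" unfolding R_def by (rule l2norm_le_pnorm)
    also have "\<dots> \<le> (\<eta> powr 2) powr (1 / p)"
    proof (intro powr_mono2)
      have "R \<le> coord_const * (s * s)" using R\<rho> s by simp
      also have "\<dots> \<le> coord_const * coord_const * (s * s)"
        using coord_const(1) mult_right_mono[of 1 coord_const coord_const] by (intro mult_right_mono) simp_all
      also have "\<dots> = \<eta> powr 2" using \<eta>(1) by (simp add: \<eta>_def power2_eq_square mult_ac)
      finally show "R \<le> \<eta> powr 2" .
    qed (use R0 p1 in auto)
    also have "\<dots> = \<eta> powr (2 / p)" by (simp add: powr_powr)
    also have "\<dots> \<le> \<eta> powr 1" using \<eta> p1 p2 by (intro powr_mono') auto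
    finally show ?thesis using \<eta> by simp
  qed
  have "bilin n (sym_mat G) r z \<le> l2norm n r * N * main_coef B + Km * E"
    unfolding N_def B_def Km_def E_def
  proof (rule cross_term_bound[OF sb yb n \<xi> A])
    have "supp n r \<subseteq> supp n y" by (auto simp: supp_def r_def)
    then show "nnz n r \<le> real n powr (p - 1)" using cy card_mono[of "supp n y" "supp n r"] by simp
    show "\<bar>r j\<bar> \<le> 1" if "j \<in> {1..n}" for j using ya[OF that] a01 by (simp add: r_def)
    show "l2norm n r \<le> 1" using \<sigma>r \<eta> by simp
    show "z j = 0" if "j \<in> {1..n}" "r j \<noteq> 0" for j using that yz by (auto simp: r_def split: if_splits)
  qed (rule zt)
  also have "l2norm n r * N * main_coef B \<le> \<eta> * N * 2"
    using \<sigma>r N0 nn YUB \<eta> main_coef_bounds(1,2)[of B] by (intro mult_mono mult_nonneg_nonneg) auto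
  finally have bil_r: "bilin n (sym_mat G) r z \<le> \<eta> * N * 2 + Km * E" by simp
  \<comment> \<open>The sign of the dominant entry moves into z, so that row i paired with z' is
    multiplied by \<mu> \<ge> 0.\<close>
  define z' where "z' j = \<epsilon> * z j" for j
  define h where "h = (\<Sum>j\<in>{1..n}. sym_mat G i j * z' j)"
  have "bilin n (sym_mat G) y z = bilin n (sym_mat G) (\<lambda>j. r j + (if j = i then y i else 0)) z"
    by (rule arg_cong[where f = "\<lambda>y. bilin n (sym_mat G) y z"]) (auto simp: r_def)
  also have "\<dots> = bilin n (sym_mat G) r z + bilin n (sym_mat G) (\<lambda>j. if j = i then y i else 0) z"
    by (rule bilin_add_left)
  also have "bilin n (sym_mat G) (\<lambda>j. if j = i then y i else 0) z
    = (\<Sum>k\<in>{1..n}. if k = i then y i * (\<Sum>j\<in>{1..n}. sym_mat G i j * z j) else 0)"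
    unfolding bilin_left by (intro sum.cong) auto
  also have "\<dots> = y i * (\<Sum>j\<in>{1..n}. sym_mat G i j * z j)" using i by simp
  also have "\<dots> = \<mu> * h" by (simp add: h_def z'_def \<epsilon>(4) sum_distrib_left mult_ac)
  finally have bil_y: "bilin n (sym_mat G) y z = bilin n (sym_mat G) r z + \<mu> * h" .
  have lower: "c0\<^sup>2 * (1 - \<rho>) * N + 2 * K' * E < \<mu> * h + \<eta> * N * 2"
    using big2 bil_y bil_r by (simp add: algebra_simps)
  \<comment> \<open>The minor entries take at most N / 16 from the 3 N / 16 secured here, so more
    than N / 8 is left for the dominant one.\<close>
  have cc: "3 / 16 \<le> c0\<^sup>2 * (1 - \<rho>)" using mult_mono[of "1/4" "c0\<^sup>2" "3/4" "1 - \<rho>"] c0 \<rho> by simp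
  have "\<eta> * N * 2 \<le> 1 / 32 * N * 2" using \<eta> N0 by (intro mult_right_mono) auto
  then have "N / 8 \<le> c0\<^sup>2 * (1 - \<rho>) * N - \<eta> * N * 2" using mult_right_mono[OF cc, of N] N0 by linarith
  then have \<mu>h: "N / 8 < \<mu> * h" using lower mult_nonneg_nonneg[OF K0(2) E0] by linarith
  define W where "W = pnorm n q (mat_vec n (sym_mat G) (basis_vec i))"
  have W0: "0 < W"
  proof -
    have "h \<noteq> 0" using \<mu>h N0 by auto
    moreover have "h = 0" if "\<forall>j\<in>{1..n}. sym_mat G i j = 0"
      unfolding h_def using that by (intro sum.neutral) auto
    ultimately have "\<not> (\<forall>j\<in>{1..n}. sym_mat G i j = 0)" by blast
    then obtain j where j: "j \<in> {1..n}" "sym_mat G i j \<noteq> 0" by blast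
    have "mat_vec n (sym_mat G) (basis_vec i) j = sym_mat G i j" using i by (rule mat_vec_basis_vec)
    then have "0 < (\<Sum>j\<in>{1..n}. \<bar>mat_vec n (sym_mat G) (basis_vec i) j\<bar> powr q)"
      using j by (intro sum_pos2[of _ j]) auto
    then show ?thesis by (simp add: W_def pnorm_def)
  qed
  define v where "v = opt_vec n p q G i"
  note ov = opt_vec_props[OF i W0[unfolded W_def], folded W_def v_def]
  define X where "X = (\<Sum>j\<in>{1..n}. (z' j - c0 * v j)\<^sup>2 * (\<bar>z' j\<bar> + \<bar>c0 * v j\<bar>) powr (p - 2))"
  have X0: "0 \<le> X" by (simp add: X_def sum_nonneg)
  have Bz': "(psum n p z') = B" by (simp add: B_def z'_def abs_mult \<epsilon>(2))
  have hX: "h \<le> W * (main_coef B - 2 * c0 * ((p - 1) / 8) * X)"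
    unfolding h_def X_def Bz'[symmetric] by (rule holder_stability[OF ov(1,2)]) (use W0 in simp)
  have "h \<le> W * 2"
  proof -
    have "0 \<le> 2 * c0 * ((p - 1) / 8) * X" using c0(1) p1 X0 by (intro mult_nonneg_nonneg) simp_all
    moreover have "main_coef B \<le> 2" using main_coef_bounds(2)[of B] nn YUB by linarith
    ultimately have "W * (main_coef B - 2 * c0 * ((p - 1) / 8) * X) \<le> W * 2"
      using W0 by (intro mult_left_mono) linarith+
    then show ?thesis using hX by linarith
  qed
  then have "\<mu> * h \<le> \<mu> * (W * 2)" using \<mu> by (intro mult_left_mono)
  \<comment> \<open>A lower bound for the row norm is obtained from near-maximality: a row of small
    norm could not produce this value of h.\<close>
  then have \<mu>W: "N / 16 \<le> \<mu> * W" using \<mu>h by simp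
  also have "\<dots> \<le> 1 * W" using \<mu> a01 W0 by (intro mult_right_mono) auto
  finally have WN: "gauss_norm n / 16 \<le> W" by (simp add: N_def)
  note on = opt_vec_norm_le[OF sb yb n \<xi> A V i W_def WN]
  have Wle: "W \<le> N + K' * E" using on(2) by (simp add: N_def K'_def Km_def E_def)
  have mc: "0 \<le> main_coef B" "main_coef B \<le> 2" using main_coef_bounds(1,2)[of B] nn YUB by auto
  \<comment> \<open>The optimum over all splittings of the mass is c0^2. The losses recorded by
    \<open>main_coef_opt\<close> are dropped, since the loss of interest is now T.\<close>
  have mm: "\<mu> * main_coef B \<le> c0\<^sup>2"
  proof -
    have "\<mu> * main_coef B \<le> a * main_coef B" using \<mu> mc by (intro mult_right_mono) auto
    also have "\<dots> \<le> c0\<^sup>2 * (1 - (a / c0 - 1)\<^sup>2 - 2 * (a / c0) * U / p)"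
      using main_coef_opt[OF a01(1) YUB'(1) nn(2,3), of 1] by simp
    also have "\<dots> \<le> c0\<^sup>2 * 1"
    proof (intro mult_left_mono)
      have "0 \<le> 2 * (a / c0) * U / p" using a01 c0(1) nn p1 by simp
      moreover have "0 \<le> (a / c0 - 1)\<^sup>2" by simp
      ultimately show "1 - (a / c0 - 1)\<^sup>2 - 2 * (a / c0) * U / p \<le> 1" by linarith
    qed simp
    finally show ?thesis by simp
  qed
  define T where "T = 2 * c0 * ((p - 1) / 8) * X"
  have "\<mu> * W * main_coef B \<le> c0\<^sup>2 * N + 2 * K' * E"
  proof -
    have "\<mu> * W * main_coef B = (\<mu> * main_coef B) * W" by simp
    also have "\<dots> \<le> (\<mu> * main_coef B) * (N + K' * E)" using Wle \<mu> mc by (intro mult_left_mono) auto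
    also have "\<dots> = (\<mu> * main_coef B) * N + (\<mu> * main_coef B) * (K' * E)" by (simp add: distrib_left)
    also have "\<dots> \<le> c0\<^sup>2 * N + 2 * (K' * E)"
    proof (intro add_mono mult_right_mono)
      have "c0\<^sup>2 \<le> 1" using c0 by (intro power_le_one) auto
      then show "\<mu> * main_coef B \<le> 2" using mm by linarith
    qed (use mm N0 K0 E0 in auto)
    finally show ?thesis by simp
  qed
  moreover have "\<mu> * h \<le> \<mu> * W * main_coef B - \<mu> * W * T"
    using mult_left_mono[OF hX[folded T_def] \<mu>(1)] by (simp add: algebra_simps)
  moreover have "c0\<^sup>2 * (1 - \<rho>) * N = c0\<^sup>2 * N - c0\<^sup>2 * \<rho> * N" by (simp add: algebra_simps)
  \<comment> \<open>Upper and lower bound for \<mu> h contain the same main term and the same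
    reserve 2 K' E; after cancellation only the defect and the cost of the minor entries bound the
    convexity term.\<close>
  ultimately have "\<mu> * W * T \<le> c0\<^sup>2 * \<rho> * N + \<eta> * N * 2" using lower by linarith
  moreover have "N / 16 * (1 * ((p - 1) / 8) * X) \<le> \<mu> * W * T"
    unfolding T_def using \<mu>W c0 p1 X0 N0 W0 \<mu> by (intro mult_mono mult_nonneg_nonneg) auto
  moreover have "c0\<^sup>2 * \<rho> * N + \<eta> * N * 2 \<le> N * (3 * \<eta>)"
  proof -
    have "c0\<^sup>2 \<le> 1" using c0 by (simp add: power_le_one)
    then have "c0\<^sup>2 * \<rho> \<le> 1 * \<rho>" using \<rho> by (intro mult_right_mono) auto
    also have "\<dots> \<le> \<eta>" using s \<eta> mult_right_mono[of s 1 s] by linarith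
    finally have "c0\<^sup>2 * \<rho> * N \<le> \<eta> * N" using N0 by (intro mult_right_mono) auto
    then show ?thesis by (simp add: algebra_simps)
  qed
  ultimately have "N * ((p - 1) / 128 * X) \<le> N * (3 * \<eta>)" by (simp add: algebra_simps)
  then have "(p - 1) / 128 * X \<le> 3 * \<eta>" using N0 by simp
  then have XG: "X \<le> stab_const * s" using p1 by (simp add: stab_const_def \<eta>_def field_simps)
  define \<gamma> where "\<gamma> = sqrt (stab_const * s)"
  have G0: "0 < stab_const * s" using p1 coord_const s by (simp add: stab_const_def)
  have \<gamma>: "0 < \<gamma>" "\<gamma>\<^sup>2 = stab_const * s" using G0 by (simp_all add: \<gamma>_def)
  have Rsum: "(\<Sum>j\<in>{1..n}. (\<bar>z' j\<bar> + \<bar>c0 * v j\<bar>) powr p) \<le> 6"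
  proof -
    have "(\<Sum>j\<in>{1..n}. (\<bar>z' j\<bar> + \<bar>c0 * v j\<bar>) powr p) \<le> (\<Sum>j\<in>{1..n}. 4 * (\<bar>z' j\<bar> powr p + 1 / 2 * \<bar>v j\<bar> powr p))"
    proof (intro sum_mono)
      fix j
      have "\<bar>c0 * v j\<bar> powr p = 1 / 2 * \<bar>v j\<bar> powr p" using c0 by (simp add: abs_mult powr_mult)
      then show "(\<bar>z' j\<bar> + \<bar>c0 * v j\<bar>) powr p \<le> 4 * (\<bar>z' j\<bar> powr p + 1 / 2 * \<bar>v j\<bar> powr p)"
        using powr_add_le_4[of "\<bar>z' j\<bar>" "\<bar>c0 * v j\<bar>" p] p1 p2 by simp
    qed
    also have "\<dots> = 4 * (B + 1 / 2)"
      by (simp only: sum_distrib_left[symmetric] sum.distrib Bz' ov(1) mult_1_right)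
    finally show ?thesis using YUB nn by simp
  qed
  have D: "(\<Sum>j\<in>{1..n}. \<bar>z' j - c0 * v j\<bar> powr p) \<le> 7 * \<gamma> powr p"
  proof -
    have "(\<Sum>j\<in>{1..n}. \<bar>z' j - c0 * v j\<bar> powr p) \<le> \<gamma> powr p * (1 + (\<Sum>j\<in>{1..n}. (\<bar>z' j\<bar> + \<bar>c0 * v j\<bar>) powr p))"
      using XG \<gamma> by (intro sum_powr_le_of_weighted) (auto simp: X_def)
    also have "\<dots> \<le> \<gamma> powr p * 7" using Rsum by (intro mult_left_mono) auto
    finally show ?thesis by simp
  qed
  define w where "w j = basis_vec i j + v j" for j
  have vi: "\<bar>v i\<bar> \<le> V" using on(1)[of i] i by (auto simp: v_def V_def)
  have norm_w: "(\<Sum>j\<in>{1..n}. \<bar>c0 * w j - w j / pnorm n p w\<bar> powr p) \<le> (2 * V) powr p"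
    using normalizer_bound[OF i ov(1) vi] assms(12) by (simp add: w_def[abs_def] V_def)
  have op: "opt_point n p q G i j = w j / pnorm n p w" for j
    by (simp add: opt_point_def w_def[abs_def] v_def Let_def)
  have \<mu>c: "\<bar>\<mu> - c0\<bar> \<le> (1 + coord_const) * s"
  proof -
    have "a - \<mu> \<le> 2 / (2 - p) * \<rho> * a" using dc(1) by (simp add: algebra_simps)
    also have "\<dots> \<le> coord_const * s * 1"
      using coord_const s a01 p2 mult_left_le[of s s] by (intro mult_mono mult_nonneg_nonneg) auto
    finally show ?thesis using ne(3) \<mu> by (simp add: s(4) ring_distribs)
  qed
  have "(\<Sum>j\<in>{1..n}. \<bar>x j - \<epsilon> * opt_point n p q G i j\<bar> powr p) \<le>
    (\<Sum>j\<in>{1..n}. 25 * ((if j = i then \<bar>\<mu> - c0\<bar> powr p else 0) + \<bar>r j\<bar> powr p + \<bar>u j\<bar> powr p +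
      \<bar>z' j - c0 * v j\<bar> powr p + \<bar>c0 * w j - w j / pnorm n p w\<bar> powr p))"
  proof (intro sum_mono)
    fix j
    define b1 where "b1 = \<epsilon> * (if j = i then \<mu> - c0 else 0)"
    define b4 where "b4 = \<epsilon> * (z' j - c0 * v j)"
    define b5 where "b5 = \<epsilon> * (c0 * w j - w j / pnorm n p w)"
    have zz: "z j = \<epsilon> * z' j" using \<epsilon>(3) by (simp add: z'_def flip: mult.assoc)
    have "x j - \<epsilon> * opt_point n p q G i j = b1 + r j + u j + b4 + b5"
      unfolding xs[of j] op b1_def b4_def b5_def zz
      by (cases "j = i") (simp_all add: r_def \<epsilon>(4) w_def basis_vec_def algebra_simps)
    moreover have "\<bar>b1\<bar> = (if j = i then \<bar>\<mu> - c0\<bar> else 0)" "\<bar>b4\<bar> = \<bar>z' j - c0 * v j\<bar>"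
      "\<bar>b5\<bar> = \<bar>c0 * w j - w j / pnorm n p w\<bar>" by (simp_all add: b1_def b4_def b5_def abs_mult \<epsilon>(2))
    ultimately show "\<bar>x j - \<epsilon> * opt_point n p q G i j\<bar> powr p \<le> 25 * ((if j = i then \<bar>\<mu> - c0\<bar> powr p else 0) + \<bar>r j\<bar> powr p + \<bar>u j\<bar> powr p +
      \<bar>z' j - c0 * v j\<bar> powr p + \<bar>c0 * w j - w j / pnorm n p w\<bar> powr p)"
      using abs_sum5_powr[OF p1 p2, of b1 "r j" "u j" b4 b5] by (auto split: if_splits)
  qed
  also have "\<dots> = 25 * (\<bar>\<mu> - c0\<bar> powr p + R + U + (\<Sum>j\<in>{1..n}. \<bar>z' j - c0 * v j\<bar> powr p) +
      (\<Sum>j\<in>{1..n}. \<bar>c0 * w j - w j / pnorm n p w\<bar> powr p))"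
    using i by (simp only: sum_distrib_left[symmetric] sum.distrib R_def U_def) simp
  also have "\<dots> \<le> 25 * (((1 + coord_const) * s) powr p + coord_const * \<rho> + 2 * \<rho> + 7 * \<gamma> powr p + (2 * V) powr p)"
    using \<mu>c R\<rho> ne(4) D norm_w p1 by (intro mult_left_mono add_mono powr_mono2) simp_all
  also have "\<dots> = dist_coef s + 25 * (2 * V) powr p" by (simp add: \<gamma>_def \<rho>_def)
  finally show ?thesis using i \<epsilon>(1) unfolding V_def by blast
qed

end

section \<open>Gaussian tail bounds and independence\<close>

lemma finite_vecs: "finite V \<Longrightarrow> finite (vecs n V)"
proof -
  assume V: "finite V"
  have "vecs n V \<subseteq> (\<lambda>f i. if i \<in> {1..n} then f i else 0) ` ({1..n} \<rightarrow>\<^sub>E V)"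
  proof
    fix a assume a: "a \<in> vecs n V"
    then have "restrict a {1..n} \<in> {1..n} \<rightarrow>\<^sub>E V" by (auto simp: vecs_def)
    moreover have "a = (\<lambda>i. if i \<in> {1..n} then restrict a {1..n} i else 0)"
      using a by (auto simp: vecs_def fun_eq_iff)
    ultimately show "a \<in> (\<lambda>f i. if i \<in> {1..n} then f i else 0) ` ({1..n} \<rightarrow>\<^sub>E V)" by blast
  qed
  then show ?thesis using V by (meson finite_PiE finite_atLeastAtMost finite_imageI finite_subset)
qed

text \<open>Clearing one nonzero entry lowers the support size by one, and an index together with a
  value restores the vector: n * card V choices per step.\<close>

lemma card_sparse_vecs:
  assumes V: "finite V" "0 \<in> V" and n: "1 \<le> n"
  shows "card {a \<in> vecs n V. card (supp n a) \<le> k} \<le> (n * card V) ^ k"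
proof (induction k)
  case 0
  have "{a \<in> vecs n V. card (supp n a) \<le> 0} \<subseteq> {\<lambda>_. 0}" by (auto simp: vecs_def supp_def fun_eq_iff)
  then have "card {a \<in> vecs n V. card (supp n a) \<le> 0} \<le> card {\<lambda>_::nat. 0::real}"
    by (intro card_mono) auto
  then show ?case by simp
next
  case (Suc k)
  define S where "S k = {a \<in> vecs n V. card (supp n a) \<le> k}" for k
  have fin: "finite (S k)" for k using finite_vecs[OF V(1)] by (simp add: S_def)
  have "S (Suc k) \<subseteq> (\<lambda>(a, i, v). a(i := v)) ` (S k \<times> {1..n} \<times> V)"
  proof
    fix a assume a: "a \<in> S (Suc k)"
    obtain i where i: "i \<in> {1..n}" and c: "card (supp n (a(i := 0))) \<le> k"
    \<comment> \<open>With empty support any index serves; 1 is available because n \<ge> 1.\<close>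
    proof (cases "supp n a = {}")
      case True
      then have "supp n (a(1 := 0)) = {}" by (auto simp: supp_def)
      then have "card (supp n (a(1 := 0))) \<le> k" by (simp only: card.empty)
      moreover have "1 \<in> {1..n}" using n by simp
      ultimately show ?thesis by (rule that[rotated])
    next
      case False
      then obtain i where i: "i \<in> supp n a" by auto
      have "supp n (a(i := 0)) = supp n a - {i}" by (auto simp: supp_def)
      then have "card (supp n (a(i := 0))) = card (supp n a) - 1" using i by simp
      moreover have "card (supp n a) \<le> Suc k" using a by (simp add: S_def)
      ultimately have "card (supp n (a(i := 0))) \<le> k" by linarith
      moreover have "i \<in> {1..n}" using i by (simp add: supp_def)
      ultimately show ?thesis by (rule that[rotated])
    qed
    have "a(i := 0) \<in> S k" using a c V i by (auto simp: S_def vecs_def)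
    moreover have "a i \<in> V" using a i by (auto simp: S_def vecs_def)
    ultimately show "a \<in> (\<lambda>(a, i, v). a(i := v)) ` (S k \<times> {1..n} \<times> V)"
      using i by (intro image_eqI[of _ _ "(a(i := 0), i, a i)"]) auto
  qed
  then have "card (S (Suc k)) \<le> card (S k \<times> {1..n} \<times> V)" using fin V by (intro surj_card_le) auto
  also have "\<dots> = card (S k) * (n * card V)" by (simp add: card_cartesian_product)
  also have "\<dots> \<le> (n * card V) ^ k * (n * card V)"
    using Suc.IH unfolding S_def by (intro mult_right_mono) auto
  finally show ?case by (simp add: S_def mult.commute)
qed

text \<open>Completing the square: the integrand is exp (s^2 / 2) times the normal density with mean
  s.\<close>

lemma nn_integral_std_normal_exp:
  "(\<integral>\<^sup>+x. ennreal (std_normal_density x) * ennreal (exp (s * x)) \<partial>lborel) = ennreal (exp (s\<^sup>2 / 2))"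
proof -
  have "std_normal_density x * exp (s * x) = exp (s\<^sup>2 / 2) * normal_density s 1 x" for x
    unfolding normal_density_def by (simp add: exp_add[symmetric] power2_eq_square field_simps)
  then have "(\<integral>\<^sup>+x. ennreal (std_normal_density x) * ennreal (exp (s * x)) \<partial>lborel) =
     (\<integral>\<^sup>+x. ennreal (exp (s\<^sup>2 / 2)) * ennreal (normal_density s 1 x) \<partial>lborel)"
    by (simp flip: ennreal_mult)
  also have "\<dots> = ennreal (exp (s\<^sup>2 / 2)) * (\<integral>\<^sup>+x. ennreal (normal_density s 1 x) \<partial>lborel)"
    by (intro nn_integral_cmult) auto
  also have "(\<integral>\<^sup>+x. ennreal (normal_density s 1 x) \<partial>lborel) = 1" by (subst nn_integral_eq_integral) auto
  finally show ?thesis by simp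
qed

text \<open>Stated with nonnegative integrals, so that independence factorizes the exponential
  moment without a discussion of integrability.\<close>

lemma (in prob_space) chernoff_bound:
  fixes Y :: "'i \<Rightarrow> 'a \<Rightarrow> real"
  assumes I: "finite I" and ind: "indep_vars (\<lambda>_. borel) Y I" and s: "0 \<le> s"
    and mgf: "\<And>i. i \<in> I \<Longrightarrow> (\<integral>\<^sup>+\<omega>. ennreal (exp (s * Y i \<omega>)) \<partial>M) \<le> ennreal (exp (b i))"
  shows "prob {\<omega> \<in> space M. r < (\<Sum>i\<in>I. Y i \<omega>)} \<le> exp ((\<Sum>i\<in>I. b i) - s * r)"
proof -
  have meas[measurable]: "Y i \<in> borel_measurable M" if "i \<in> I" for i
    using ind that by (auto simp: indep_vars_def)
  have ind2: "indep_vars (\<lambda>_. borel) (\<lambda>i \<omega>. ennreal (exp (s * Y i \<omega>))) I"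
    by (rule indep_vars_compose2[OF ind]) simp
  define A where "A = {\<omega> \<in> space M. r < (\<Sum>i\<in>I. Y i \<omega>)}"
  have A[measurable]: "A \<in> sets M" unfolding A_def by measurable
  have "ennreal (exp (s * r)) * emeasure M A = (\<integral>\<^sup>+\<omega>. ennreal (exp (s * r)) * indicator A \<omega> \<partial>M)"
    by (simp add: nn_integral_cmult_indicator)
  also have "\<dots> \<le> (\<integral>\<^sup>+\<omega>. (\<Prod>i\<in>I. ennreal (exp (s * Y i \<omega>))) \<partial>M)"
  proof (intro nn_integral_mono)
    fix \<omega>
    have "(\<Prod>i\<in>I. ennreal (exp (s * Y i \<omega>))) = ennreal (exp (s * (\<Sum>i\<in>I. Y i \<omega>)))"
      using I by (simp add: prod_ennreal sum_distrib_left exp_sum)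
    then show "ennreal (exp (s * r)) * indicator A \<omega> \<le> (\<Prod>i\<in>I. ennreal (exp (s * Y i \<omega>)))"
      using s by (auto simp: A_def indicator_def intro!: ennreal_leI mult_left_mono)
  qed
  also have "\<dots> = (\<Prod>i\<in>I. \<integral>\<^sup>+\<omega>. ennreal (exp (s * Y i \<omega>)) \<partial>M)"
    by (rule indep_vars_nn_integral[OF I ind2]) simp
  also have "\<dots> \<le> (\<Prod>i\<in>I. ennreal (exp (b i)))" by (intro prod_mono_ennreal mgf)
  also have "\<dots> = ennreal (exp (\<Sum>i\<in>I. b i))" using I by (simp add: prod_ennreal exp_sum)
  finally have "ennreal (exp (s * r) * prob A) \<le> ennreal (exp (\<Sum>i\<in>I. b i))"
    by (simp add: emeasure_eq_measure ennreal_mult)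
  then have "exp (s * r) * prob A \<le> exp (\<Sum>i\<in>I. b i)" by simp
  then show ?thesis unfolding A_def by (simp add: exp_diff field_simps)
qed

lemma (in prob_space) gaussian_sum_tail:
  fixes g :: "'i \<Rightarrow> 'a \<Rightarrow> real"
  assumes I: "finite I" and ind: "indep_vars (\<lambda>_. borel) g I"
    and g: "\<And>i. i \<in> I \<Longrightarrow> distributed M lborel (g i) std_normal_density"
    and v: "(\<Sum>i\<in>I. (c i)\<^sup>2) \<le> v" "0 < v" and r: "0 \<le> r"
  shows "prob {\<omega> \<in> space M. r < (\<Sum>i\<in>I. c i * g i \<omega>)} \<le> exp (- (r\<^sup>2 / (2 * v)))"
proof -
  \<comment> \<open>This s minimizes s^2 v / 2 - s r.\<close>
  define s where "s = r / v"
  have s: "0 \<le> s" using r v by (simp add: s_def)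
  have "prob {\<omega> \<in> space M. r < (\<Sum>i\<in>I. c i * g i \<omega>)} \<le> exp ((\<Sum>i\<in>I. (s * c i)\<^sup>2 / 2) - s * r)"
  proof (rule chernoff_bound[OF I _ s])
    show "indep_vars (\<lambda>_. borel) (\<lambda>i \<omega>. c i * g i \<omega>) I" by (rule indep_vars_compose2[OF ind]) simp
    show "(\<integral>\<^sup>+\<omega>. ennreal (exp (s * (c i * g i \<omega>))) \<partial>M) \<le> ennreal (exp ((s * c i)\<^sup>2 / 2))" if "i \<in> I" for i
    proof -
      have "(\<integral>\<^sup>+\<omega>. ennreal (exp (s * (c i * g i \<omega>))) \<partial>M) =
         (\<integral>\<^sup>+x. ennreal (std_normal_density x) * ennreal (exp ((s * c i) * x)) \<partial>lborel)"
        by (subst distributed_nn_integral[OF g[OF that]]) (auto simp: mult.assoc)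
      then show ?thesis by (simp add: nn_integral_std_normal_exp)
    qed
  qed
  also have "(\<Sum>i\<in>I. (s * c i)\<^sup>2 / 2) = s\<^sup>2 / 2 * (\<Sum>i\<in>I. (c i)\<^sup>2)"
    by (simp add: sum_distrib_left power_mult_distrib)
  also have "exp (s\<^sup>2 / 2 * (\<Sum>i\<in>I. (c i)\<^sup>2) - s * r) \<le> exp (s\<^sup>2 / 2 * v - s * r)"
    using v by (simp add: mult_left_mono)
  also have "s\<^sup>2 / 2 * v - s * r = - (r\<^sup>2 / (2 * v))"
    using v by (simp add: s_def power2_eq_square field_simps)
  finally show ?thesis .
qed

abbreviation mat_at :: "(nat \<Rightarrow> nat \<Rightarrow> 'a \<Rightarrow> real) \<Rightarrow> 'a \<Rightarrow> nat \<Rightarrow> nat \<Rightarrow> real" where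
  "mat_at g \<omega> \<equiv> \<lambda>i j. g i j \<omega>"

text \<open>Outside the support of \<open>y\<close>, coordinate \<open>i\<close> of the product involves only the entries in row and
  column \<open>i\<close> whose other index lies in the support, and these blocks are disjoint.\<close>

lemma (in prob_space) indep_mat_vec_off_supp:
  fixes g :: "nat \<Rightarrow> nat \<Rightarrow> 'a \<Rightarrow> real" and F :: "real \<Rightarrow> real"
  assumes ind: "indep_vars (\<lambda>_. borel) (\<lambda>(i, j). g i j) ({1..n} \<times> {1..n})"
    and F[measurable]: "F \<in> borel_measurable borel"
  shows "indep_vars (\<lambda>_. borel) (\<lambda>i \<omega>. F (mat_vec n (sym_mat (mat_at g \<omega>)) y i)) ({1..n} - supp n y)"
proof -
  define S where "S = supp n y"
  have S: "S \<subseteq> {1..n}" "finite S" by (auto simp: S_def supp_def)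
  define K where "K i = {i} \<times> S \<union> S \<times> {i}" for i :: nat
  define X where "X = (\<lambda>(i, j). g i j)"
  have "indep_vars (\<lambda>i. PiM (K i) (\<lambda>_. borel)) (\<lambda>i \<omega>. restrict (\<lambda>p. X p \<omega>) (K i)) ({1..n} - S)"
  proof (rule indep_vars_restrict)
    show "indep_vars (\<lambda>_. borel) X ({1..n} \<times> {1..n})" using ind by (simp add: X_def)
    show "K i \<subseteq> {1..n} \<times> {1..n}" if "i \<in> {1..n} - S" for i using that S by (auto simp: K_def)
    show "disjoint_family_on K ({1..n} - S)" by (auto simp: disjoint_family_on_def K_def)
  qed
  then have "indep_vars (\<lambda>_. borel) (\<lambda>i \<omega>. (\<lambda>f. F (\<Sum>j\<in>S. (f (i, j) + f (j, i)) / sqrt 2 * y j)) (restrict (\<lambda>p. X p \<omega>) (K i))) ({1..n} - S)"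
  proof (rule indep_vars_compose2)
    fix i
    have [measurable]: "(\<lambda>f. f (i, j)) \<in> borel_measurable (PiM (K i) (\<lambda>_. borel))"
      "(\<lambda>f. f (j, i)) \<in> borel_measurable (PiM (K i) (\<lambda>_. borel))" if "j \<in> S" for j
      using that by (auto simp: K_def intro!: measurable_component_singleton)
    show "(\<lambda>f. F (\<Sum>j\<in>S. (f (i, j) + f (j, i)) / sqrt 2 * y j)) \<in> borel_measurable (PiM (K i) (\<lambda>_. borel))"
      by measurable
  qed
  moreover have "(\<Sum>j\<in>S. (restrict (\<lambda>p. X p \<omega>) (K i) (i, j) + restrict (\<lambda>p. X p \<omega>) (K i) (j, i)) / sqrt 2 * y j)
     = mat_vec n (sym_mat (mat_at g \<omega>)) y i" for i \<omega>
  proof -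
    have "mat_vec n (sym_mat (mat_at g \<omega>)) y i = (\<Sum>j\<in>S. (g i j \<omega> + g j i \<omega>) / sqrt 2 * y j)"
      unfolding mat_vec_def sym_mat_def by (intro sum.mono_neutral_right) (auto simp: S_def supp_def)
    then show ?thesis by (simp add: K_def X_def)
  qed
  ultimately show ?thesis by (simp add: S_def)
qed

text \<open>As i lies outside the support S, the positions (i, j) and (j, i) with j in S are 2 card
  S different ones, and their entries are independent. The squares of the weights y_j / (sqrt 2
  \<sigma>) add up to 1.\<close>

lemma (in prob_space) mat_vec_std_normal:
  fixes g :: "nat \<Rightarrow> nat \<Rightarrow> 'a \<Rightarrow> real"
  assumes ind: "indep_vars (\<lambda>_. borel) (\<lambda>(i, j). g i j) ({1..n} \<times> {1..n})"
    and g: "\<And>i j. i \<in> {1..n} \<Longrightarrow> j \<in> {1..n} \<Longrightarrow> distributed M lborel (g i j) std_normal_density"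
    and y: "supp n y \<noteq> {}" and i: "i \<in> {1..n} - supp n y"
  shows "distributed M lborel (\<lambda>\<omega>. mat_vec n (sym_mat (mat_at g \<omega>)) y i / l2norm n y) std_normal_density"
proof -
  define S where "S = supp n y"
  have S: "S \<subseteq> {1..n}" "finite S" "i \<notin> S" using i by (auto simp: S_def supp_def)
  define \<sigma> where "\<sigma> = l2norm n y"
  have \<sigma>: "0 < \<sigma>" unfolding \<sigma>_def by (rule l2norm_pos[OF y])
  define K where "K = {i} \<times> S \<union> S \<times> {i}"
  define c where "c = (\<lambda>(k, l). y (if k = i then l else k) / (sqrt 2 * \<sigma>))"
  have disj: "({i} \<times> S) \<inter> (S \<times> {i}) = {}" using S by auto
  have sumK: "(\<Sum>p\<in>K. f p) = (\<Sum>j\<in>S. f (i, j) + f (j, i))" for f :: "nat \<times> nat \<Rightarrow> real"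
  proof -
    have "(\<Sum>p\<in>K. f p) = (\<Sum>p\<in>{i} \<times> S. f p) + (\<Sum>p\<in>S \<times> {i}. f p)"
      unfolding K_def using S disj by (intro sum.union_disjoint) auto
    also have "(\<Sum>p\<in>{i} \<times> S. f p) = (\<Sum>j\<in>S. f (i, j))"
      by (rule sum.reindex_bij_witness[of _ "\<lambda>j. (i, j)" snd]) auto
    also have "(\<Sum>p\<in>S \<times> {i}. f p) = (\<Sum>j\<in>S. f (j, i))"
      by (rule sum.reindex_bij_witness[of _ "\<lambda>j. (j, i)" fst]) auto
    finally show ?thesis by (simp add: sum.distrib)
  qed
  have KI: "K \<subseteq> {1..n} \<times> {1..n}" using S i by (auto simp: K_def)
  have c0: "c p \<noteq> 0" if "p \<in> K" for p
    using that \<sigma> S by (auto simp: c_def K_def S_def supp_def split: if_splits)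
  have "distributed M lborel (\<lambda>\<omega>. \<Sum>p\<in>K. c p * (case p of (i, j) \<Rightarrow> g i j) \<omega>)
     (normal_density (\<Sum>p\<in>K. 0) (sqrt (\<Sum>p\<in>K. \<bar>c p\<bar>\<^sup>2)))"
  proof (rule sum_indep_normal)
    show "finite K" using S by (simp add: K_def)
    show "K \<noteq> {}" using y by (auto simp: K_def S_def)
    show "indep_vars (\<lambda>i. borel) (\<lambda>p \<omega>. c p * (case p of (i, j) \<Rightarrow> g i j) \<omega>) K"
      by (rule indep_vars_compose2[OF indep_vars_subset[OF ind KI]]) simp
    show "0 < \<bar>c p\<bar>" if "p \<in> K" for p using c0[OF that] by simp
    show "distributed M lborel (\<lambda>\<omega>. c p * (case p of (i, j) \<Rightarrow> g i j) \<omega>) (\<lambda>x. ennreal (normal_density 0 \<bar>c p\<bar> x))" if p: "p \<in> K" for p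
    proof -
      obtain k l where kl: "p = (k, l)" by (cases p)
      then have "k \<in> {1..n}" "l \<in> {1..n}" using KI p by auto
      from normal_density_affine[OF g[OF this], of "c p" 0] c0[OF p] show ?thesis by (simp add: kl)
    qed
  qed
  moreover have "(\<Sum>p\<in>K. c p * (case p of (i, j) \<Rightarrow> g i j) \<omega>) = mat_vec n (sym_mat (mat_at g \<omega>)) y i / \<sigma>" for \<omega>
  proof -
    have "mat_vec n (sym_mat (mat_at g \<omega>)) y i = (\<Sum>j\<in>S. (g i j \<omega> + g j i \<omega>) / sqrt 2 * y j)"
      unfolding mat_vec_def sym_mat_def by (intro sum.mono_neutral_right) (auto simp: S_def supp_def)
    moreover have "(\<Sum>p\<in>K. c p * (case p of (i, j) \<Rightarrow> g i j) \<omega>) = (\<Sum>j\<in>S. (g i j \<omega> + g j i \<omega>) / sqrt 2 * y j / \<sigma>)"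
      unfolding sumK using S \<sigma> by (intro sum.cong refl) (auto simp: c_def field_simps)
    ultimately show ?thesis by (simp add: sum_divide_distrib)
  qed
  moreover have "(\<Sum>p\<in>K. \<bar>c p\<bar>\<^sup>2) = 1"
  proof -
    have "(\<Sum>p\<in>K. \<bar>c p\<bar>\<^sup>2) = (\<Sum>j\<in>S. (y j)\<^sup>2 / \<sigma>\<^sup>2)"
      unfolding sumK using S \<sigma> by (intro sum.cong refl) (auto simp: c_def power_divide power_mult_distrib field_simps)
    also have "\<dots> = (\<Sum>j\<in>{1..n}. (y j)\<^sup>2 / \<sigma>\<^sup>2)"
      by (intro sum.mono_neutral_left) (auto simp: S_def supp_def)
    also have "\<dots> = \<sigma>\<^sup>2 / \<sigma>\<^sup>2" unfolding sum_divide_distrib[symmetric] by (simp add: \<sigma>_def l2norm_def sum_nonneg)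
    finally show ?thesis using \<sigma> by simp
  qed
  ultimately show ?thesis by (simp add: \<sigma>_def)
qed

section \<open>Probability of the two deterministic conditions\<close>

lemma integrable_std_normal_abs_powr:
  assumes "0 \<le> q"
  shows "integrable lborel (\<lambda>x. std_normal_density x * \<bar>x\<bar> powr q)"
proof -
  define k where "k = nat \<lceil>q\<rceil>"
  have k: "q \<le> real k" unfolding k_def by linarith
  have "integrable lborel (\<lambda>x. std_normal_density x * \<bar>x\<bar> ^ 0 + std_normal_density x * \<bar>x\<bar> ^ k)"
    by (intro Bochner_Integration.integrable_add integrable_std_normal_moment_abs)
  then show ?thesis
  proof (rule Bochner_Integration.integrable_bound)
    show "AE x in lborel. norm (std_normal_density x * \<bar>x\<bar> powr q) \<le>
        norm (std_normal_density x * \<bar>x\<bar> ^ 0 + std_normal_density x * \<bar>x\<bar> ^ k)"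
    proof (intro AE_I2)
      fix x :: real
      have "\<bar>x\<bar> powr q \<le> \<bar>x\<bar> ^ 0 + \<bar>x\<bar> ^ k"
      proof (cases "\<bar>x\<bar> \<le> 1")
        case True
        then have "\<bar>x\<bar> powr q \<le> 1 powr q" using assms by (intro powr_mono2) auto
        then show ?thesis by (simp add: add_increasing2)
      next
        case False
        then have "\<bar>x\<bar> powr q \<le> \<bar>x\<bar> powr real k" using k by (intro powr_mono) auto
        then show ?thesis using False by (simp add: powr_realpow)
      qed
      then have "std_normal_density x * \<bar>x\<bar> powr q \<le> std_normal_density x * (\<bar>x\<bar> ^ 0 + \<bar>x\<bar> ^ k)"
        by (intro mult_left_mono) auto
      then show "norm (std_normal_density x * \<bar>x\<bar> powr q) \<le>
        norm (std_normal_density x * \<bar>x\<bar> ^ 0 + std_normal_density x * \<bar>x\<bar> ^ k)"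
        by (simp add: distrib_left)
    qed
  qed measurable
qed

text \<open>The lower bound integrates Bernoulli's inequality with exponent q / 2 at x^2; as the
  second moment is 1, the linear term vanishes.\<close>

lemma gauss_xi_powr:
  assumes "2 \<le> q"
  shows "gauss_xi q powr q = (\<integral>x. std_normal_density x * \<bar>x\<bar> powr q \<partial>lborel)" and "1 \<le> gauss_xi q powr q"
    and "0 < gauss_xi q"
proof -
  define m where "m = (\<integral>x. std_normal_density x * \<bar>x\<bar> powr q \<partial>lborel)"
  have "(\<integral>z. \<bar>z\<bar> powr q \<partial>density lborel std_normal_density) = m"
    unfolding m_def by (subst integral_density) auto
  then have xi: "gauss_xi q = m powr (1 / q)" by (simp add: gauss_xi_def)
  have "(\<integral>x. std_normal_density x * (1 - q / 2) + q / 2 * (std_normal_density x * x ^ (2 * 1)) \<partial>lborel) \<le> m"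
    unfolding m_def
  proof (rule integral_mono)
    show "integrable lborel (\<lambda>x. std_normal_density x * (1 - q / 2) + q / 2 * (std_normal_density x * x ^ (2 * 1)))"
      by (intro Bochner_Integration.integrable_add integrable_mult_left integrable_mult_right
          integrable_std_normal_moment integrable_normal_density) auto
    show "integrable lborel (\<lambda>x. std_normal_density x * \<bar>x\<bar> powr q)"
      using assms by (intro integrable_std_normal_abs_powr) auto
    fix x :: real
    have "1 + q / 2 * (x\<^sup>2 - 1) \<le> (x\<^sup>2) powr (q / 2)" using assms by (intro bernoulli_powr) auto
    also have "x\<^sup>2 = \<bar>x\<bar> powr 2" by simp
    also have "(\<bar>x\<bar> powr 2) powr (q / 2) = \<bar>x\<bar> powr q" by (simp only: powr_powr) simp
    finally have "std_normal_density x * (1 + q / 2 * (x\<^sup>2 - 1)) \<le> std_normal_density x * \<bar>x\<bar> powr q"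
      by (intro mult_left_mono) auto
    moreover have "std_normal_density x * (1 - q / 2) + q / 2 * (std_normal_density x * x ^ (2 * 1)) =
        std_normal_density x * (1 + q / 2 * (x\<^sup>2 - 1))" by (simp add: field_simps power2_eq_square)
    ultimately show "std_normal_density x * (1 - q / 2) + q / 2 * (std_normal_density x * x ^ (2 * 1)) \<le> std_normal_density x * \<bar>x\<bar> powr q"
      by linarith
  qed
  moreover have "(\<integral>x. std_normal_density x * (1 - q / 2) + q / 2 * (std_normal_density x * x ^ (2 * 1)) \<partial>lborel)
     = (1 - q / 2) + q / 2 * 1"
  proof (subst Bochner_Integration.integral_add)
    have "(\<integral>x. std_normal_density x * x ^ (2 * 1) \<partial>lborel) = 1"
      by (subst integral_std_normal_moment_even) (simp add: numeral_2_eq_2)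
    then show "(\<integral>x. std_normal_density x * (1 - q / 2) \<partial>lborel) + (\<integral>x. q / 2 * (std_normal_density x * x ^ (2 * 1)) \<partial>lborel) = (1 - q / 2) + q / 2 * 1"
      by simp
  qed (intro integrable_mult_left integrable_mult_right integrable_std_normal_moment integrable_normal_density; simp)+
  ultimately have m1: "1 \<le> m" by simp
  have "gauss_xi q powr q = m" using assms m1 by (simp add: xi powr_powr)
  then show "gauss_xi q powr q = (\<integral>x. std_normal_density x * \<bar>x\<bar> powr q \<partial>lborel)" "1 \<le> gauss_xi q powr q"
    using m1 by (simp_all add: m_def)
  show "0 < gauss_xi q" using m1 by (simp add: xi)
qed

lemma exp_le_quadratic:
  assumes "0 \<le> (u::real)"
  shows "exp u \<le> 1 + u + u\<^sup>2 * exp u"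
proof -
  have *: "exp u - 1 \<le> u * exp u"
  proof -
    have "1 - u \<le> exp (- u)" using exp_ge_add_one_self[of "- u"] by simp
    then have "(1 - u) * exp u \<le> exp (- u) * exp u" by (intro mult_right_mono) auto
    then show ?thesis by (simp add: algebra_simps flip: exp_add)
  qed
  have "u * (exp u - 1) \<le> u * (u * exp u)" using assms * by (intro mult_left_mono)
  then show ?thesis using * by (simp add: power2_eq_square algebra_simps)
qed

context conjugate_exponents begin

lemma trunc_young_measurable [measurable]: "trunc_young t l \<in> borel_measurable borel"
  unfolding trunc_young_def by measurable

lemma trunc_young_nonneg: "0 \<le> t \<Longrightarrow> 0 \<le> trunc_young t l w" using q_gt by (simp add: trunc_young_def)

text \<open>The two branches of the minimum serve different orders in s. In the linear term of the
  exponential the power branch gives the mean with its sharp constant; in the quadratic remainder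
  the branch t |x| gives a finite exponential moment, where s t \<le> 1 keeps the exponent at most
  |x|.\<close>

lemma trunc_young_mgf:
  assumes s: "0 \<le> s" "s * t \<le> 1" and t: "0 \<le> t"
  shows "(\<integral>\<^sup>+x. ennreal (std_normal_density x) * ennreal (exp (s * trunc_young t l x)) \<partial>lborel)
    \<le> ennreal (exp (s * (gauss_xi q powr q * l powr (1 - q) / q) + 8 * exp 2 * (s * t)\<^sup>2))"
proof -
  define c where "c = s * (l powr (1 - q) / q)"
  define k where "k = 4 * (s * t)\<^sup>2"
  have c0: "0 \<le> c" using s q_gt by (simp add: c_def)
  have k0: "0 \<le> k" by (simp add: k_def)
  define m where "m = gauss_xi q powr q"
  have m: "m = (\<integral>x. std_normal_density x * \<bar>x\<bar> powr q \<partial>lborel)" and m1: "1 \<le> m"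
    using gauss_xi_powr q_gt by (auto simp: m_def)
  have pt: "exp (s * trunc_young t l x) \<le> 1 + c * \<bar>x\<bar> powr q + k * (exp (2 * x) + exp ((-2) * x))" for x
  proof -
    define u where "u = s * trunc_young t l x"
    have u0: "0 \<le> u" using s t by (simp add: u_def trunc_young_nonneg)
    have u1: "u \<le> s * t * \<bar>x\<bar>" using s by (simp add: u_def trunc_young_def mult.assoc mult_left_mono)
    have u2: "u \<le> c * \<bar>x\<bar> powr q"
      using mult_left_mono[OF min.cobounded2 s(1), of "t * \<bar>x\<bar>" "\<bar>x\<bar> powr q * l powr (1 - q) / q"]
      by (simp add: u_def trunc_young_def c_def mult_ac)
    have "s * t * \<bar>x\<bar> \<le> 1 * \<bar>x\<bar>" using s by (intro mult_right_mono) auto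
    then have u3: "u \<le> \<bar>x\<bar>" using u1 by simp
    \<comment> \<open>One factor exp |x| absorbs x^2 at the cost of a 4, another one bounds exp u.
      Their product is at most exp (2 x) + exp (- 2 x), with Gaussian integral 2 exp 2, whence the
      constant 8 exp 2.\<close>
    have "\<bar>x\<bar> / 2 \<le> exp (\<bar>x\<bar> / 2)" using exp_ge_add_one_self[of "\<bar>x\<bar> / 2"] by linarith
    then have "(\<bar>x\<bar> / 2)\<^sup>2 \<le> (exp (\<bar>x\<bar> / 2))\<^sup>2" by (intro power_mono) auto
    then have x2: "\<bar>x\<bar>\<^sup>2 \<le> 4 * exp \<bar>x\<bar>" by (simp add: power_divide flip: exp_double)
    have "u\<^sup>2 \<le> (s * t * \<bar>x\<bar>)\<^sup>2" using u0 u1 by (intro power_mono) auto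
    also have "\<dots> = (s * t)\<^sup>2 * \<bar>x\<bar>\<^sup>2" by (simp add: power_mult_distrib)
    also have "\<dots> \<le> (s * t)\<^sup>2 * (4 * exp \<bar>x\<bar>)" by (intro mult_left_mono x2) auto
    finally have "u\<^sup>2 * exp u \<le> ((s * t)\<^sup>2 * (4 * exp \<bar>x\<bar>)) * exp \<bar>x\<bar>" using u3 by (intro mult_mono) auto
    also have "\<dots> = k * exp (2 * \<bar>x\<bar>)" by (simp add: k_def exp_double power2_eq_square)
    also have "\<dots> \<le> k * (exp (2 * x) + exp ((-2) * x))"
      using k0 by (intro mult_left_mono) (auto simp: abs_if)
    finally show ?thesis using exp_le_quadratic[OF u0] u2 by (simp add: u_def)
  qed
  have "(\<integral>\<^sup>+x. ennreal (std_normal_density x) * ennreal (exp (s * trunc_young t l x)) \<partial>lborel)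
    \<le> (\<integral>\<^sup>+x. ennreal (std_normal_density x) + ennreal c * ennreal (std_normal_density x * \<bar>x\<bar> powr q)
      + ennreal k * (ennreal (std_normal_density x) * ennreal (exp (2 * x)) + ennreal (std_normal_density x) * ennreal (exp ((-2) * x))) \<partial>lborel)"
  proof (intro nn_integral_mono)
    fix x
    have "std_normal_density x * exp (s * trunc_young t l x) \<le> std_normal_density x * (1 + c * \<bar>x\<bar> powr q + k * (exp (2 * x) + exp ((-2) * x)))"
      by (intro mult_left_mono pt) auto
    also have "\<dots> = std_normal_density x + c * (std_normal_density x * \<bar>x\<bar> powr q)
       + k * (std_normal_density x * exp (2 * x) + std_normal_density x * exp ((-2) * x))"
      by (simp add: algebra_simps)
    finally show "ennreal (std_normal_density x) * ennreal (exp (s * trunc_young t l x)) \<le>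
      ennreal (std_normal_density x) + ennreal c * ennreal (std_normal_density x * \<bar>x\<bar> powr q)
      + ennreal k * (ennreal (std_normal_density x) * ennreal (exp (2 * x)) + ennreal (std_normal_density x) * ennreal (exp ((-2) * x)))"
      using c0 k0 by (simp add: ennreal_leI flip: ennreal_mult ennreal_plus)
  qed
  also have "\<dots> = 1 + ennreal c * ennreal m + ennreal k * (ennreal (exp 2) + ennreal (exp 2))"
  proof -
    have 1: "(\<integral>\<^sup>+x. ennreal (std_normal_density x) \<partial>lborel) = 1" by (subst nn_integral_eq_integral) auto
    have 2: "(\<integral>\<^sup>+x. ennreal (std_normal_density x * \<bar>x\<bar> powr q) \<partial>lborel) = ennreal m"
      unfolding m using q_gt by (intro nn_integral_eq_integral integrable_std_normal_abs_powr) auto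
    have 3: "(\<integral>\<^sup>+x. ennreal (std_normal_density x) * ennreal (exp (- (2 * x))) \<partial>lborel) = ennreal (exp 2)"
      using nn_integral_std_normal_exp[of "- 2"] by simp
    show ?thesis by (simp add: nn_integral_add nn_integral_cmult 1 2 3 nn_integral_std_normal_exp)
  qed
  also have "\<dots> = ennreal (1 + (c * m + k * (2 * exp 2)))"
    using c0 k0 m1 by (simp add: algebra_simps flip: ennreal_mult ennreal_plus ennreal_1)
  also have "\<dots> \<le> ennreal (exp (c * m + k * (2 * exp 2)))" by (intro ennreal_leI exp_ge_add_one_self)
  also have "c * m + k * (2 * exp 2) = s * (gauss_xi q powr q * l powr (1 - q) / q) + 8 * exp 2 * (s * t)\<^sup>2"
    by (simp add: c_def k_def m_def)
  finally show ?thesis .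
qed

end

section \<open>Union bounds over sparse vectors\<close>

lemma card_grid: "finite (grid n)" "0 \<in> grid n" "card (grid n) \<le> 2 * n\<^sup>2 + 1"
proof -
  show "finite (grid n)" by (simp add: grid_def)
  show "0 \<in> grid n" unfolding grid_def by (rule image_eqI[of _ _ 0]) auto
  have "card (grid n) \<le> card {- int (n\<^sup>2)..int (n\<^sup>2)}" unfolding grid_def by (rule card_image_le) simp
  also have "\<dots> = 2 * n\<^sup>2 + 1" unfolding card_atLeastAtMost_int by linarith
  finally show "card (grid n) \<le> 2 * n\<^sup>2 + 1" .
qed

lemma gaussian_matrix_measurable:
  assumes "gaussian_matrix M n g" "i \<in> {1..n}" "j \<in> {1..n}"
  shows "g i j \<in> borel_measurable M"
  using assms distributed_measurable[of M lborel "g i j" std_normal_density] by (auto simp: gaussian_matrix_def)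

lemma bilin_measurable:
  assumes "gaussian_matrix M n g"
  shows "(\<lambda>\<omega>. bilin n (mat_at g \<omega>) a b) \<in> borel_measurable M"
  unfolding bilin_def using gaussian_matrix_measurable[OF assms] by (auto intro!: borel_measurable_sum)

lemma mat_vec_sym_measurable:
  assumes "gaussian_matrix M n g" "i \<in> {1..n}"
  shows "(\<lambda>\<omega>. mat_vec n (sym_mat (mat_at g \<omega>)) y i) \<in> borel_measurable M"
  unfolding mat_vec_def sym_mat_def using gaussian_matrix_measurable[OF assms(1)] assms(2)
  by (auto intro!: borel_measurable_sum)

text \<open>Vectors of support size k are counted together with all sparser ones. The overcount is
  harmless because the weights decay faster than these counts grow.\<close>

lemma sum_sparse_weights:
  assumes V: "finite V" "0 \<in> V" and n: "1 \<le> n" and w: "\<And>k. 0 \<le> (w k :: real)"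
  shows "(\<Sum>a\<in>{a\<in>vecs n V. supp n a \<noteq> {}}. w (card (supp n a))) \<le> (\<Sum>k\<in>{1..n}. (real n * real (card V)) ^ k * w k)"
proof -
  let ?A = "{a\<in>vecs n V. supp n a \<noteq> {}}"
  have fin: "finite ?A" using finite_vecs[OF V(1)] by simp
  have "w (card (supp n a)) \<le> (\<Sum>k\<in>{1..n}. if card (supp n a) \<le> k then w k else 0)" if "a \<in> ?A" for a
  proof -
    have "card (supp n a) \<le> card {1..n}" by (intro card_mono) (auto simp: supp_def)
    moreover have "0 < card (supp n a)" using that by (simp add: card_gt_0_iff)
    ultimately have "card (supp n a) \<in> {1..n}" by (simp add: Suc_le_eq)
    then have "(if card (supp n a) \<le> card (supp n a) then w (card (supp n a)) else 0) \<le> (\<Sum>k\<in>{1..n}. if card (supp n a) \<le> k then w k else 0)"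
      using w by (intro member_le_sum) auto
    then show ?thesis by simp
  qed
  then have "(\<Sum>a\<in>?A. w (card (supp n a))) \<le> (\<Sum>a\<in>?A. \<Sum>k\<in>{1..n}. if card (supp n a) \<le> k then w k else 0)"
    by (intro sum_mono)
  also have "\<dots> = (\<Sum>k\<in>{1..n}. \<Sum>a\<in>?A. if card (supp n a) \<le> k then w k else 0)" by (rule sum.swap)
  also have "\<dots> \<le> (\<Sum>k\<in>{1..n}. (real n * real (card V)) ^ k * w k)"
  proof (intro sum_mono)
    fix k
    have "(\<Sum>a\<in>?A. if card (supp n a) \<le> k then w k else 0) = (\<Sum>a\<in>{a\<in>?A. card (supp n a) \<le> k}. w k)"
      by (rule sum.inter_filter[OF fin, symmetric])
    also have "\<dots> = real (card {a\<in>?A. card (supp n a) \<le> k}) * w k" by simp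
    also have "card {a\<in>?A. card (supp n a) \<le> k} \<le> card {a\<in>vecs n V. card (supp n a) \<le> k}"
      using finite_vecs[OF V(1)] by (intro card_mono) auto
    also have "\<dots> \<le> (n * card V) ^ k" by (rule card_sparse_vecs[OF V n])
    finally show "(\<Sum>a\<in>?A. if card (supp n a) \<le> k then w k else 0) \<le> (real n * real (card V)) ^ k * w k"
      using w[of k] by (simp add: mult_right_mono flip: of_nat_mult of_nat_power)
  qed
  finally show ?thesis .
qed

text \<open>A pair with support sizes k and l fails with probability at most n powr (-(3 + d) (k +
  l)), since A^2 / 2 = 3 + d, and this factorizes over the two vectors. At most (3 n)^k \<le> n^(2
  k) sign vectors have support size at most k, which leaves n powr (-(1 + d) k) for each k \<le> n
  and n powr (- d) after summation.\<close>

lemma sign_bound_prob: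
  assumes gm: "gaussian_matrix M n g" and n: "3 \<le> n" and d: "0 < d"
  defines "A \<equiv> sqrt (2 * (3 + d))"
  shows "{\<omega> \<in> space M. sign_bound n A (mat_at g \<omega>)} \<in> sets M"
    and "measure M {\<omega> \<in> space M. \<not> sign_bound n A (mat_at g \<omega>)} \<le> real n powr (- d)"
proof -
  interpret prob_space M using gm by (simp add: gaussian_matrix_def)
  define V :: "real set" where "V = {-1, 0, 1}"
  define S where "S = vecs n V"
  have V: "finite V" "0 \<in> V" "card V = 3" by (auto simp: V_def)
  have fS: "finite S" using finite_vecs V by (simp add: S_def)
  define r where "r a b = A * sqrt (nnz n a * nnz n b *
       (nnz n a + nnz n b) * ln (real n))" for a b
  define Bd where "Bd a b = {\<omega> \<in> space M. r a b < bilin n (mat_at g \<omega>) a b}" for a b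
  have Bd: "Bd a b \<in> sets M" for a b unfolding Bd_def using bilin_measurable[OF gm] by measurable
  have sb: "sign_bound n A G \<longleftrightarrow> (\<forall>a\<in>S. \<forall>b\<in>S. \<not> r a b < bilin n G a b)" for G
    by (simp add: sign_bound_def S_def V_def r_def not_less)
  have good: "{\<omega> \<in> space M. sign_bound n A (mat_at g \<omega>)} = space M - (\<Union>a\<in>S. \<Union>b\<in>S. Bd a b)"
    by (auto simp: sb Bd_def)
  show "{\<omega> \<in> space M. sign_bound n A (mat_at g \<omega>)} \<in> sets M"
    unfolding good using fS Bd by (intro sets.Diff sets.top sets.finite_UN) auto
  have L: "0 < ln (real n)" using n by simp
  have A2: "A\<^sup>2 / 2 = 3 + d" using d by (simp add: A_def)
  define w where "w k = exp (- ((3 + d) * real k * ln (real n)))" for k :: nat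
  have w: "w k = real n powr (- ((3 + d) * real k))" for k using n by (simp add: w_def powr_def)
  define S' where "S' = {a \<in> S. supp n a \<noteq> {}}"
  have fS': "finite S'" using fS by (simp add: S'_def)
  have bad: "{\<omega> \<in> space M. \<not> sign_bound n A (mat_at g \<omega>)} \<subseteq> (\<Union>(a, b)\<in>S' \<times> S'. Bd a b)"
  proof
    fix \<omega> assume "\<omega> \<in> {\<omega> \<in> space M. \<not> sign_bound n A (mat_at g \<omega>)}"
    then obtain a b where ab: "a \<in> S" "b \<in> S" "\<omega> \<in> Bd a b" "\<omega> \<in> space M" by (auto simp: sb Bd_def)
    \<comment> \<open>With an empty support both sides of the inequality are 0, so such a pair never
      fails.\<close>
    have "supp n a \<noteq> {} \<and> supp n b \<noteq> {}"
    proof (rule ccontr)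
      assume "\<not> ?thesis"
      then have "bilin n (mat_at g \<omega>) a b = 0" "r a b = 0"
        by (auto simp: bilin_def r_def supp_def intro!: sum.neutral)
      then show False using ab by (simp add: Bd_def)
    qed
    then show "\<omega> \<in> (\<Union>(a, b)\<in>S' \<times> S'. Bd a b)" using ab by (auto simp: S'_def)
  qed
  have each: "prob (Bd a b) \<le> w (card (supp n a)) * w (card (supp n b))" if "a \<in> S'" "b \<in> S'" for a b
  proof -
    define k l where "k = nnz n a" and "l = nnz n b"
    have k0: "0 < k" "0 < l" using that by (auto simp: k_def l_def S'_def card_gt_0_iff)
    have sq: "(\<Sum>i\<in>{1..n}. (a i)\<^sup>2) = nnz n a" if "a \<in> S'" for a
    proof -
      have "(\<Sum>i\<in>{1..n}. (a i)\<^sup>2) = (\<Sum>i\<in>supp n a. (a i)\<^sup>2)"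
        by (intro sum.mono_neutral_right) (auto simp: supp_def)
      also have "\<dots> = (\<Sum>i\<in>supp n a. 1)"
      proof (intro sum.cong refl)
        fix i assume "i \<in> supp n a"
        then have "a i = -1 \<or> a i = 1" using that by (auto simp: supp_def S'_def S_def vecs_def V_def)
        then show "(a i)\<^sup>2 = 1" by auto
      qed
      finally show ?thesis by simp
    qed
    have "prob {\<omega> \<in> space M. r a b < (\<Sum>p\<in>{1..n} \<times> {1..n}. (case p of (i, j) \<Rightarrow> a i * b j) * (case p of (i, j) \<Rightarrow> g i j) \<omega>)}
      \<le> exp (- ((r a b)\<^sup>2 / (2 * (k * l))))"
    proof (rule gaussian_sum_tail)
      show "indep_vars (\<lambda>_. borel) (\<lambda>(i, j). g i j) ({1..n} \<times> {1..n})" using gm by (simp add: gaussian_matrix_def)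
      show "distributed M lborel (case p of (i, j) \<Rightarrow> g i j) (\<lambda>x. ennreal (std_normal_density x))"
        if "p \<in> {1..n} \<times> {1..n}" for p using gm that by (auto simp: gaussian_matrix_def)
      have "(\<Sum>p\<in>{1..n} \<times> {1..n}. (case p of (i, j) \<Rightarrow> a i * b j)\<^sup>2) = (\<Sum>i\<in>{1..n}. \<Sum>j\<in>{1..n}. (a i)\<^sup>2 * (b j)\<^sup>2)"
        by (simp add: sum.cartesian_product' power_mult_distrib)
      also have "\<dots> = (\<Sum>i\<in>{1..n}. (a i)\<^sup>2) * (\<Sum>j\<in>{1..n}. (b j)\<^sup>2)" by (simp only: sum_product)
      also have "\<dots> = k * l" using sq that by (simp only: k_def l_def)
      finally show "(\<Sum>p\<in>{1..n} \<times> {1..n}. (case p of (i, j) \<Rightarrow> a i * b j)\<^sup>2) \<le> k * l" by simp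
      show "0 \<le> r a b" using L d by (simp add: r_def A_def)
    qed (use k0 in auto)
    also have "(\<lambda>\<omega>. \<Sum>p\<in>{1..n} \<times> {1..n}. (case p of (i, j) \<Rightarrow> a i * b j) * (case p of (i, j) \<Rightarrow> g i j) \<omega>)
       = (\<lambda>\<omega>. bilin n (mat_at g \<omega>) a b)" by (simp add: sum.cartesian_product' bilin_def mult_ac)
    also have "(r a b)\<^sup>2 / (2 * (k * l)) = A\<^sup>2 / 2 * (k + l) * ln (real n)"
      using k0 L by (simp add: r_def power_mult_distrib flip: k_def l_def)
    also have "exp (- (A\<^sup>2 / 2 * (k + l) * ln (real n))) = w (card (supp n a)) * w (card (supp n b))"
      unfolding A2 by (simp add: w_def k_def l_def algebra_simps flip: exp_add)
    finally show ?thesis by (simp add: Bd_def)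
  qed
  have W: "(\<Sum>a\<in>S'. w (card (supp n a))) \<le> real n powr (- d)"
  proof -
    have "(\<Sum>a\<in>S'. w (card (supp n a))) \<le> (\<Sum>k\<in>{1..n}. (real n * real (card V)) ^ k * w k)"
      unfolding S'_def S_def using V n by (intro sum_sparse_weights) (auto simp: w_def)
    also have "\<dots> \<le> (\<Sum>k\<in>{1..n}. real n powr (- (1 + d)))"
    proof (intro sum_mono)
      fix k assume k: "k \<in> {1..n}"
      have "real n * real (card V) \<le> (real n)\<^sup>2" using n by (simp add: V power2_eq_square)
      then have "(real n * real (card V)) ^ k \<le> ((real n)\<^sup>2) ^ k" by (intro power_mono) auto
      also have "\<dots> = real n ^ (2 * k)" by (simp add: power_mult)
      also have "\<dots> = real n powr real (2 * k)" using n by (intro powr_realpow[symmetric]) auto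
      also have "\<dots> = real n powr (2 * real k)" by simp
      finally have "(real n * real (card V)) ^ k * w k \<le> real n powr (2 * real k) * w k"
        by (intro mult_right_mono) (auto simp: w_def)
      also have "\<dots> = real n powr (- ((1 + d) * real k))" by (simp add: w algebra_simps flip: powr_add)
      also have "\<dots> \<le> real n powr (- (1 + d))"
      proof (intro powr_mono)
        have "(1 + d) * 1 \<le> (1 + d) * real k" using d k by (intro mult_left_mono) auto
        then show "- ((1 + d) * real k) \<le> - (1 + d)" by (simp only: neg_le_iff_le mult_1_right)
      qed (use n in simp)
      finally show "(real n * real (card V)) ^ k * w k \<le> real n powr (- (1 + d))" .
    qed
    also have "\<dots> = real n powr 1 * real n powr (- (1 + d))" by simp
    also have "\<dots> = real n powr (- d)" by (subst powr_add[symmetric]) simp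
    finally show ?thesis .
  qed
  have W0: "0 \<le> (\<Sum>a\<in>S'. w (card (supp n a)))" by (intro sum_nonneg) (simp add: w_def)
  have "prob {\<omega> \<in> space M. \<not> sign_bound n A (mat_at g \<omega>)} \<le> prob (\<Union>(a, b)\<in>S' \<times> S'. Bd a b)"
    using fS' Bd by (intro finite_measure_mono bad) auto
  also have "\<dots> \<le> (\<Sum>p\<in>S' \<times> S'. prob (case p of (a, b) \<Rightarrow> Bd a b))"
    using fS' Bd by (intro finite_measure_subadditive_finite) auto
  also have "\<dots> \<le> (\<Sum>p\<in>S' \<times> S'. case p of (a, b) \<Rightarrow> w (card (supp n a)) * w (card (supp n b)))"
    using each by (intro sum_mono) auto
  also have "\<dots> = (\<Sum>a\<in>S'. w (card (supp n a))) * (\<Sum>b\<in>S'. w (card (supp n b)))"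
    by (simp add: sum_product sum.cartesian_product)
  also have "\<dots> \<le> real n powr (- d) * 1"
  proof (intro mult_mono W W0)
    have "real n powr (- d) \<le> real n powr 0" using n d by (intro powr_mono) auto
    then show "(\<Sum>b\<in>S'. w (card (supp n b))) \<le> 1" using W n by simp
  qed simp
  finally show "prob {\<omega> \<in> space M. \<not> sign_bound n A (mat_at g \<omega>)} \<le> real n powr (- d)" by simp
qed

context conjugate_exponents begin

text \<open>Chernoff's bound with parameter E = \<open>err n\<close>. The means add up to at most
  the main term; the assumption \<open>small\<close> gives E t \<le> 1, and then the quadratic
  remainders add up to at most 8 exp 2 E^2. The net has at most exp (4 E^2) points, so A leaves the
  exponent - d E^2, and E^2 \<ge> ln n.\<close>

lemma young_bound_prob:
  assumes gm: "gaussian_matrix M n g" and n: "3 \<le> n" and d: "0 < d" and small: "(err n)\<^sup>2 \<le> real n"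
  defines "A \<equiv> 4 + 8 * exp 2 + d"
  shows "{\<omega> \<in> space M. young_bound n A (mat_at g \<omega>)} \<in> sets M"
    and "measure M {\<omega> \<in> space M. \<not> young_bound n A (mat_at g \<omega>)} \<le> real n powr (- d)"
proof -
  interpret prob_space M using gm by (simp add: gaussian_matrix_def)
  define E where "E = err n"
  define N where "N = gauss_norm n"
  define t where "t = 1 / sqrt (real n)"
  have t: "0 < t" "t\<^sup>2 = 1 / real n" using n by (simp_all add: t_def power_divide)
  have L: "0 < ln (real n)" using n by simp
  have E0: "0 \<le> E" using L by (simp add: E_def err_def)
  have E2: "E\<^sup>2 = real n powr (p - 1) * ln (real n)" unfolding E_def by (rule err_squared[OF n])
  have np: "1 \<le> real n powr (p - 1)" using n p1 by (intro ge_one_powr_ge_zero) auto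
  have \<xi>: "0 < gauss_xi q" using gauss_xi_powr(3) q_gt by simp
  have N0: "0 < N" using \<xi> n by (simp add: N_def gauss_norm_def)
  define S where "S = {y \<in> vecs n (grid n). supp n y \<noteq> {} \<and> nnz n y \<le> real n powr (p - 1)}"
  define Y where "Y y i \<omega> = trunc_young t (2 * c0 * N) (mat_vec n (sym_mat (mat_at g \<omega>)) y i / l2norm n y)" for y i \<omega>
  define r where "r = N * c0 / q + A * E"
  define Bd where "Bd y = {\<omega> \<in> space M. r < (\<Sum>i\<in>{1..n} - supp n y. Y y i \<omega>)}" for y
  have Ym[measurable]: "Y y i \<in> borel_measurable M" if "i \<in> {1..n}" for y i
    unfolding Y_def using mat_vec_sym_measurable[OF gm that] by measurable
  have Bd: "Bd y \<in> sets M" for y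
  proof -
    have "(\<lambda>\<omega>. \<Sum>i\<in>{1..n} - supp n y. Y y i \<omega>) \<in> borel_measurable M"
      using Ym by (intro borel_measurable_sum) auto
    then show ?thesis unfolding Bd_def by measurable
  qed
  have fS: "finite S" using finite_vecs[OF card_grid(1)] by (simp add: S_def)
  have yb: "young_bound n A (mat_at g \<omega>) \<longleftrightarrow> (\<forall>y\<in>S. \<not> r < (\<Sum>i\<in>{1..n} - supp n y. Y y i \<omega>))" for \<omega>
    unfolding young_bound_def S_def Y_def r_def t_def N_def E_def not_less by blast
  have good: "{\<omega> \<in> space M. young_bound n A (mat_at g \<omega>)} = space M - (\<Union>y\<in>S. Bd y)"
    by (auto simp: yb Bd_def)
  show "{\<omega> \<in> space M. young_bound n A (mat_at g \<omega>)} \<in> sets M" unfolding good using fS Bd by auto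
  define m where "m = nat \<lfloor>real n powr (p - 1)\<rfloor>"
  have m: "real m \<le> real n powr (p - 1)" unfolding m_def by simp
  have "S \<subseteq> {y \<in> vecs n (grid n). card (supp n y) \<le> m}" by (auto simp: S_def m_def le_nat_floor)
  then have "card S \<le> card {y \<in> vecs n (grid n). card (supp n y) \<le> m}"
    using finite_vecs[OF card_grid(1)] by (intro card_mono) auto
  also have "\<dots> \<le> (n * card (grid n)) ^ m" using n by (intro card_sparse_vecs card_grid) auto
  \<comment> \<open>n indices times at most 2 n^2 + 1 \<le> n^3 grid values, as n \<ge> 3.\<close>
  also have "\<dots> \<le> (n ^ 4) ^ m"
  proof (intro power_mono)
    have "1 \<le> n\<^sup>2" using n by simp
    then have "2 * n\<^sup>2 + 1 \<le> 3 * n\<^sup>2" by linarith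
    also have "\<dots> \<le> n * n\<^sup>2" using n by (intro mult_right_mono) auto
    finally have "card (grid n) \<le> n * n\<^sup>2" using card_grid(3)[of n] by linarith
    then have "n * card (grid n) \<le> n * (n * n\<^sup>2)" by (intro mult_left_mono) auto
    then show "n * card (grid n) \<le> n ^ 4" by (simp add: numeral_eq_Suc)
  qed auto
  finally have "real (card S) \<le> real ((n ^ 4) ^ m)" by (rule of_nat_mono)
  also have "\<dots> = exp (4 * real m * ln (real n))"
  proof -
    have "real ((n ^ 4) ^ m) = real n ^ (4 * m)" by (simp add: power_mult)
    also have "\<dots> = real n powr real (4 * m)" using n by (intro powr_realpow[symmetric]) auto
    finally show ?thesis using n by (simp add: powr_def)
  qed
  also have "\<dots> \<le> exp (4 * E\<^sup>2)" using m L by (simp add: E2 mult_right_mono)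
  finally have cS: "real (card S) \<le> exp (4 * E\<^sup>2)" .
  have st: "E * t \<le> 1"
  proof -
    have "E \<le> sqrt (real n)" using small E0 by (simp add: E_def real_le_rsqrt)
    then show ?thesis using n by (simp add: t_def)
  qed
  define \<mu> where "\<mu> = gauss_xi q powr q * (2 * c0 * N) powr (1 - q) / q"
  \<comment> \<open>\<mu> is the untruncated mean for the multiplier 2 c0 N; the identity
    \<open>(2 * c0) powr (1 - q) = c0\<close> turns n \<mu> into the main term exactly.\<close>
  have n\<mu>: "real n * \<mu> = N * c0 / q"
  proof -
    have Nq: "N powr q = gauss_xi q powr q * real n"
      using \<xi> q_gt n by (simp add: N_def gauss_norm_def powr_mult powr_powr)
    have "(2 * c0 * N) powr (1 - q) = (2 * c0) powr (1 - q) * N powr (1 - q)" by (rule powr_mult)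
    then have "real n * \<mu> = (gauss_xi q powr q * real n) * N powr (1 - q) * c0 / q"
      by (simp add: \<mu>_def c0(6))
    also have "(gauss_xi q powr q * real n) * N powr (1 - q) = N powr 1"
      unfolding Nq[symmetric] by (subst powr_add[symmetric]) simp
    finally show ?thesis using N0 by simp
  qed
  have \<mu>0: "0 \<le> \<mu>" using q_gt by (simp add: \<mu>_def)
  have each: "prob (Bd y) \<le> exp (- ((4 + d) * E\<^sup>2))" if y: "y \<in> S" for y
  proof -
    have yne: "supp n y \<noteq> {}" using y by (simp add: S_def)
    have ind: "indep_vars (\<lambda>_. borel) (\<lambda>(i, j). g i j) ({1..n} \<times> {1..n})" using gm by (simp add: gaussian_matrix_def)
    have dist: "\<And>i j. i \<in> {1..n} \<Longrightarrow> j \<in> {1..n} \<Longrightarrow> distributed M lborel (g i j) std_normal_density"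
      using gm by (simp add: gaussian_matrix_def)
    have "prob (Bd y) \<le> exp ((\<Sum>i\<in>{1..n} - supp n y. E * \<mu> + 8 * exp 2 * (E * t)\<^sup>2) - E * r)"
      unfolding Bd_def
    proof (rule chernoff_bound[OF _ _ E0])
      show "indep_vars (\<lambda>_. borel) (Y y) ({1..n} - supp n y)" unfolding Y_def
        by (rule indep_mat_vec_off_supp[OF ind, of "\<lambda>w. trunc_young t (2 * c0 * N) (w / l2norm n y)"]) measurable
      fix i assume i: "i \<in> {1..n} - supp n y"
      have "(\<integral>\<^sup>+\<omega>. ennreal (exp (E * Y y i \<omega>)) \<partial>M) =
        (\<integral>\<^sup>+x. ennreal (std_normal_density x) * ennreal (exp (E * trunc_young t (2 * c0 * N) x)) \<partial>lborel)"
        unfolding Y_def by (rule distributed_nn_integral[OF mat_vec_std_normal[OF ind dist yne i], symmetric]) measurable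
      also have "\<dots> \<le> ennreal (exp (E * \<mu> + 8 * exp 2 * (E * t)\<^sup>2))"
        unfolding \<mu>_def using trunc_young_mgf[OF E0 st] t by simp
      finally show "(\<integral>\<^sup>+\<omega>. ennreal (exp (E * Y y i \<omega>)) \<partial>M) \<le> ennreal (exp (E * \<mu> + 8 * exp 2 * (E * t)\<^sup>2))" .
    qed simp
    also have "(\<Sum>i\<in>{1..n} - supp n y. E * \<mu> + 8 * exp 2 * (E * t)\<^sup>2) \<le> (\<Sum>i\<in>{1..n}. E * \<mu> + 8 * exp 2 * (E * t)\<^sup>2)"
      using E0 \<mu>0 by (intro sum_mono2) auto
    also have "\<dots> = E * (real n * \<mu>) + 8 * exp 2 * E\<^sup>2"
      using n by (simp add: power_mult_distrib t(2) distrib_left)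
    also have "E * (real n * \<mu>) + 8 * exp 2 * E\<^sup>2 - E * r = - ((4 + d) * E\<^sup>2)"
      unfolding n\<mu> by (simp add: r_def A_def power2_eq_square algebra_simps)
    finally show ?thesis by simp
  qed
  have "{\<omega> \<in> space M. \<not> young_bound n A (mat_at g \<omega>)} = (\<Union>y\<in>S. Bd y)" using good by (auto simp: Bd_def)
  then have "prob {\<omega> \<in> space M. \<not> young_bound n A (mat_at g \<omega>)} = prob (\<Union>y\<in>S. Bd y)" by simp
  also have "\<dots> \<le> (\<Sum>y\<in>S. prob (Bd y))" using fS Bd by (intro finite_measure_subadditive_finite) auto
  also have "\<dots> \<le> (\<Sum>y\<in>S. exp (- ((4 + d) * E\<^sup>2)))" by (intro sum_mono each)
  also have "\<dots> = real (card S) * exp (- ((4 + d) * E\<^sup>2))" by simp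
  also have "\<dots> \<le> exp (4 * E\<^sup>2) * exp (- ((4 + d) * E\<^sup>2))" by (intro mult_right_mono cS) auto
  also have "\<dots> = exp (- (d * E\<^sup>2))" by (simp add: algebra_simps flip: exp_add)
  also have "\<dots> \<le> exp (- (d * ln (real n)))"
  proof -
    have "1 * ln (real n) \<le> E\<^sup>2" unfolding E2 using np L by (intro mult_right_mono) auto
    then show ?thesis using d by (simp add: mult_left_mono)
  qed
  also have "\<dots> = real n powr (- d)" using n by (simp add: powr_def)
  finally show "prob {\<omega> \<in> space M. \<not> young_bound n A (mat_at g \<omega>)} \<le> real n powr (- d)" .
qed

end

section \<open>Measurability of the event\<close>

text \<open>The constraint set is compact for each outcome and every constraint is continuous in \<open>x\<close> and
  measurable in the outcome, so the existence of a far point with a large value of the form can be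
  tested approximately on rational points.\<close>

definition coord_box :: "nat \<Rightarrow> (nat \<Rightarrow> real) set" where
  "coord_box n = (\<Pi>\<^sub>E i\<in>UNIV. if i \<in> {1..n} then {-1..1} else {0})"

definition rat_box :: "nat \<Rightarrow> (nat \<Rightarrow> real) set" where
  "rat_box n = (\<Union>k. vecs n ((\<lambda>j. real_of_int j / real (Suc k)) ` {- int (Suc k)..int (Suc k)}))"

lemma compact_coord_box: "compact (coord_box n)"
proof -
  have "compactin (product_topology (\<lambda>_. euclidean) UNIV) (\<Pi>\<^sub>E i\<in>UNIV. if i \<in> {1..n} then {-1..1::real} else {0})"
    by (subst compactin_PiE) auto
  then show ?thesis unfolding coord_box_def by (simp add: euclidean_product_topology)
qed

lemma mem_coord_box: "x \<in> coord_box n \<longleftrightarrow> (\<forall>i\<in>{1..n}. \<bar>x i\<bar> \<le> 1) \<and> (\<forall>i. i \<notin> {1..n} \<longrightarrow> x i = 0)"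
  by (auto simp: coord_box_def PiE_UNIV_domain Pi_iff abs_le_iff split: if_splits) 

lemma countable_rat_box: "countable (rat_box n)"
  unfolding rat_box_def using countable_finite[OF finite_vecs] by (intro countable_UN) auto

lemma rat_box_subset: "rat_box n \<subseteq> coord_box n"
proof
  fix x assume "x \<in> rat_box n"
  then obtain k where k: "x \<in> vecs n ((\<lambda>j. real_of_int j / real (Suc k)) ` {- int (Suc k)..int (Suc k)})"
    by (auto simp: rat_box_def)
  have "\<bar>x i\<bar> \<le> 1" if "i \<in> {1..n}" for i
  proof -
    have "x i \<in> (\<lambda>j. real_of_int j / real (Suc k)) ` {- int (Suc k)..int (Suc k)}"
      using k that unfolding vecs_def by blast
    then obtain j where j: "x i = real_of_int j / real (Suc k)" "j \<in> {- int (Suc k)..int (Suc k)}" by (rule imageE)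
    then have "\<bar>j\<bar> \<le> int (Suc k)" by (auto simp: abs_le_iff simp del: of_nat_Suc)
    then have "\<bar>real_of_int j\<bar> \<le> real (Suc k)" by linarith
    then show ?thesis unfolding j(1) by (simp add: abs_divide divide_le_eq)
  qed
  then show "x \<in> coord_box n" using k by (auto simp: mem_coord_box vecs_def)
qed

lemma rat_box_dense:
  assumes "x \<in> coord_box n"
  shows "\<exists>y. (\<forall>k. y k \<in> rat_box n) \<and> y \<longlonglongrightarrow> x"
proof -
  define y where "y k = (\<lambda>i. real_of_int \<lfloor>x i * real (Suc k)\<rfloor> / real (Suc k))" for k
  have "y k \<in> rat_box n" for k
  proof -
    have "\<lfloor>x i * real (Suc k)\<rfloor> \<in> {- int (Suc k)..int (Suc k)}" if "i \<in> {1..n}" for i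
    proof -
      have "\<bar>x i\<bar> \<le> 1" using assms that by (simp add: mem_coord_box)
      then have "x i \<le> 1" "-1 \<le> x i" by auto
      define a where "a = x i * real (Suc k)"
      have "a \<le> 1 * real (Suc k)" "(-1) * real (Suc k) \<le> a"
        unfolding a_def using \<open>x i \<le> 1\<close> \<open>-1 \<le> x i\<close> by (intro mult_right_mono; simp)+
      then have a: "a \<le> real (Suc k)" "real_of_int (- int (Suc k)) \<le> a" by simp_all
      have "\<lfloor>a\<rfloor> \<le> int (Suc k)" using floor_mono[OF a(1)] by (simp only: floor_of_nat)
      moreover have "- int (Suc k) \<le> \<lfloor>a\<rfloor>" using a(2) by (simp only: le_floor_iff)
      ultimately have "\<lfloor>a\<rfloor> \<le> int (Suc k)" "- int (Suc k) \<le> \<lfloor>a\<rfloor>" .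
      then show ?thesis by (simp add: a_def del: of_nat_Suc)
    qed
    then have "y k \<in> vecs n ((\<lambda>j. real_of_int j / real (Suc k)) ` {- int (Suc k)..int (Suc k)})"
      using assms unfolding vecs_def y_def by (auto simp: mem_coord_box)
    then show ?thesis by (auto simp: rat_box_def)
  qed
  moreover have "(\<lambda>k. y k i) \<longlonglongrightarrow> x i" for i
  proof -
    have "(\<lambda>k. real_of_int \<lfloor>x i * real (Suc k)\<rfloor> / real (Suc k)) \<longlonglongrightarrow> x i"
    proof (rule tendsto_sandwich)
      show "\<forall>\<^sub>F k in sequentially. x i - 1 / real (Suc k) \<le> real_of_int \<lfloor>x i * real (Suc k)\<rfloor> / real (Suc k)"
      proof (intro always_eventually allI)
        fix k
        have "(x i * real (Suc k) - 1) / real (Suc k) \<le> real_of_int \<lfloor>x i * real (Suc k)\<rfloor> / real (Suc k)"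
          by (intro divide_right_mono) (linarith, simp)
        then show "x i - 1 / real (Suc k) \<le> real_of_int \<lfloor>x i * real (Suc k)\<rfloor> / real (Suc k)"
          by (simp add: diff_divide_distrib)
      qed
      show "\<forall>\<^sub>F k in sequentially. real_of_int \<lfloor>x i * real (Suc k)\<rfloor> / real (Suc k) \<le> x i"
      proof (intro always_eventually allI)
        fix k
        have "real_of_int \<lfloor>x i * real (Suc k)\<rfloor> / real (Suc k) \<le> (x i * real (Suc k)) / real (Suc k)"
          by (intro divide_right_mono) (linarith, simp)
        then show "real_of_int \<lfloor>x i * real (Suc k)\<rfloor> / real (Suc k) \<le> x i" by simp
      qed
      show "(\<lambda>k. x i - 1 / real (Suc k)) \<longlonglongrightarrow> x i"
        using tendsto_diff[OF tendsto_const LIMSEQ_inverse_real_of_nat, of "x i"] by (simp add: inverse_eq_divide)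
    qed simp
    then show ?thesis by (simp add: y_def)
  qed
  then have "limitin (product_topology (\<lambda>_. euclidean) UNIV) y x sequentially"
    unfolding limitin_componentwise by simp
  then have "y \<longlonglongrightarrow> x" by (simp add: euclidean_product_topology)
  ultimately show ?thesis by blast
qed

text \<open>By continuity a zero forces small values at nearby rational points. Conversely the
  minimum over the compact box is attained, and a positive minimum would exclude such values. The
  right-hand side has countable quantifiers only.\<close>

lemma zero_on_coord_box_iff:
  fixes f :: "(nat \<Rightarrow> real) \<Rightarrow> real"
  assumes f: "continuous_on UNIV f" and f0: "\<And>x. 0 \<le> f x"
  shows "(\<exists>x\<in>coord_box n. f x = 0) \<longleftrightarrow> (\<forall>m. \<exists>x\<in>rat_box n. f x < 1 / real (Suc m))"
proof
  assume "\<exists>x\<in>coord_box n. f x = 0"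
  then obtain x where x: "x \<in> coord_box n" "f x = 0" by blast
  obtain y where y: "\<And>k. y k \<in> rat_box n" "y \<longlonglongrightarrow> x" using rat_box_dense[OF x(1)] by blast
  have "isCont f x" using f by (simp add: continuous_on_eq_continuous_at)
  then have "(\<lambda>k. f (y k)) \<longlonglongrightarrow> 0" using y(2) x(2) isCont_tendsto_compose by metis
  show "\<forall>m. \<exists>x\<in>rat_box n. f x < 1 / real (Suc m)"
  proof
    fix m
    have "\<forall>\<^sub>F k in sequentially. f (y k) < 1 / real (Suc m)"
      using \<open>(\<lambda>k. f (y k)) \<longlonglongrightarrow> 0\<close> by (rule order_tendstoD) simp
    then obtain k where "f (y k) < 1 / real (Suc m)" by (auto simp: eventually_sequentially)
    then show "\<exists>x\<in>rat_box n. f x < 1 / real (Suc m)" using y(1) by blast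
  qed
next
  assume *: "\<forall>m. \<exists>x\<in>rat_box n. f x < 1 / real (Suc m)"
  have "(\<lambda>_. 0) \<in> coord_box n" by (simp add: mem_coord_box)
  then have "coord_box n \<noteq> {}" by blast
  then obtain x where x: "x \<in> coord_box n" "\<And>y. y \<in> coord_box n \<Longrightarrow> f x \<le> f y"
    using continuous_attains_inf[OF compact_coord_box _ continuous_on_subset[OF f]] by blast
  have "f x = 0"
  proof (rule ccontr)
    assume "f x \<noteq> 0"
    then have "0 < f x" using f0[of x] by simp
    then obtain m where m: "1 / real (Suc m) < f x" using nat_approx_posE by blast
    obtain y where y: "y \<in> rat_box n" "f y < 1 / real (Suc m)" using * by blast
    then show False using x(2)[of y] rat_box_subset m by force
  qed
  then show "\<exists>x\<in>coord_box n. f x = 0" using x(1) by blast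
qed

lemma pnorm_continuous:
  assumes "1 < p"
  shows "continuous_on UNIV (\<lambda>x. pnorm n p (\<lambda>j. x j - y j))"
proof -
  have 1: "continuous_on UNIV (\<lambda>x::nat \<Rightarrow> real. x j)" for j by (rule continuous_on_product_coordinates)
  have 2: "continuous_on UNIV (\<lambda>x::nat \<Rightarrow> real. \<bar>x j - y j\<bar> powr p)" for j
    using assms by (intro continuous_on_powr' continuous_intros 1) auto
  show ?thesis unfolding pnorm_def
    using assms by (intro continuous_on_powr' continuous_intros 2) (auto intro: sum_nonneg)
qed

lemma inner_prod_mat_vec: "inner_prod n (mat_vec n G x) x = bilin n G x x"
  unfolding inner_prod_def mat_vec_def bilin_left by (simp add: mult.commute)

lemma form_continuous: "continuous_on UNIV (\<lambda>x. inner_prod n (mat_vec n G x) x)"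
proof -
  have 1: "continuous_on UNIV (\<lambda>x::nat \<Rightarrow> real. x j)" for j by (rule continuous_on_product_coordinates)
  show ?thesis unfolding inner_prod_def mat_vec_def by (intro continuous_intros 1)
qed

lemma pdist_opt_set:
  assumes "1 \<le> n"
  shows "\<delta> \<le> pdist_set n p x (opt_set n p q G) \<longleftrightarrow>
    (\<forall>i\<in>{1..n}. \<forall>\<epsilon>\<in>{1, -1}. \<delta> \<le> pnorm n p (\<lambda>j. x j - \<epsilon> * opt_point n p q G i j))"
proof -
  have fin: "finite (opt_set n p q G)" by (simp add: opt_set_def)
  have "opt_point n p q G 1 \<in> opt_set n p q G" using assms by (auto simp: opt_set_def)
  then have ne: "opt_set n p q G \<noteq> {}" by blast
  have "\<delta> \<le> pdist_set n p x (opt_set n p q G) \<longleftrightarrow> (\<forall>y\<in>opt_set n p q G. \<delta> \<le> pnorm n p (\<lambda>j. x j - y j))"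
    unfolding pdist_set_def using fin ne by (subst Min_ge_iff) auto
  then show ?thesis by (simp add: opt_set_def)
qed

lemma opt_point_measurable:
  assumes "gaussian_matrix M n g" "i \<in> {1..n}" "j \<in> {1..n}"
  shows "(\<lambda>\<omega>. opt_point n p q (mat_at g \<omega>) i j) \<in> borel_measurable M"
proof -
  have mv: "(\<lambda>\<omega>. mat_vec n (sym_mat (mat_at g \<omega>)) y i) \<in> borel_measurable M" if "i \<in> {1..n}" for i y
    using mat_vec_sym_measurable[OF assms(1) that] .
  have pn: "(\<lambda>\<omega>. pnorm n r (f \<omega>)) \<in> borel_measurable M"
    if [measurable]: "\<And>j. j \<in> {1..n} \<Longrightarrow> (\<lambda>\<omega>. f \<omega> j) \<in> borel_measurable M" for f :: "'a \<Rightarrow> nat \<Rightarrow> real" and r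
    unfolding pnorm_def by measurable
  have ov: "(\<lambda>\<omega>. opt_vec n p q (mat_at g \<omega>) i j) \<in> borel_measurable M" if j: "j \<in> {1..n}" for j
  proof -
    have [measurable]: "g i j \<in> borel_measurable M" "g j i \<in> borel_measurable M"
      using gaussian_matrix_measurable[OF assms(1)] assms(2) j by auto
    have [measurable]: "(\<lambda>\<omega>. pnorm n q (mat_vec n (sym_mat (mat_at g \<omega>)) (basis_vec i))) \<in> borel_measurable M"
      by (intro pn mv)
    have "opt_vec n p q (mat_at g \<omega>) i j = (if (g i j \<omega> + g j i \<omega>) / sqrt 2 \<ge> 0 then 1 else -1) *
       (\<bar>(g i j \<omega> + g j i \<omega>) / sqrt 2\<bar> powr q / pnorm n q (mat_vec n (sym_mat (mat_at g \<omega>)) (basis_vec i)) powr q) powr (1 / p)" for \<omega>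
      by (simp add: opt_vec_def sgn1_def sym_mat_def)
    then show ?thesis by simp
  qed
  have w: "(\<lambda>\<omega>. basis_vec i j + opt_vec n p q (mat_at g \<omega>) i j) \<in> borel_measurable M" if "j \<in> {1..n}" for j
    using ov[OF that] by measurable
  have "(\<lambda>\<omega>. pnorm n p (\<lambda>j. basis_vec i j + opt_vec n p q (mat_at g \<omega>) i j)) \<in> borel_measurable M"
    by (intro pn w)
  then show ?thesis unfolding opt_point_def Let_def using w[OF assms(3)] by measurable
qed

text \<open>The event fails iff a feasible x makes the form exceed b. Replacing "exceeds b" by "is
  at least b + 1 / (k + 1) for some k" makes every condition closed, so failure means that, for some
  k, a continuous nonnegative function of x has a zero.\<close>

lemma max_far_form_measurable:
  assumes gm: "gaussian_matrix M n g" and n: "1 \<le> n" and p: "1 < p"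
  shows "{\<omega> \<in> space M. max_far_form n p q \<delta> (mat_at g \<omega>) \<le> ereal b} \<in> sets M"
proof -
  define o' where "o' \<omega> i = opt_point n p q (mat_at g \<omega>) i" for \<omega> i
  define Q where "Q \<omega> x = bilin n (mat_at g \<omega>) x x" for \<omega> x
  define F where "F k \<omega> x = \<bar>pnorm n p (\<lambda>j. x j - 0) - 1\<bar> +
    (\<Sum>i\<in>{1..n}. max 0 (\<delta> - pnorm n p (\<lambda>j. x j - 1 * o' \<omega> i j)) + max 0 (\<delta> - pnorm n p (\<lambda>j. x j - (-1) * o' \<omega> i j))) +
    max 0 (b + 1 / real (Suc k) - Q \<omega> x)" for k \<omega> x
  have Fc: "continuous_on UNIV (F k \<omega>)" for k \<omega> unfolding F_def Q_def
    by (intro continuous_intros continuous_on_max pnorm_continuous[OF p] form_continuous[unfolded inner_prod_mat_vec])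
  have F0: "0 \<le> F k \<omega> x" for k \<omega> x unfolding F_def by (intro add_nonneg_nonneg sum_nonneg) auto
  have Fz: "F k \<omega> x = 0 \<longleftrightarrow> pnorm n p x = 1 \<and> \<delta> \<le> pdist_set n p x (opt_set n p q (mat_at g \<omega>)) \<and> b + 1 / real (Suc k) \<le> Q \<omega> x" for k \<omega> x
  proof -
    have "F k \<omega> x = 0 \<longleftrightarrow> \<bar>pnorm n p x - 1\<bar> = 0 \<and>
      (\<Sum>i\<in>{1..n}. max 0 (\<delta> - pnorm n p (\<lambda>j. x j - 1 * o' \<omega> i j)) + max 0 (\<delta> - pnorm n p (\<lambda>j. x j - (-1) * o' \<omega> i j))) = 0 \<and>
      max 0 (b + 1 / real (Suc k) - Q \<omega> x) = 0"
      unfolding F_def by (subst add_nonneg_eq_0_iff, (auto intro!: sum_nonneg add_nonneg_nonneg)[2], subst add_nonneg_eq_0_iff, (auto intro!: sum_nonneg)[2], simp)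
    also have "(\<Sum>i\<in>{1..n}. max 0 (\<delta> - pnorm n p (\<lambda>j. x j - 1 * o' \<omega> i j)) + max 0 (\<delta> - pnorm n p (\<lambda>j. x j - (-1) * o' \<omega> i j))) = 0
      \<longleftrightarrow> \<delta> \<le> pdist_set n p x (opt_set n p q (mat_at g \<omega>))" unfolding pdist_opt_set[OF n] o'_def
      by (subst sum_nonneg_eq_0_iff) (auto simp: add_nonneg_eq_0_iff max_def split: if_splits)
    finally show ?thesis by (auto simp: max_def split: if_splits)
  qed
  have Fm: "(\<lambda>\<omega>. F k \<omega> x) \<in> borel_measurable M" for k x
  proof -
    have [measurable]: "(\<lambda>\<omega>. Q \<omega> x) \<in> borel_measurable M" unfolding Q_def by (rule bilin_measurable[OF gm])
    have om[measurable]: "(\<lambda>\<omega>. o' \<omega> i j) \<in> borel_measurable M" if "i \<in> {1..n}" "j \<in> {1..n}" for i j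
      unfolding o'_def by (rule opt_point_measurable[OF gm that])
    have [measurable]: "(\<lambda>\<omega>. pnorm n p (\<lambda>j. x j - e * o' \<omega> i j)) \<in> borel_measurable M" if "i \<in> {1..n}" for i e
      unfolding pnorm_def using om[OF that] by measurable
    show ?thesis unfolding F_def by measurable
  qed
  have iff: "max_far_form n p q \<delta> (mat_at g \<omega>) \<le> ereal b \<longleftrightarrow> \<not> (\<exists>k. \<forall>m. \<exists>x\<in>rat_box n. F k \<omega> x < 1 / real (Suc m))" for \<omega>
  proof -
    have "max_far_form n p q \<delta> (mat_at g \<omega>) \<le> ereal b \<longleftrightarrow>
      (\<forall>x. \<delta> \<le> pdist_set n p x (opt_set n p q (mat_at g \<omega>)) \<and> pnorm n p x = 1 \<longrightarrow> Q \<omega> x \<le> b)"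
      by (auto simp: max_far_form_def SUP_le_iff Q_def inner_prod_mat_vec)
    also have "\<dots> \<longleftrightarrow> \<not> (\<exists>k. \<exists>x. F k \<omega> x = 0)"
    proof
      assume *: "\<not> (\<exists>k. \<exists>x. F k \<omega> x = 0)"
      show "\<forall>x. \<delta> \<le> pdist_set n p x (opt_set n p q (mat_at g \<omega>)) \<and> pnorm n p x = 1 \<longrightarrow> Q \<omega> x \<le> b"
      proof (intro allI impI, rule ccontr)
        fix x assume x: "\<delta> \<le> pdist_set n p x (opt_set n p q (mat_at g \<omega>)) \<and> pnorm n p x = 1" "\<not> Q \<omega> x \<le> b"
        then have "0 < Q \<omega> x - b" by simp
        then obtain k where "1 / real (Suc k) < Q \<omega> x - b" using nat_approx_posE by blast
        then have "F k \<omega> x = 0" using x unfolding Fz by simp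
        then show False using * by blast
      qed
    next
      assume *: "\<forall>x. \<delta> \<le> pdist_set n p x (opt_set n p q (mat_at g \<omega>)) \<and> pnorm n p x = 1 \<longrightarrow> Q \<omega> x \<le> b"
      show "\<not> (\<exists>k. \<exists>x. F k \<omega> x = 0)"
      proof
        assume "\<exists>k. \<exists>x. F k \<omega> x = 0"
        then obtain k x where x: "F k \<omega> x = 0" by blast
        have "0 < 1 / real (Suc k)" by simp
        moreover have "b + 1 / real (Suc k) \<le> Q \<omega> x" "Q \<omega> x \<le> b" using x * unfolding Fz by auto
        ultimately show False by linarith
      qed
    qed
    also have "(\<exists>k. \<exists>x. F k \<omega> x = 0) \<longleftrightarrow> (\<exists>k. \<exists>x\<in>coord_box n. F k \<omega> x = 0)"
    proof (intro iff_exI iffI)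
      fix k assume "\<exists>x. F k \<omega> x = 0"
      then obtain x where x: "F k \<omega> x = 0" by blast
      define x' where "x' i = (if i \<in> {1..n} then x i else 0)" for i
      have pc: "pnorm n p f = pnorm n p f'" if "\<And>i. i \<in> {1..n} \<Longrightarrow> f i = f' i" for f f'
        unfolding pnorm_def using that by (intro arg_cong2[where f = "(powr)"] sum.cong) auto
      have "Q \<omega> x' = Q \<omega> x" unfolding Q_def bilin_def by (intro sum.cong) (auto simp: x'_def)
      then have "F k \<omega> x' = F k \<omega> x"
        unfolding F_def by (intro arg_cong2[where f = "(+)"] arg_cong2[where f = max] arg_cong2[where f = "(-)"] arg_cong[where f = abs] sum.cong pc refl) (auto simp: x'_def)
      moreover have "x' \<in> coord_box n"
      proof -
        have x1: "psum n p x powr (1 / p) = 1" using x unfolding Fz by (simp add: pnorm_def)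
        have "\<bar>x i\<bar> \<le> 1" if "i \<in> {1..n}" for i
        proof -
          have "\<bar>x i\<bar> \<le> psum n p x powr (1 / p)" using p that by (intro abs_le_sum_powr) auto
          then show ?thesis using x1 by simp
        qed
        then show ?thesis by (auto simp: mem_coord_box x'_def)
      qed
      ultimately show "\<exists>x\<in>coord_box n. F k \<omega> x = 0" using x by metis
    qed auto
    also have "\<dots> \<longleftrightarrow> (\<exists>k. \<forall>m. \<exists>x\<in>rat_box n. F k \<omega> x < 1 / real (Suc m))"
      using zero_on_coord_box_iff[OF Fc F0] by simp
    finally show ?thesis .
  qed
  have cnt: "{\<omega> \<in> space M. \<exists>x\<in>rat_box n. F k \<omega> x < 1 / real (Suc m)} \<in> sets M" for k m
  proof -
    have "{\<omega> \<in> space M. \<exists>x\<in>rat_box n. F k \<omega> x < 1 / real (Suc m)} = (\<Union>x\<in>rat_box n. {\<omega> \<in> space M. F k \<omega> x < 1 / real (Suc m)})"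
      by auto
    also have "\<dots> \<in> sets M" using Fm countable_rat_box by (intro sets.countable_UN') auto
    finally show ?thesis .
  qed
  show ?thesis unfolding iff using cnt by (intro sets.sets_Collect_neg sets.sets_Collect_countable_Ex sets.sets_Collect_countable_All)
qed

section \<open>Choice of constants\<close>

lemma ln_powr_times_powr_tendsto_0:
  assumes "0 < (e::real)"
  shows "(\<lambda>n::nat. ln (real n) powr f * real n powr (- e)) \<longlonglongrightarrow> 0" using assms by real_asymp

context conjugate_exponents begin

lemma vec_max_eq:
  assumes "3 \<le> n" "0 \<le> A"
  shows "vec_max n A = (32 * A / gauss_xi q) powr (q / p) * (ln (real n) powr (q / p / 2) * real n powr (- (1 / p)))"
proof -
  have L: "0 < ln (real n)" using assms by simp
  have \<xi>: "0 < gauss_xi q" using gauss_xi_powr(3) q_gt by simp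
  have "32 * A * sqrt (ln (real n)) / gauss_norm n = (32 * A / gauss_xi q) * (ln (real n) powr (1 / 2) * real n powr (- (1 / q)))"
    using L assms by (simp add: gauss_norm_def powr_half_sqrt powr_minus field_simps)
  then have "vec_max n A = (32 * A / gauss_xi q) powr (q / p) * ((ln (real n) powr (1 / 2)) powr (q / p) * (real n powr (- (1 / q))) powr (q / p))"
    unfolding vec_max_def by (simp only: powr_mult)
  also have "(ln (real n) powr (1 / 2)) powr (q / p) = ln (real n) powr (q / p / 2)" by (simp add: powr_powr mult.commute)
  also have "(real n powr (- (1 / q))) powr (q / p) = real n powr (- (1 / p))" using q_gt by (simp add: powr_powr)
  finally show ?thesis .
qed

lemma vec_max_times_powr_tendsto_0:
  assumes "\<beta> < 1 / p" "0 \<le> A"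
  shows "(\<lambda>n. vec_max n A * real n powr \<beta>) \<longlonglongrightarrow> 0"
proof -
  define K where "K = (32 * A / gauss_xi q) powr (q / p)"
  have "(\<lambda>n. K * (ln (real n) powr (q / p / 2) * real n powr (- (1 / p - \<beta>)))) \<longlonglongrightarrow> K * 0"
    using assms by (intro tendsto_mult tendsto_const ln_powr_times_powr_tendsto_0) auto
  moreover have "\<forall>\<^sub>F n in sequentially. K * (ln (real n) powr (q / p / 2) * real n powr (- (1 / p - \<beta>))) = vec_max n A * real n powr \<beta>"
    using eventually_ge_at_top[of 3]
  proof eventually_elim
    case (elim n)
    have "real n powr (- (1 / p - \<beta>)) = real n powr (- (1 / p)) * real n powr \<beta>" by (simp flip: powr_add)
    then show ?case using vec_max_eq[OF elim assms(2)] by (simp add: K_def)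
  qed
  ultimately show ?thesis by (simp add: tendsto_cong)
qed

lemma large_dimension:
  assumes "\<kappa> < 1 / p" "0 \<le> A"
  shows "\<exists>n0\<ge>3. \<forall>n\<ge>n0. vec_max n A \<le> 1 / sqrt (real n) \<and> vec_max n A \<le> 1 / 8 \<and>
    vec_max n A * real n powr \<kappa> \<le> 1 / 200 \<and> (err n)\<^sup>2 \<le> real n"
proof -
  have "1 / 2 < 1 / p" using p1 p2 by (simp add: field_simps)
  then have 1: "\<forall>\<^sub>F n in sequentially. vec_max n A * real n powr (1 / 2) < 1 / 8"
    by (intro order_tendstoD(2)[OF vec_max_times_powr_tendsto_0] assms) auto
  have 2: "\<forall>\<^sub>F n in sequentially. vec_max n A * real n powr \<kappa> < 1 / 200"
    by (intro order_tendstoD(2)[OF vec_max_times_powr_tendsto_0] assms) auto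
  have 3: "\<forall>\<^sub>F n in sequentially. ln (real n) powr 1 * real n powr (- (2 - p)) < 1"
    using p2 by (intro order_tendstoD(2)[OF ln_powr_times_powr_tendsto_0]) auto
  have "\<forall>\<^sub>F n in sequentially. vec_max n A \<le> 1 / sqrt (real n) \<and> vec_max n A \<le> 1 / 8 \<and>
    vec_max n A * real n powr \<kappa> \<le> 1 / 200 \<and> (err n)\<^sup>2 \<le> real n" using 1 2 3 eventually_ge_at_top[of 3]
  proof eventually_elim
    case (elim n)
    have L: "0 < ln (real n)" using elim by simp
    have V0: "0 \<le> vec_max n A" by (simp add: vec_max_def)
    have sq: "vec_max n A * sqrt (real n) < 1 / 8" using elim by (simp add: powr_half_sqrt)
    have "vec_max n A * 1 \<le> vec_max n A * sqrt (real n)" using V0 elim by (intro mult_left_mono) auto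
    then have "vec_max n A \<le> 1 / 8" using sq by simp
    moreover have "vec_max n A \<le> 1 / sqrt (real n)" using sq elim by (simp add: field_simps)
    moreover have "(err n)\<^sup>2 \<le> real n"
    proof -
      have "(err n)\<^sup>2 = real n powr (1 - (2 - p)) * ln (real n)" using err_squared[of n] elim by simp
      also have "\<dots> = real n powr 1 * real n powr (- (2 - p)) * ln (real n)" by (subst powr_add[symmetric]) simp
      also have "\<dots> = real n * (ln (real n) powr 1 * real n powr (- (2 - p)))" using L elim by simp
      also have "\<dots> \<le> real n * 1" using elim by (intro mult_left_mono) auto
      finally show ?thesis by simp
    qed
    ultimately show ?case using elim by simp
  qed
  then obtain n1 where "\<And>n. n1 \<le> n \<Longrightarrow> vec_max n A \<le> 1 / sqrt (real n) \<and> vec_max n A \<le> 1 / 8 \<and>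
    vec_max n A * real n powr \<kappa> \<le> 1 / 200 \<and> (err n)\<^sup>2 \<le> real n" by (auto simp: eventually_sequentially)
  then show ?thesis by (intro exI[of _ "max 3 n1"]) auto
qed

lemma small_constant:
  "\<exists>c>0. c \<le> 1 / 2 \<and> coord_const * c \<le> 1 / 32 \<and>
    dist_coef c < 1 / 2"
proof -
  have k: "0 < coord_const" using coord_const(1) by linarith
  have G: "0 < stab_const" using k p1 by (simp add: stab_const_def)
  have ev: "\<forall>\<^sub>F c::real in at_right 0. 0 < c" by (simp add: eventually_at_right_less)
  have t0: "((\<lambda>c::real. c) \<longlongrightarrow> 0) (at_right 0)" by (rule tendsto_ident_at)
  have "((\<lambda>c. (1 + coord_const) * c) \<longlongrightarrow> (1 + coord_const) * 0) (at_right 0)" by (intro tendsto_intros)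
  then have t1: "((\<lambda>c. ((1 + coord_const) * c) powr p) \<longlongrightarrow> 0) (at_right 0)"
    using k p1 by (intro tendsto_zero_powrI[where b = p] eventually_mono[OF ev]) auto
  have "((\<lambda>c. sqrt (stab_const * c)) \<longlongrightarrow> sqrt (stab_const * 0)) (at_right 0)" by (intro tendsto_intros)
  then have t2: "((\<lambda>c. (sqrt (stab_const * c)) powr p) \<longlongrightarrow> 0) (at_right 0)"
    using G p1 by (intro tendsto_zero_powrI[where b = p] eventually_mono[OF ev]) auto
  have "((\<lambda>c. dist_coef c)
    \<longlongrightarrow> 25 * (0 + coord_const * 0\<^sup>2 + 2 * 0\<^sup>2 + 7 * 0)) (at_right 0)" by (intro tendsto_intros t1 t2)
  then have e1: "\<forall>\<^sub>F c in at_right 0. dist_coef c < 1 / 2" by (rule order_tendstoD) simp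
  have e2: "\<forall>\<^sub>F c::real in at_right 0. c < 1 / 2" using t0 by (rule order_tendstoD) simp
  have "((\<lambda>c. coord_const * c) \<longlongrightarrow> coord_const * 0) (at_right 0)" by (intro tendsto_intros)
  then have e3: "\<forall>\<^sub>F c in at_right 0. coord_const * c < 1 / 32" by (rule order_tendstoD) simp
  have "\<forall>\<^sub>F c in at_right (0::real). 0 < c \<and> c \<le> 1 / 2 \<and> coord_const * c \<le> 1 / 32 \<and>
    dist_coef c < 1 / 2" using ev e1 e2 e3 by eventually_elim simp
  then show ?thesis using eventually_happens'[OF trivial_limit_at_right_real] by blast
qed

lemma distance_budget:
  assumes c: "0 < c" "c \<le> 1 / 2"
    and budget: "dist_coef c < 1 / 2"
    and \<delta>: "0 < \<delta>" "\<delta> \<le> 1" and V: "0 \<le> V" "V \<le> \<delta> / 200"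
  shows "dist_coef (c * \<delta> ^ 3) + 25 * (2 * V) powr p < \<delta> powr p"
proof -
  have k: "0 < coord_const" using coord_const(1) by linarith
  have G: "0 < stab_const" using k p1 by (simp add: stab_const_def)
  have \<delta>3: "\<delta> ^ 3 \<le> \<delta>" using \<delta> power_decreasing[of 1 3 \<delta>] by simp
  have \<delta>6: "\<delta> ^ 6 \<le> \<delta> powr p"
  proof -
    have "\<delta> ^ 6 = \<delta> powr 6" using \<delta> by simp
    also have "\<dots> \<le> \<delta> powr p" using \<delta> p2 by (intro powr_mono') auto
    finally show ?thesis .
  qed
  have \<delta>s: "sqrt (\<delta> ^ 3) \<le> \<delta>"
  proof -
    have "\<delta> ^ 3 \<le> \<delta> ^ 2" using \<delta> by (intro power_decreasing) auto
    then show ?thesis using \<delta> by (intro real_le_lsqrt) auto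
  qed
  have a: "((1 + coord_const) * (c * \<delta> ^ 3)) powr p \<le> ((1 + coord_const) * c) powr p * \<delta> powr p"
  proof -
    have "((1 + coord_const) * (c * \<delta> ^ 3)) powr p \<le> ((1 + coord_const) * c * \<delta>) powr p"
      using \<delta>3 \<delta> c k p1 by (intro powr_mono2) (auto simp: mult.assoc)
    then show ?thesis by (simp add: powr_mult)
  qed
  have b: "(sqrt (stab_const * (c * \<delta> ^ 3))) powr p \<le> (sqrt (stab_const * c)) powr p * \<delta> powr p"
  proof -
    have "(sqrt (stab_const * (c * \<delta> ^ 3))) powr p \<le> (sqrt (stab_const * c) * \<delta>) powr p"
      using \<delta>s \<delta> c G p1 by (intro powr_mono2) (auto simp: real_sqrt_mult mult.assoc)
    then show ?thesis by (simp add: powr_mult)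
  qed
  have v: "25 * (2 * V) powr p \<le> 1 / 2 * \<delta> powr p"
  proof -
    have "(2 * V) powr p \<le> (1 / 100 * \<delta>) powr p" using V p1 by (intro powr_mono2) auto
    also have "\<dots> = (1 / 100) powr p * \<delta> powr p" by (rule powr_mult)
    also have "\<dots> \<le> (1 / 100) powr (1::real) * \<delta> powr p"
      using p1 by (intro mult_right_mono powr_mono') auto
    finally have "(2 * V) powr p \<le> 1 / 100 * \<delta> powr p" by simp
    then show ?thesis using powr_ge_zero[of \<delta> p] by linarith
  qed
  have e: "(c * \<delta> ^ 3)\<^sup>2 \<le> c\<^sup>2 * \<delta> powr p"
    using \<delta>6 by (simp add: power_mult_distrib mult_left_mono flip: power_mult)
  have "dist_coef (c * \<delta> ^ 3) \<le> 25 * (((1 + coord_const) * c) powr p * \<delta> powr p + coord_const * (c\<^sup>2 * \<delta> powr p) +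
      2 * (c\<^sup>2 * \<delta> powr p) + 7 * ((sqrt (stab_const * c)) powr p * \<delta> powr p))"
    using a b k by (intro mult_left_mono[OF _ less_imp_le[OF k]] mult_left_mono add_mono e) auto
  also have "\<dots> = dist_coef c * \<delta> powr p" by (simp add: algebra_simps)
  finally have "dist_coef (c * \<delta> ^ 3) + 25 * (2 * V) powr p \<le> dist_coef c * \<delta> powr p + 1 / 2 * \<delta> powr p"
    using v by (intro add_mono)
  also have "\<dots> < 1 / 2 * \<delta> powr p + 1 / 2 * \<delta> powr p"
    using budget \<delta> by (intro add_strict_right_mono mult_strict_right_mono) auto
  finally show ?thesis by simp
qed

lemma max_far_form_le:
  assumes sb: "sign_bound n A1 G" and yb: "young_bound n A2 G" and n: "3 \<le> n" and A: "0 \<le> A1" "0 \<le> A2"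
    and V: "vec_max n A1 \<le> 1 / sqrt (real n)" "vec_max n A1 \<le> 1 / 8" "vec_max n A1 \<le> \<delta> / 200"
    and c: "0 < c" "c \<le> 1 / 2" "coord_const * c \<le> 1 / 32"
      "dist_coef c < 1 / 2"
    and \<delta>: "0 < \<delta>" "\<delta> \<le> 1"
  shows "max_far_form n p q \<delta> G \<le> ereal (sqrt 2 * c0\<^sup>2 * (1 - c\<^sup>2 * \<delta> ^ 6) * gauss_norm n + err_total A1 A2 * err n)"
  unfolding max_far_form_def
proof (rule SUP_least)
  fix x assume "x \<in> {x. \<delta> \<le> pdist_set n p x (opt_set n p q G) \<and> pnorm n p x = 1}"
  then have far: "\<delta> \<le> pdist_set n p x (opt_set n p q G)" and x1: "pnorm n p x = 1" by auto
  define s where "s = c * \<delta> ^ 3"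
  have s2: "s\<^sup>2 = c\<^sup>2 * \<delta> ^ 6" by (simp add: s_def power_mult_distrib flip: power_mult)
  have d3: "\<delta> ^ 3 \<le> 1" "0 < \<delta> ^ 3" using \<delta> by (auto intro: power_le_one)
  have S: "psum n p x = 1" (is "?S = 1")
  proof -
    have "?S = (?S powr (1 / p)) powr p" using p1 by (simp add: powr_powr sum_nonneg)
    then show ?thesis using x1 by (simp add: pnorm_def)
  qed
  have \<xi>: "0 < gauss_xi q" using gauss_xi_powr(3) q_gt by simp
  have n1: "1 \<le> n" using n by simp
  have "bilin n G x x \<le> sqrt 2 * c0\<^sup>2 * (1 - s\<^sup>2) * gauss_norm n + err_total A1 A2 * err n"
  proof (rule ccontr)
    assume "\<not> ?thesis"
    then have big: "sqrt 2 * c0\<^sup>2 * (1 - s\<^sup>2) * gauss_norm n + err_total A1 A2 * err n < bilin n G x x" by simp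
    have "0 < s" using c \<delta> by (simp add: s_def)
    moreover have "s \<le> 1 / 2" unfolding s_def using c d3 mult_mono[of c "1 / 2" "\<delta> ^ 3" 1] by simp
    moreover have "coord_const * s \<le> 1 / 32"
      unfolding s_def using c d3 coord_const(1) mult_mono[of "coord_const * c" "1 / 32" "\<delta> ^ 3" 1] by (simp add: mult.assoc)
    ultimately obtain i \<epsilon> where i: "i \<in> {1..n}" "\<epsilon> \<in> {1, -1}" and
      le: "(\<Sum>j\<in>{1..n}. \<bar>x j - \<epsilon> * opt_point n p q G i j\<bar> powr p) \<le>
        dist_coef s + 25 * (2 * vec_max n A1) powr p" (is "?D \<le> _")
      using near_maximizer_close_to_opt[OF sb yb n \<xi> A S _ _ _ V(1,2) big] by blast
    have "0 \<le> vec_max n A1" by (simp add: vec_max_def)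
    then have "?D < \<delta> powr p" using le distance_budget[OF c(1,2,4) \<delta> _ V(3)] unfolding s_def by linarith
    have "\<delta> \<le> pnorm n p (\<lambda>j. x j - \<epsilon> * opt_point n p q G i j)"
      using far i unfolding pdist_opt_set[OF n1] by blast
    then have "\<delta> powr p \<le> (?D powr (1 / p)) powr p"
      using \<delta> p1 by (intro powr_mono2) (auto simp: pnorm_def)
    also have "\<dots> = ?D" using p1 by (simp add: powr_powr sum_nonneg)
    finally show False using \<open>?D < \<delta> powr p\<close> by simp
  qed
  then show "ereal (inner_prod n (mat_vec n G x) x) \<le> ereal (sqrt 2 * c0\<^sup>2 * (1 - c\<^sup>2 * \<delta> ^ 6) * gauss_norm n + err_total A1 A2 * err n)"
    by (simp add: inner_prod_mat_vec s2)
qed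

lemma crude_const_pos: "0 < crude_const p"
proof -
  have "2 powr (p / 2 - 1) < 2 powr (0::real)" using p2 by (intro powr_less_mono) auto
  moreover have "2 powr (0::real) < 2 powr (p - 1)" using p1 by (intro powr_less_mono) auto
  ultimately show ?thesis by (simp add: crude_const_def)
qed

lemma err_eq: "err n = real n powr (p / (2 * q)) * sqrt (ln (real n))"
proof -
  have "p / (2 * q) = (p / q) / 2" by simp
  then show ?thesis by (simp only: exp_simps(2) err_def)
qed

end

theorem theorem1p4:
  fixes p q \<kappa> d :: real
  assumes "1 < p" and "p < 2"
    and "1 / p + 1 / q = 1"
    and "0 < \<kappa>" and "\<kappa> < 1 / (3 * p)"
    and "0 < d"
  shows "\<exists>C1 C2 C3 :: real. C1 > 0 \<and> C2 > 0 \<and> C3 > 0 \<and>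
    (\<forall>(n :: nat) (\<delta> :: real) (M :: 'a measure) (g :: nat \<Rightarrow> nat \<Rightarrow> 'a \<Rightarrow> real).
       n \<ge> 1 \<longrightarrow> real n powr (- \<kappa>) \<le> \<delta> \<longrightarrow> \<delta> \<le> 1 \<longrightarrow> gaussian_matrix M n g \<longrightarrow>
       \<P>(\<omega> in M.
           max_far_form n p q \<delta> (\<lambda>i j. g i j \<omega>)
             \<le> ereal (2 powr (1 / 2 - 2 / p) * (1 - C1 * \<delta> ^ 6) * gauss_xi q * real n powr (1 / q)
                 + C2 * real n powr (p / (2 * q)) * sqrt (ln (real n))))
         \<ge> 1 - C3 * real n powr (- d))"
proof -
  interpret conjugate_exponents p q by unfold_locales (use assms in auto)
  define A1 where "A1 = sqrt (2 * (3 + d))"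
  define A2 where "A2 = 4 + 8 * exp 2 + d"
  have A: "0 < A1" "0 < A2"
    using \<open>0 < d\<close> exp_gt_zero[of "2::real"] unfolding A1_def A2_def by (simp, linarith)
  have "1 / (3 * p) < 1 / p" using assms by (simp add: field_simps)
  then obtain n0 where n0: "3 \<le> n0" and large: "\<And>n. n0 \<le> n \<Longrightarrow> vec_max n A1 \<le> 1 / sqrt (real n) \<and> vec_max n A1 \<le> 1 / 8 \<and>
    vec_max n A1 * real n powr \<kappa> \<le> 1 / 200 \<and> (err n)\<^sup>2 \<le> real n"
    using large_dimension[of \<kappa> A1] assms A by auto
  obtain c where c: "0 < c" "c \<le> 1 / 2" "coord_const * c \<le> 1 / 32"
    "dist_coef c < 1 / 2" using small_constant by blast
  define C3 where "C3 = real n0 powr d + 2"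
  have C20: "0 < err_total A1 A2"
    unfolding err_total_def err_main_def using A crude_const_pos by (intro add_pos_pos mult_pos_pos) auto
  have main: "1 - C3 * real n powr (- d) \<le> \<P>(\<omega> in M. max_far_form n p q \<delta> (mat_at g \<omega>)
      \<le> ereal (2 powr (1 / 2 - 2 / p) * (1 - c\<^sup>2 * \<delta> ^ 6) * gauss_xi q * real n powr (1 / q)
          + err_total A1 A2 * real n powr (p / (2 * q)) * sqrt (ln (real n))))"
    if n: "1 \<le> n" and \<delta>: "real n powr (- \<kappa>) \<le> \<delta>" "\<delta> \<le> 1" and gm: "gaussian_matrix M n g"
    for n \<delta> and M :: "'a measure" and g
  proof (cases "n0 \<le> n")
    case False
    have "1 * 1 \<le> (real n0 / real n) powr d"
      using False n \<open>0 < d\<close> ge_one_powr_ge_zero[of "real n0 / real n" d] by simp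
    also have "\<dots> = real n0 powr d * real n powr (- d)" by (simp add: powr_divide powr_minus_divide)
    also have "\<dots> \<le> C3 * real n powr (- d)" by (intro mult_right_mono) (auto simp: C3_def)
    finally show ?thesis using measure_nonneg[of M] by (smt (verit))
  next
    case True
    interpret prob_space M using gm by (simp add: gaussian_matrix_def)
    have n3: "3 \<le> n" using True n0 by simp
    note lg = large[OF True]
    have "0 < real n powr (- \<kappa>)" using n by simp
    then have \<delta>0: "0 < \<delta>" using \<delta>(1) by linarith
    have V: "vec_max n A1 \<le> \<delta> / 200"
    proof -
      have "vec_max n A1 = vec_max n A1 * real n powr \<kappa> * real n powr (- \<kappa>)"
        using n by (simp add: mult.assoc flip: powr_add)
      also have "\<dots> \<le> 1 / 200 * real n powr (- \<kappa>)" using lg by (intro mult_right_mono) auto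
      also have "\<dots> \<le> 1 / 200 * \<delta>" using \<delta> by (intro mult_left_mono) auto
      finally show ?thesis by simp
    qed
    define b where "b = 2 powr (1 / 2 - 2 / p) * (1 - c\<^sup>2 * \<delta> ^ 6) * gauss_xi q * real n powr (1 / q)
          + err_total A1 A2 * real n powr (p / (2 * q)) * sqrt (ln (real n))"
    have b: "b = sqrt 2 * c0\<^sup>2 * (1 - c\<^sup>2 * \<delta> ^ 6) * gauss_norm n + err_total A1 A2 * err n"
      unfolding b_def c0(8) gauss_norm_def err_eq by (simp only: mult.assoc)
    define Sg where "Sg = {\<omega> \<in> space M. sign_bound n A1 (mat_at g \<omega>)}"
    define Yg where "Yg = {\<omega> \<in> space M. young_bound n A2 (mat_at g \<omega>)}"
    define Ev where "Ev = {\<omega> \<in> space M. max_far_form n p q \<delta> (mat_at g \<omega>) \<le> ereal b}"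
    have "space M - Sg = {\<omega> \<in> space M. \<not> sign_bound n A1 (mat_at g \<omega>)}" by (auto simp: Sg_def)
    then have Sg: "Sg \<in> sets M" "prob (space M - Sg) \<le> real n powr (- d)"
      using sign_bound_prob[OF gm n3 \<open>0 < d\<close>] by (simp_all only: Sg_def A1_def)
    have "space M - Yg = {\<omega> \<in> space M. \<not> young_bound n A2 (mat_at g \<omega>)}" by (auto simp: Yg_def)
    then have Yg: "Yg \<in> sets M" "prob (space M - Yg) \<le> real n powr (- d)"
      using young_bound_prob[OF gm n3 \<open>0 < d\<close>] lg by (simp_all only: Yg_def A2_def)
    have Ev: "Ev \<in> sets M" unfolding Ev_def by (rule max_far_form_measurable[OF gm n p1])
    have "Sg \<inter> Yg \<subseteq> Ev"
      unfolding Sg_def Yg_def Ev_def b using lg V n3 A c \<delta>0 \<delta> by (auto intro!: max_far_form_le)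
    then have "space M - Ev \<subseteq> (space M - Sg) \<union> (space M - Yg)" by blast
    then have "prob (space M - Ev) \<le> prob ((space M - Sg) \<union> (space M - Yg))"
      using Sg Yg by (intro finite_measure_mono) auto
    also have "\<dots> \<le> prob (space M - Sg) + prob (space M - Yg)" using Sg Yg by (intro measure_Un_le) auto
    also have "\<dots> \<le> 2 * real n powr (- d)" using Sg Yg by simp
    finally have "1 - 2 * real n powr (- d) \<le> prob Ev" using Ev by (simp add: prob_compl)
    moreover have "2 * real n powr (- d) \<le> C3 * real n powr (- d)" by (intro mult_right_mono) (auto simp: C3_def)
    ultimately have "1 - C3 * real n powr (- d) \<le> prob Ev" by linarith
    then show ?thesis unfolding Ev_def b_def .
  qed
  have "0 < c\<^sup>2" "0 < C3" using c by (auto simp: C3_def intro: add_nonneg_pos)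
  then show ?thesis using C20 main by (intro exI[of _ "c\<^sup>2"] exI[of _ "err_total A1 A2"] exI[of _ C3]) auto
qed

end
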